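(* Let $p,q,r\in\mathbb{N}$ and consider the hidden Markov model $$X_t=X_0+\int_0^tb(X_s)\,ds+\int_0^t\sigma(X_s)\,dW_s,\qquad Y_t=\int_0^th(X_s)\,ds+DV_t,\qquad t\ge0,$$ where $W$ and $V$ are independent $p$- and $r$-dimensional Wiener processes, independent of $X_0$, and $D\in\mathbb{R}^{q\times r}$, $b:\mathbb{R}^q\to\mathbb{R}^q$, $\sigma:\mathbb{R}^q\to\mathbb{R}^{q\times p}$, $h:\mathbb{R}^q\to\mathbb{R}^q$ satisfy: 1. $b$ is globally Lipschitz continuous; 2. $\sigma$ is globally Lipschitz continuous and bounded; 3. $h(x)=Cx+h_0(x)$, where $C\in\mathbb{R}^{q\times q}$ is an invertible matrix and $h_0:\mathbb{R}^q\to\mathbb{R}^q$ satisfies $\|C^{-1}h_0\|_L<1$. Denote by $\mathbf{P}^\mu$ the law of $(X_t,Y_t)_{t\ge0}$ when $X_0\sim\mu\in P(\mathbb{R}^q)$. Then the model is uniformly observable: for all sequences $\{\mu_n\},\{\nu_n\}\subset P(\mathbb{R}^q)$, $$\|\mathbf{P}^{\mu_n}|_{\mathcal{F}^Y}-\mathbf{P}^{\nu_n}|_{\mathcal{F}^Y}\|_{\mathrm{TV}}\xrightarrow{n\to\infty}0\quad\text{implies}\quad\|\mu_n-\nu_n\|_{\mathrm{BL}}\xrightarrow{n\to\infty}0.$$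
   Context: $P(\mathbb{R}^q)$ is the set of Borel probability measures on $\mathbb{R}^q$. $\|g\|_L=\sup_{x\ne y}\|g(x)-g(y)\|/\|x-y\|$ is the Lipschitz constant (Euclidean norms). $\mathcal F^Y$ is the $\sigma$-field generated by the observation process $(Y_t)_{t\ge0}$ (completed), so $\mathbf{P}^\mu|_{\mathcal F^Y}$ is the law of the path $(Y_t)_{t\ge0}$ when $X_0\sim\mu$. $\|\cdot\|_{\mathrm{TV}}$ is total variation distance, normalized as the supremum of differences of integrals of measurable functions with absolute value at most $1$. $\|\mu-\nu\|_{\mathrm{BL}}=\sup|\int f\,d\mu-\int f\,d\nu|$, the supremum being over all $f:\mathbb{R}^q\to\mathbb{R}$ with $\|f\|_\infty\le1$ and $\|f\|_L\le1$. Under the stated conditions the equations are well posed (in law), so $\mathbf{P}^\mu$ is well defined. *)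

theory Defs
  imports "HOL-Probability.Probability"
begin

section \<open>Norms\<close>

definition lip_norm :: "('a::metric_space \<Rightarrow> 'b::metric_space) \<Rightarrow> ennreal" where
  "lip_norm g = (SUP (x, y)\<in>{(x, y). x \<noteq> y}. ennreal (dist (g x) (g y) / dist x y))"

definition bl_dist :: "'a::metric_space measure \<Rightarrow> 'a measure \<Rightarrow> real" where
  "bl_dist \<mu> \<nu> =
    (SUP f\<in>{f :: 'a \<Rightarrow> real. (\<forall>x. \<bar>f x\<bar> \<le> 1) \<and> lip_norm f \<le> 1}. \<bar>(\<integral>x. f x \<partial>\<mu>) - (\<integral>x. f x \<partial>\<nu>)\<bar>)"

text \<open>Meant for probability measures with the same measurable sets; the values lie in [0, 2].\<close>

definition tv_dist :: "'a measure \<Rightarrow> 'a measure \<Rightarrow> real" where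
  "tv_dist P Q =
    (SUP f\<in>{f \<in> borel_measurable P. \<forall>x\<in>space P. \<bar>f x\<bar> \<le> 1}. \<bar>(\<integral>x. f x \<partial>P) - (\<integral>x. f x \<partial>Q)\<bar>)"

definition borel_prob :: "'a::topological_space measure set" where
  "borel_prob = {\<mu>. prob_space \<mu> \<and> sets \<mu> = sets borel}"


section \<open>Processes\<close>

text \<open>A process is a function of type \<open>real \<Rightarrow> 'w \<Rightarrow> 'a\<close>, of which only the times in
  \<open>{0..}\<close> matter.\<close>

definition sample_path :: "real set \<Rightarrow> (real \<Rightarrow> 'w \<Rightarrow> 'a) \<Rightarrow> 'w \<Rightarrow> real \<Rightarrow> 'a" where
  "sample_path I Z \<omega> = (\<lambda>t\<in>I. Z t \<omega>)"

abbreviation path_space :: "real set \<Rightarrow> (real \<Rightarrow> 'a::topological_space) measure" where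
  "path_space I \<equiv> PiM I (\<lambda>_. borel)"

definition wiener_process :: "'w measure \<Rightarrow> (real \<Rightarrow> 'w \<Rightarrow> real^'d) \<Rightarrow> bool" where
  "wiener_process M W \<longleftrightarrow>
    (\<forall>t\<ge>0. W t \<in> borel_measurable M) \<and>
    (AE \<omega> in M. W 0 \<omega> = 0) \<and>
    (AE \<omega> in M. continuous_on {0..} (\<lambda>t. W t \<omega>)) \<and>
    (\<forall>s t. 0 \<le> s \<and> s < t \<longrightarrow>
      distributed M lborel (\<lambda>\<omega>. W t \<omega> - W s \<omega>)
        (\<lambda>x. \<Prod>i\<in>UNIV. normal_density 0 (sqrt (t - s)) (x $ i)) \<and>
      prob_space.indep_set M
        (sets (vimage_algebra (space M) (sample_path {0..s} W) (path_space {0..s})))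
        (sets (vimage_algebra (space M) (\<lambda>\<omega>. W t \<omega> - W s \<omega>) borel)))"

text \<open>The filtration generated by an initial value and a process, augmented by the null sets.\<close>

definition augmented_filtration ::
  "'w measure \<Rightarrow> ('w \<Rightarrow> 'a::topological_space) \<Rightarrow> (real \<Rightarrow> 'w \<Rightarrow> 'b::topological_space) \<Rightarrow> real \<Rightarrow> 'w measure"
where
  "augmented_filtration M \<xi> W t = sigma (space M)
    ({\<xi> -` A \<inter> space M | A. A \<in> sets borel} \<union>
     {W s -` A \<inter> space M | s A. 0 \<le> s \<and> s \<le> t \<and> A \<in> sets borel} \<union>
     null_sets M)"


section \<open>The Ito integral\<close>

text \<open>\<open>(m, \<tau>, \<xi>)\<close> stands for the simple process
  \<open>\<Sum>k<m. 1\<^bsub>(\<tau> k, \<tau> (k + 1)]\<^esub> \<xi> k\<close> on the time interval \<open>{0..T}\<close>.\<close>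

definition simple_integrand ::
  "'w measure \<Rightarrow> (real \<Rightarrow> 'w measure) \<Rightarrow> real \<Rightarrow> nat \<Rightarrow> (nat \<Rightarrow> real) \<Rightarrow> (nat \<Rightarrow> 'w \<Rightarrow> real^'p^'q) \<Rightarrow> bool"
where
  "simple_integrand M F T m \<tau> \<xi> \<longleftrightarrow>
    (\<forall>k\<le>m. 0 \<le> \<tau> k \<and> \<tau> k \<le> T) \<and> (\<forall>k<m. \<tau> k \<le> \<tau> (Suc k)) \<and>
    (\<forall>k<m. \<xi> k \<in> borel_measurable (F (\<tau> k))) \<and>
    (\<exists>B. \<forall>k<m. \<forall>\<omega>\<in>space M. norm (\<xi> k \<omega>) \<le> B)"

definition simple_process ::
  "nat \<Rightarrow> (nat \<Rightarrow> real) \<Rightarrow> (nat \<Rightarrow> 'w \<Rightarrow> real^'p^'q) \<Rightarrow> real \<Rightarrow> 'w \<Rightarrow> real^'p^'q"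
where
  "simple_process m \<tau> \<xi> s \<omega> = (\<Sum>k<m. indicat_real {\<tau> k<..\<tau> (Suc k)} s *\<^sub>R \<xi> k \<omega>)"

definition simple_ito_integral ::
  "(real \<Rightarrow> 'w \<Rightarrow> real^'p) \<Rightarrow> nat \<Rightarrow> (nat \<Rightarrow> real) \<Rightarrow> (nat \<Rightarrow> 'w \<Rightarrow> real^'p^'q) \<Rightarrow> 'w \<Rightarrow> real^'q"
where
  "simple_ito_integral W m \<tau> \<xi> \<omega> = (\<Sum>k<m. \<xi> k \<omega> *v (W (\<tau> (Suc k)) \<omega> - W (\<tau> k) \<omega>))"

text \<open>\<open>I\<close> is (a version of) \<open>\<integral>\<^sub>0\<^sup>T H dW\<close>: the \<open>L\<^sup>2\<close>-limit of the integrals of simple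
  processes approximating \<open>H\<close> in \<open>L\<^sup>2(dt \<times> M)\<close>. By the Ito isometry \<open>I\<close> is unique up to
  null sets and does not depend on the approximating sequence.\<close>

definition has_ito_integral ::
  "'w measure \<Rightarrow> (real \<Rightarrow> 'w measure) \<Rightarrow> (real \<Rightarrow> 'w \<Rightarrow> real^'p) \<Rightarrow> (real \<Rightarrow> 'w \<Rightarrow> real^'p^'q) \<Rightarrow>
   real \<Rightarrow> ('w \<Rightarrow> real^'q) \<Rightarrow> bool"
where
  "has_ito_integral M F W H T I \<longleftrightarrow>
    I \<in> borel_measurable M \<and>
    (\<exists>m \<tau> \<xi>.
      (\<forall>n. simple_integrand M F T (m n) (\<tau> n) (\<xi> n)) \<and>
      (\<lambda>n. \<integral>\<^sup>+\<omega>. (\<integral>\<^sup>+s\<in>{0..T}. ennreal ((norm (H s \<omega> - simple_process (m n) (\<tau> n) (\<xi> n) s \<omega>))\<^sup>2)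
              \<partial>lborel) \<partial>M) \<longlonglongrightarrow> 0 \<and>
      (\<lambda>n. \<integral>\<^sup>+\<omega>. ennreal ((norm (I \<omega> - simple_ito_integral W (m n) (\<tau> n) (\<xi> n) \<omega>))\<^sup>2) \<partial>M)
        \<longlonglongrightarrow> 0)"


section \<open>The hidden Markov model\<close>

text \<open>Stochastic integrals are taken with respect to the augmented filtration of
  \<open>(X\<^sub>0, W)\<close>. For Lipschitz coefficients the signal equation is pathwise unique and has a strong
  solution, so adaptedness to this filtration excludes no weak solution.\<close>

definition hmm_solution ::
  "(real^'q \<Rightarrow> real^'q) \<Rightarrow> (real^'q \<Rightarrow> real^'p^'q) \<Rightarrow> (real^'q \<Rightarrow> real^'q) \<Rightarrow> real^'r^'q \<Rightarrow>
   'w measure \<Rightarrow> (real \<Rightarrow> 'w \<Rightarrow> real^'p) \<Rightarrow> (real \<Rightarrow> 'w \<Rightarrow> real^'r) \<Rightarrow>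
   (real \<Rightarrow> 'w \<Rightarrow> real^'q) \<Rightarrow> (real \<Rightarrow> 'w \<Rightarrow> real^'q) \<Rightarrow> bool"
where
  "hmm_solution b \<sigma> h D M W V X Y \<longleftrightarrow>
    prob_space M \<and> wiener_process M W \<and> wiener_process M V \<and> X 0 \<in> borel_measurable M \<and>
    prob_space.indep_sets M
      (\<lambda>i::nat. [sets (vimage_algebra (space M) (X 0) borel),
                 sets (vimage_algebra (space M) (sample_path {0..} W) (path_space {0..})),
                 sets (vimage_algebra (space M) (sample_path {0..} V) (path_space {0..}))] ! i) {0, 1, 2} \<and>
    (\<forall>t\<ge>0. X t \<in> borel_measurable (augmented_filtration M (X 0) W t)) \<and>
    (\<forall>t\<ge>0. Y t \<in> borel_measurable M) \<and>
    (AE \<omega> in M. continuous_on {0..} (\<lambda>t. X t \<omega>)) \<and>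
    (\<forall>t\<ge>0. \<exists>I. has_ito_integral M (augmented_filtration M (X 0) W) W (\<lambda>s \<omega>. \<sigma> (X s \<omega>)) t I \<and>
      (AE \<omega> in M. X t \<omega> = X 0 \<omega> + integral {0..t} (\<lambda>s. b (X s \<omega>)) + I \<omega>)) \<and>
    (AE \<omega> in M. \<forall>t\<ge>0. Y t \<omega> = integral {0..t} (\<lambda>s. h (X s \<omega>)) + D *v V t \<omega>)"

text \<open>\<open>P\<close> is the law of \<open>(X\<^sub>t, Y\<^sub>t)\<^sub>t\<close> when \<open>X\<^sub>0\<close> has law \<open>\<mu>\<close>. The type argument is the type
  of outcomes of the probability space carrying the solution.\<close>

definition is_hmm_law ::
  "'w itself \<Rightarrow> (real^'q \<Rightarrow> real^'q) \<Rightarrow> (real^'q \<Rightarrow> real^'p^'q) \<Rightarrow> (real^'q \<Rightarrow> real^'q) \<Rightarrow> real^'r^'q \<Rightarrow>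
   (real^'q) measure \<Rightarrow> (real \<Rightarrow> (real^'q) \<times> (real^'q)) measure \<Rightarrow> bool"
where
  "is_hmm_law _ b \<sigma> h D \<mu> P \<longleftrightarrow>
    (\<exists>(M :: 'w measure) W V X Y.
      hmm_solution b \<sigma> h D M W V X Y \<and>
      distr M borel (X 0) = \<mu> \<and>
      P = distr M (path_space {0..}) (sample_path {0..} (\<lambda>t \<omega>. (X t \<omega>, Y t \<omega>))))"

text \<open>The \<open>\<sigma>\<close>-field on the canonical path space generated by the observations. Completing it
  would not change total variation distances.\<close>

definition obs_algebra :: "(real \<Rightarrow> (real^'q) \<times> (real^'q)) measure" where
  "obs_algebra = vimage_algebra (space (path_space {0..}))
    (sample_path {0..} (\<lambda>t z. snd (z t))) (path_space {0..})"

end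

theory Submission
  imports Defs "HOL-Real_Asymp.Real_Asymp"
begin

text \<open>
  Fix a small time \<open>t\<close> and write \<open>C\<^sup>-\<^sup>1 h = id + k\<close> with \<open>k\<close> a strict contraction. Then
  \<open>C\<^sup>-\<^sup>1 Y\<^sub>t / t = Z + C\<^sup>-\<^sup>1 D V\<^sub>t / t\<close>, where \<open>Z\<close> is the time average of \<open>X + k(X)\<close> over \<open>[0, t]\<close>.
  Comparing two paths pathwise shows that \<open>|x 0 - y 0|\<close> is bounded by a constant multiple of
  \<open>|Z x - Z y|\<close> plus the mean size of the noises \<open>x s - x 0 - \<integral>\<^sub>0\<^sup>s b(x)\<close>, which is of order
  \<open>sqrt t\<close> in expectation, uniformly in the initial law, because \<open>\<sigma>\<close> is bounded. Hence every bounded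
  Lipschitz function of \<open>X\<^sub>0\<close> is, up to \<open>O(sqrt t)\<close>, a bounded Lipschitz function of \<open>Z\<close>.

  The observation noise is of order \<open>1 / sqrt t\<close> and has to be removed by deconvolution. With \<open>\<gamma>\<^sub>t\<close>
  the centred Gaussian density of variance \<open>t\<close>, completing the square gives \<open>\<gamma>\<^sub>t * (\<gamma>\<^sub>t cos(l \<cdot>))
  = exp(- l\<^sup>2 t / 4) \<gamma>\<^sub>2\<^sub>t cos(l \<cdot> / 2)\<close>. So \<open>\<gamma>\<^sub>2\<^sub>t(y) cos(a y / sqrt n)\<^sup>n\<close>, a combination of such
  functions, has an integrable preimage under convolution with \<open>\<gamma>\<^sub>t\<close>; as \<open>n \<rightarrow> \<infinity>\<close> it converges in
  \<open>L\<^sup>1\<close> to \<open>\<gamma>\<^sub>2\<^sub>t(y) exp(- a\<^sup>2 y\<^sup>2 / 2)\<close>, a multiple of a Gaussian density that is as narrow as desired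
  for large \<open>a\<close>. Thus a bounded Lipschitz function of \<open>Z\<close> is uniformly approximated by the conditional
  expectation of a bounded function of \<open>Y\<^sub>t\<close>, with a bound that does not depend on the initial law,
  and total variation convergence of the observations applies.
\<close>

section \<open>Gaussian deconvolution\<close>

text \<open>These are the real and imaginary parts of the characteristic function of the standard
  normal law.\<close>

lemma std_normal_cos_sin:
  fixes u :: real
  shows "(\<integral>x. std_normal_density x * cos (u * x) \<partial>lborel) = exp (- u\<^sup>2 / 2)"
    and "(\<integral>x. std_normal_density x * sin (u * x) \<partial>lborel) = 0"
proof -
  have int: "integrable std_normal_distribution (\<lambda>x. iexp (u * x))"
    by (intro finite_measure.integrable_const_bound[where B=1] prob_space.finite_measure
        prob_space_normal_density) auto
  have *: "(CLINT x|std_normal_distribution. iexp (u * x)) = complex_of_real (exp (- u\<^sup>2 / 2))"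
    using fun_cong[OF char_std_normal_distribution, of u] by (simp add: char_def)
  have "(\<integral>x. cos (u * x) \<partial>std_normal_distribution) = exp (- u\<^sup>2 / 2)"
    using integral_Re[OF int] arg_cong[OF *, of Re] by (simp add: Re_exp Im_exp)
  moreover have "(\<integral>x. sin (u * x) \<partial>std_normal_distribution) = 0"
    using integral_Im[OF int] arg_cong[OF *, of Im] by (simp add: Re_exp Im_exp)
  ultimately show "(\<integral>x. std_normal_density x * cos (u * x) \<partial>lborel) = exp (- u\<^sup>2 / 2)"
    and "(\<integral>x. std_normal_density x * sin (u * x) \<partial>lborel) = 0"
    by (simp_all add: integral_density)
qed

lemma normal_density_cos_integrable:
  "integrable lborel (\<lambda>x. normal_density m s x * cos (u * x))" if "s > 0"
  by (rule Bochner_Integration.integrable_bound[OF integrable_normal_density[OF that, of m]])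
    (auto simp: abs_mult mult_left_le)

lemma std_normal_sin_integrable:
  "integrable lborel (\<lambda>x. std_normal_density x * sin (u * x))"
  by (rule Bochner_Integration.integrable_bound[OF integrable_normal_density[of 1 0]])
    (auto simp: abs_mult mult_left_le)

text \<open>An affine substitution reduces to the standard normal. After the addition formula the
  sine integral vanishes, which leaves the phase at the mean, damped according to the
  variance.\<close>

lemma integral_normal_density_cos:
  assumes "v > 0"
  shows "(\<integral>x. normal_density m (sqrt v) x * cos (u * x) \<partial>lborel) = cos (u * m) * exp (- u\<^sup>2 * v / 2)"
proof -
  have nd: "sqrt v * normal_density m (sqrt v) (m + sqrt v * x) = std_normal_density x" for x
    using assms by (simp add: normal_density_def real_sqrt_mult field_simps)
  have "(\<integral>x. normal_density m (sqrt v) x * cos (u * x) \<partial>lborel) =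
      (\<integral>x. std_normal_density x * (cos (u * m) * cos (u * sqrt v * x) - sin (u * m) * sin (u * sqrt v * x)) \<partial>lborel)"
    using assms by (subst lborel_integral_real_affine[where c="sqrt v" and t=m])
      (simp_all add: nd[symmetric] cos_add distrib_left mult_ac flip: integral_mult_right_zero)
  also have "\<dots> = (\<integral>x. cos (u * m) * (std_normal_density x * cos (u * sqrt v * x))
       - sin (u * m) * (std_normal_density x * sin (u * sqrt v * x)) \<partial>lborel)"
    by (intro Bochner_Integration.integral_cong) (simp_all add: algebra_simps)
  also have "\<dots> = cos (u * m) * (\<integral>x. std_normal_density x * cos (u * sqrt v * x) \<partial>lborel)
       - sin (u * m) * (\<integral>x. std_normal_density x * sin (u * sqrt v * x) \<partial>lborel)"
    by (subst Bochner_Integration.integral_diff)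
      (auto intro!: integrable_mult_right normal_density_cos_integrable std_normal_sin_integrable)
  finally show ?thesis
    using assms by (simp add: std_normal_cos_sin power_mult_distrib)
qed

text \<open>Completing the square in \<open>z\<close>. In probabilistic terms: if two independent
  centred Gaussians of variance \<open>t\<close> have sum \<open>y\<close>, then the sum has
  variance \<open>2 * t\<close>, and given \<open>y\<close> each of them has mean
  \<open>y / 2\<close> and variance \<open>t / 2\<close>.\<close>

lemma normal_density_mult:
  assumes "t > 0"
  shows "normal_density 0 (sqrt t) (y - z) * normal_density 0 (sqrt t) z =
    normal_density 0 (sqrt (2 * t)) y * normal_density (y / 2) (sqrt (t / 2)) z"
proof -
  have "- (y - z)\<^sup>2 / (2 * t) + - z\<^sup>2 / (2 * t) = - y\<^sup>2 / (2 * (2 * t)) + - (z - y / 2)\<^sup>2 / (2 * (t / 2))"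
    using assms by (simp add: field_simps power2_eq_square)
  then have "exp (- (y - z)\<^sup>2 / (2 * t)) * exp (- z\<^sup>2 / (2 * t)) =
      exp (- y\<^sup>2 / (2 * (2 * t))) * exp (- (z - y / 2)\<^sup>2 / (2 * (t / 2)))"
    by (simp only: mult_exp_exp)
  moreover have "sqrt (2 * pi * (2 * t)) * sqrt (2 * pi * (t / 2)) = sqrt (2 * pi * t) * sqrt (2 * pi * t)"
    unfolding real_sqrt_mult[symmetric] by (simp add: field_simps)
  ultimately show ?thesis
    using assms by (simp add: normal_density_def)
qed

section \<open>Functions with an explicit preimage under Gaussian convolution\<close>

text \<open>Binomial weights of \<open>cos ^ n\<close>, each multiplied by the inverse of the
  damping that convolution with the Gaussian of variance \<open>t\<close> inflicts on the frequency
  \<open>2 * b * (n - 2 * k)\<close>. The factor 2 in the frequency is there because the convolution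
  halves it.\<close>

definition damped_cos_coeff :: "nat \<Rightarrow> real \<Rightarrow> real \<Rightarrow> nat \<Rightarrow> real" where
  "damped_cos_coeff n t b k = real (n choose k) / 2 ^ n * exp ((2 * b * (real n - 2 * real k))\<^sup>2 * t / 4)"

definition deconv_kernel :: "nat \<Rightarrow> real \<Rightarrow> real \<Rightarrow> real \<Rightarrow> real" where
  "deconv_kernel n t b z = (\<Sum>k\<le>n. damped_cos_coeff n t b k *
     (normal_density 0 (sqrt t) z * cos (2 * b * (real n - 2 * real k) * z)))"

text \<open>Binomial theorem for \<open>(cis x + cis (- x)) / 2\<close>, read off in the real
  part.\<close>

lemma cos_power_expand:
  "cos (x::real) ^ n = (\<Sum>k\<le>n. real (n choose k) / 2 ^ n * cos ((real n - 2 * real k) * x))"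
proof -
  have "complex_of_real (cos x ^ n) = ((cis x + cis (- x)) / 2) ^ n"
    by (simp add: complex_eq_iff cis.ctr flip: of_real_power)
  also have "\<dots> = (\<Sum>k\<le>n. of_nat (n choose k) * cis (- x) ^ k * cis x ^ (n - k)) / 2 ^ n"
    by (simp add: power_divide add.commute[of "cis x"] binomial_ring)
  also have "\<dots> = (\<Sum>k\<le>n. of_real (real (n choose k) / 2 ^ n) * cis ((real n - 2 * real k) * x))"
    unfolding sum_divide_distrib
  proof (intro sum.cong refl)
    fix k assume k: "k \<in> {..n}"
    have "cis (- x) ^ k * cis x ^ (n - k) = cis ((real n - 2 * real k) * x)"
      unfolding Complex.DeMoivre cis_mult by (rule arg_cong[where f=cis]) (use k in \<open>simp add: of_nat_diff algebra_simps\<close>)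
    then show "of_nat (n choose k) * cis (- x) ^ k * cis x ^ (n - k) / 2 ^ n =
        of_real (real (n choose k) / 2 ^ n) * cis ((real n - 2 * real k) * x)"
      by (simp add: mult.assoc)
  qed
  finally have "Re (complex_of_real (cos x ^ n)) = Re (\<Sum>k\<le>n. of_real (real (n choose k) / 2 ^ n) * cis ((real n - 2 * real k) * x))"
    by (rule arg_cong)
  then show ?thesis by simp
qed

lemma deconv_kernel_integrable: "t > 0 \<Longrightarrow> integrable lborel (deconv_kernel n t b)"
  unfolding deconv_kernel_def
  by (intro Bochner_Integration.integrable_sum integrable_mult_right normal_density_cos_integrable) auto

text \<open>By \<open>normal_density_mult\<close> each summand turns into a cosine integral against
  a Gaussian with mean \<open>y / 2\<close>. Its damping cancels the exponential in
  \<open>damped_cos_coeff\<close>, and the remaining binomial sum is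
  \<open>cos (b * y) ^ n\<close>.\<close>

lemma deconv_kernel_conv:
  assumes "t > 0"
  shows "(\<integral>z. normal_density 0 (sqrt t) (y - z) * deconv_kernel n t b z \<partial>lborel) =
    normal_density 0 (sqrt (2 * t)) y * cos (b * y) ^ n"
proof -
  define l where "l k = 2 * b * (real n - 2 * real k)" for k
  have arg: "l k * (y / 2) = (real n - 2 * real k) * (b * y)" for k
    by (simp add: l_def)
  have "(\<integral>z. normal_density 0 (sqrt t) (y - z) * deconv_kernel n t b z \<partial>lborel) =
    (\<integral>z. (\<Sum>k\<le>n. (damped_cos_coeff n t b k * normal_density 0 (sqrt (2 * t)) y) *
       (normal_density (y / 2) (sqrt (t / 2)) z * cos (l k * z))) \<partial>lborel)"
    using normal_density_mult[OF assms, of y] unfolding deconv_kernel_def l_def sum_distrib_left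
    by (intro Bochner_Integration.integral_cong sum.cong) (auto simp: algebra_simps)
  also have "\<dots> = (\<Sum>k\<le>n. (damped_cos_coeff n t b k * normal_density 0 (sqrt (2 * t)) y) *
       (cos (l k * (y / 2)) * exp (- (l k)\<^sup>2 * (t / 2) / 2)))"
    using assms by (subst Bochner_Integration.integral_sum)
      (auto intro!: integrable_mult_right normal_density_cos_integrable simp: integral_normal_density_cos)
  also have "\<dots> = normal_density 0 (sqrt (2 * t)) y * (\<Sum>k\<le>n. real (n choose k) / 2 ^ n * cos ((real n - 2 * real k) * (b * y)))"
    unfolding sum_distrib_left
    by (intro sum.cong) (simp_all only: arg, simp_all add: damped_cos_coeff_def l_def exp_minus field_simps)
  finally show ?thesis by (simp add: cos_power_expand)
qed

text \<open>This is the central limit theorem for symmetric signs, stated for characteristic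
  functions. It turns the powers of cosines into a Gaussian factor.\<close>

lemma cos_power_tendsto: "(\<lambda>n. cos (a / sqrt (real n) * y) ^ n) \<longlonglongrightarrow> exp (- (a * y)\<^sup>2 / 2)"
proof -
  have "(\<lambda>n. cos (c / sqrt (real n)) ^ n) \<longlonglongrightarrow> exp (- c\<^sup>2 / 2)" if "c \<noteq> 0" for c :: real
  proof -
    have "((\<lambda>x::real. cos (c / sqrt x) powr x) \<longlongrightarrow> exp (- c\<^sup>2 / 2)) at_top"
      using that by (real_asymp simp: power2_eq_square)
    then have "(\<lambda>n. cos (c / sqrt (real n)) powr real n) \<longlonglongrightarrow> exp (- c\<^sup>2 / 2)"
      by (rule filterlim_compose[OF _ filterlim_real_sequentially])
    \<comment> \<open>\<open>powr\<close> agrees with the natural power only for a positive base,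
      which holds once \<open>c / sqrt n\<close> is small.\<close>
    moreover have "\<forall>\<^sub>F n in sequentially. cos (c / sqrt (real n)) > 0"
      using that by real_asymp
    then have "\<forall>\<^sub>F n in sequentially. cos (c / sqrt (real n)) powr real n = cos (c / sqrt (real n)) ^ n"
      by eventually_elim (simp add: powr_realpow)
    ultimately show ?thesis
      by (rule Lim_transform_eventually)
  qed
  from this[of "a * y"] show ?thesis
    by (cases "a * y = 0") (auto simp: mult.commute)
qed

section \<open>Centred product Gaussians and their moments\<close>

text \<open>The parameter \<open>s\<close> is the variance of each coordinate, so this is the
  density of a Wiener increment over a time span of length \<open>s\<close>.\<close>

definition gauss :: "real \<Rightarrow> real^'n \<Rightarrow> real" where
  "gauss s x = (\<Prod>i\<in>UNIV. normal_density 0 (sqrt s) (x $ i))"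

lemma gauss_nonneg [simp]: "0 \<le> gauss s x"
  by (simp add: gauss_def prod_nonneg)

lemma gauss_measurable [measurable]: "gauss s \<in> borel_measurable borel"
  unfolding gauss_def by measurable

text \<open>Lebesgue measure on vectors is the image of a product measure indexed by
  \<open>Basis\<close>. Reindexing the coordinates by the axis vectors makes Fubini for product
  functions applicable.\<close>

lemma lborel_vec_prod:
  fixes f :: "'n::finite \<Rightarrow> real \<Rightarrow> real"
  assumes f: "\<And>i. integrable lborel (f i)"
  shows "integrable lborel (\<lambda>x::real^'n. \<Prod>i\<in>UNIV. f i (x $ i))" (is ?A)
    and "(\<integral>(x::real^'n). (\<Prod>i\<in>UNIV. f i (x $ i)) \<partial>lborel) = (\<Prod>i\<in>UNIV. \<integral>u. f i u \<partial>lborel)" (is ?B)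
proof -
  interpret product_sigma_finite "\<lambda>_::real^'n. lborel :: real measure"
    by standard
  define a :: "'n \<Rightarrow> real^'n" where "a i = axis i 1" for i
  have inj: "inj a"
    by (auto simp: inj_def a_def axis_eq_axis)
  have Basis: "Basis = range a"
    by (auto simp: a_def Basis_vec_def)
  have aB: "a i \<in> Basis" for i
    by (simp add: Basis)
  define F where "F b = f (inv a b)" for b
  have F: "integrable lborel (F b)" for b
    by (simp add: F_def f)
  have comp: "(\<Sum>b\<in>Basis. w b *\<^sub>R b) $ i = w (a i)" for w i
    using inner_sum_left_Basis[of "a i" w] aB by (simp add: cart_eq_inner_axis flip: a_def)
  have prod: "(\<Prod>i\<in>UNIV. f i (w (a i))) = (\<Prod>b\<in>Basis. F b (w b))" for w
    unfolding Basis by (subst prod.reindex) (auto simp: F_def inj)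
  have [measurable]: "f i \<in> borel_measurable borel" for i
    using borel_measurable_integrable[OF f] by simp
  have [measurable]: "(\<lambda>x::real^'n. \<Prod>i\<in>UNIV. f i (x $ i)) \<in> borel_measurable borel"
    by measurable
  show ?A
    unfolding lborel_eq[where 'a="real^'n"]
    by (subst integrable_distr_eq) (simp_all only: comp prod, auto intro!: product_integrable_prod F)
  have "(\<integral>(x::real^'n). (\<Prod>i\<in>UNIV. f i (x $ i)) \<partial>lborel) = (\<Prod>b\<in>Basis. \<integral>u. F b u \<partial>lborel)"
    unfolding lborel_eq[where 'a="real^'n"]
    by (subst integral_distr) (simp_all only: comp prod, auto intro!: product_integral_prod F)
  also have "\<dots> = (\<Prod>i\<in>UNIV. \<integral>u. f i u \<partial>lborel)"
    unfolding Basis by (subst prod.reindex) (auto simp: F_def inj)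
  finally show ?B .
qed

lemma gauss_integrable: "s > 0 \<Longrightarrow> integrable lborel (gauss s :: real^'n \<Rightarrow> real)"
  unfolding gauss_def by (rule lborel_vec_prod) auto

lemma gauss_integral: "s > 0 \<Longrightarrow> (\<integral>x. gauss s (x :: real^'n) \<partial>lborel) = 1"
  unfolding gauss_def by (subst lborel_vec_prod) auto

lemma gauss_component_moment:
  fixes j :: "'n::finite"
  assumes "s > 0"
  shows "integrable lborel (\<lambda>x. (x $ j) ^ k * gauss s x)"
    and "(\<integral>x. (x $ j) ^ k * gauss s x \<partial>lborel) = (\<integral>u. normal_density 0 (sqrt s) u * u ^ k \<partial>lborel)"
proof -
  \<comment> \<open>The power is absorbed into the \<open>j\<close>-th factor, so that the integrand
    is again a product over coordinates.\<close>
  define f where "f i u = normal_density 0 (sqrt s) u * (if i = j then u ^ k else 1)" for i u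
  have int: "integrable lborel (f i)" for i
    using integrable_normal_moment[of "sqrt s" 0 k] assms by (cases "i = j") (auto simp: f_def[abs_def])
  have eq: "(x $ j) ^ k * gauss s x = (\<Prod>i\<in>UNIV. f i (x $ i))" for x
    by (simp add: f_def gauss_def prod.distrib)
  show "integrable lborel (\<lambda>x. (x $ j) ^ k * gauss s x)"
    unfolding eq by (rule lborel_vec_prod) (rule int)
  have "(\<integral>x. (x $ j) ^ k * gauss s x \<partial>lborel) = (\<Prod>i\<in>UNIV. \<integral>u. f i u \<partial>lborel)"
    unfolding eq by (rule lborel_vec_prod) (rule int)
  also have "\<dots> = (\<Prod>i\<in>UNIV. if i = j then (\<integral>u. normal_density 0 (sqrt s) u * u ^ k \<partial>lborel) else 1)"
    using assms by (intro prod.cong) (auto simp: f_def[abs_def])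
  finally show "(\<integral>x. (x $ j) ^ k * gauss s x \<partial>lborel) = (\<integral>u. normal_density 0 (sqrt s) u * u ^ k \<partial>lborel)"
    by simp
qed

lemma gauss_mean:
  assumes "s > 0"
  shows "integrable lborel (\<lambda>x. gauss s x * (x $ j))" and "(\<integral>x. gauss s x * (x $ j) \<partial>lborel) = 0"
  using gauss_component_moment[OF assms, where k=1 and j=j] integral_normal_moment_nz_1[of "sqrt s" 0] assms
  by (simp_all add: mult.commute)

lemma gauss_second_moment:
  assumes "s > 0"
  shows "integrable lborel (\<lambda>x :: real^'n. gauss s x * (norm x)\<^sup>2)"
    and "(\<integral>(x::real^'n). gauss s x * (norm x)\<^sup>2 \<partial>lborel) = real CARD('n) * s"
proof -
  have sq: "(norm x)\<^sup>2 = (\<Sum>i\<in>UNIV. (x $ i)\<^sup>2)" for x :: "real^'n"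
    by (simp add: norm_vec_def L2_set_def sum_nonneg)
  have eq: "gauss s x * (norm x)\<^sup>2 = (\<Sum>j\<in>UNIV. (x $ j)\<^sup>2 * gauss s x)" for x :: "real^'n"
    by (simp add: sq sum_distrib_left mult.commute)
  have m: "(\<integral>u. normal_density 0 (sqrt s) u * u ^ 2 \<partial>lborel) = s"
    using integral_normal_moment_even[of "sqrt s" 0 1] assms by (simp add: fact_numeral)
  show "integrable lborel (\<lambda>x :: real^'n. gauss s x * (norm x)\<^sup>2)"
    unfolding eq by (intro Bochner_Integration.integrable_sum gauss_component_moment assms)
  show "(\<integral>(x::real^'n). gauss s x * (norm x)\<^sup>2 \<partial>lborel) = real CARD('n) * s"
    unfolding eq using assms
    by (subst Bochner_Integration.integral_sum) (simp_all add: gauss_component_moment m)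
qed

text \<open>The weighted arithmetic-geometric mean inequality replaces Cauchy-Schwarz. With weight
  \<open>sqrt s\<close> both terms are of order \<open>sqrt s\<close>.\<close>

lemma gauss_norm_moment:
  assumes "s > 0"
  shows "integrable lborel (\<lambda>x :: real^'n. gauss s x * norm x)"
    and "(\<integral>(x::real^'n). gauss s x * norm x \<partial>lborel) \<le> (real CARD('n) + 1) / 2 * sqrt s"
proof -
  have le: "norm x \<le> ((norm x)\<^sup>2 / sqrt s + sqrt s) / 2" for x :: "real^'n"
  proof -
    have "0 \<le> (norm x - sqrt s)\<^sup>2" by simp
    then show ?thesis
      using assms by (simp add: power2_eq_square field_simps)
  qed
  have le': "gauss s x * norm x \<le> (gauss s x * (norm x)\<^sup>2 / sqrt s + gauss s x * sqrt s) / 2" for x :: "real^'n"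
    using mult_left_mono[OF le gauss_nonneg, of s x] by (simp add: algebra_simps add_divide_distrib)
  have int: "integrable lborel (\<lambda>x :: real^'n. (gauss s x * (norm x)\<^sup>2 / sqrt s + gauss s x * sqrt s) / 2)"
    using assms by (intro integrable_divide Bochner_Integration.integrable_add integrable_mult_left
        gauss_second_moment gauss_integrable)
  show i: "integrable lborel (\<lambda>x :: real^'n. gauss s x * norm x)"
    by (rule Bochner_Integration.integrable_bound[OF int]) (use le' in \<open>auto intro!: AE_I2 order_trans[OF _ abs_ge_self]\<close>)
  have "(\<integral>(x::real^'n). gauss s x * norm x \<partial>lborel) \<le>
      (\<integral>(x::real^'n). (gauss s x * (norm x)\<^sup>2 / sqrt s + gauss s x * sqrt s) / 2 \<partial>lborel)"
    by (intro integral_mono i int le')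
  also have "\<dots> = (real CARD('n) * s / sqrt s + sqrt s) / 2"
    using assms by (simp add: gauss_second_moment gauss_integrable gauss_integral)
  also have "\<dots> = (real CARD('n) + 1) / 2 * sqrt s"
    using assms by (simp add: real_div_sqrt distrib_right flip: times_divide_eq_right)
  finally show "(\<integral>(x::real^'n). gauss s x * norm x \<partial>lborel) \<le> (real CARD('n) + 1) / 2 * sqrt s" .
qed

section \<open>Approximate deconvolution in L1\<close>

text \<open>A Gaussian factor adds to the inverse variance: \<open>a\<close> is chosen so that
  \<open>1 / (2 * t)\<close> plus its square equals \<open>1 / s\<close>. This is possible because
  \<open>s < 2 * t\<close>.\<close>

lemma deconvolution_1d_limit:
  assumes "t > 0" "s > 0" "s < 2 * t"
  obtains a Z where "Z > 0" and "\<And>y. normal_density 0 (sqrt (2 * t)) y * exp (- (a * y)\<^sup>2 / 2) =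
    Z * normal_density 0 (sqrt s) y"
proof
  define a where "a = sqrt (1 / s - 1 / (2 * t))"
  have a2: "a\<^sup>2 = 1 / s - 1 / (2 * t)"
    using assms by (simp add: a_def field_simps)
  show "sqrt (s / (2 * t)) > 0"
    using assms by simp
  fix y
  have "- y\<^sup>2 / (2 * (2 * t)) + - (a * y)\<^sup>2 / 2 = - y\<^sup>2 / (2 * s)"
    unfolding power_mult_distrib a2 using assms by (simp add: field_simps)
  then have "exp (- y\<^sup>2 / (2 * (2 * t))) * exp (- (a * y)\<^sup>2 / 2) = exp (- y\<^sup>2 / (2 * s))"
    by (simp only: mult_exp_exp)
  moreover have "1 / sqrt (2 * pi * (2 * t)) = sqrt (s / (2 * t)) * (1 / sqrt (2 * pi * s))"
    using assms by (simp add: real_sqrt_mult real_sqrt_divide)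
  ultimately show "normal_density 0 (sqrt (2 * t)) y * exp (- (a * y)\<^sup>2 / 2) =
    sqrt (s / (2 * t)) * normal_density 0 (sqrt s) y"
    using assms by (simp add: normal_density_def)
qed

lemma lborel_translate:
  fixes f :: "'a::euclidean_space \<Rightarrow> real"
  assumes [measurable]: "f \<in> borel_measurable borel"
  shows "(\<integral>v. f (v + z) \<partial>lborel) = (\<integral>y. f y \<partial>lborel)"
    and "integrable lborel f \<Longrightarrow> integrable lborel (\<lambda>v. f (v + z))"
proof -
  have "(\<integral>y. f y \<partial>lborel) = (\<integral>y. f y \<partial>(distr lborel borel ((+) z)))"
    by (simp add: lborel_distr_plus)
  also have "\<dots> = (\<integral>v. f (v + z) \<partial>lborel)"
    by (subst integral_distr) (simp_all add: add.commute)
  finally show "(\<integral>v. f (v + z) \<partial>lborel) = (\<integral>y. f y \<partial>lborel)" ..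
  assume "integrable lborel f"
  then have "integrable (distr lborel borel ((+) z)) f"
    by (simp add: lborel_distr_plus)
  then show "integrable lborel (\<lambda>v. f (v + z))"
    by (subst (asm) integrable_distr_eq) (simp_all add: add.commute)
qed

text \<open>Smoothing \<open>g\<close> by \<eta> and then averaging over noise with density \<gamma>
  is the same as averaging \<open>g\<close> against the convolution of \<gamma> and \<eta>. The
  proof exchanges the integrals, shifts by \<open>y = v + z\<close> and exchanges back; the bound on
  \<open>g\<close> gives the integrability for both exchanges.\<close>

lemma smooth_deconvolution:
  fixes g :: "'a::euclidean_space \<Rightarrow> real" and \<eta> \<gamma> :: "'b::euclidean_space \<Rightarrow> real"
  assumes g[measurable]: "g \<in> borel_measurable borel" and g1: "\<And>x. \<bar>g x\<bar> \<le> 1"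
    and \<eta>: "integrable lborel \<eta>" and \<gamma>: "integrable lborel \<gamma>" and D[measurable]: "D \<in> borel_measurable borel"
    and Dadd: "\<And>u v. D (u + v) = D u + D v"
  shows "(\<integral>v. (\<integral>z. g (x + D v + D z) * \<eta> z \<partial>lborel) * \<gamma> v \<partial>lborel) =
    (\<integral>y. g (x + D y) * (\<integral>z. \<gamma> (y - z) * \<eta> z \<partial>lborel) \<partial>lborel)"
proof -
  have [measurable]: "\<eta> \<in> borel_measurable borel" "\<gamma> \<in> borel_measurable borel"
    using borel_measurable_integrable[OF \<eta>] borel_measurable_integrable[OF \<gamma>] by simp_all
  have int: "integrable (lborel \<Otimes>\<^sub>M lborel) (\<lambda>(v, z). k v z * (\<gamma> v * \<eta> z))"
    if [measurable]: "(\<lambda>(v, z). k v z) \<in> borel_measurable (borel \<Otimes>\<^sub>M borel)"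
      and k: "\<And>v z. \<bar>k v z\<bar> \<le> 1" for k :: "'b \<Rightarrow> 'b \<Rightarrow> real"
  proof (rule lborel_pair.Fubini_integrable)
    show "(\<lambda>(v, z). k v z * (\<gamma> v * \<eta> z)) \<in> borel_measurable (lborel \<Otimes>\<^sub>M lborel)"
      by measurable
    have i: "integrable lborel (\<lambda>z. k v z * (\<gamma> v * \<eta> z))" for v
      by (rule Bochner_Integration.integrable_bound[OF integrable_mult_right[OF \<eta>, of "\<gamma> v"]])
        (use k in \<open>auto simp: abs_mult intro!: AE_I2 mult_left_le_one_le mult_nonneg_nonneg\<close>)
    then show "AE v in lborel. integrable lborel (\<lambda>z. case (v, z) of (v, z) \<Rightarrow> k v z * (\<gamma> v * \<eta> z))"
      by simp
    have "(\<integral>z. \<bar>k v z * (\<gamma> v * \<eta> z)\<bar> \<partial>lborel) \<le> (\<integral>z. \<bar>\<gamma> v\<bar> * \<bar>\<eta> z\<bar> \<partial>lborel)" for v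
      using integrable_abs[OF i] \<eta> k
      by (intro integral_mono integrable_mult_right) (auto simp: abs_mult mult_left_le_one_le)
    then show "integrable lborel (\<lambda>v. \<integral>z. norm (case (v, z) of (v, z) \<Rightarrow> k v z * (\<gamma> v * \<eta> z)) \<partial>lborel)"
      by (intro Bochner_Integration.integrable_bound[OF integrable_mult_left[OF \<gamma>, of "\<integral>z. \<bar>\<eta> z\<bar> \<partial>lborel"]])
        (auto simp: abs_mult intro!: AE_I2)
  qed
  \<comment> \<open>For the shifted integrand the \<open>y\<close>-integral is taken first, since by
    translation invariance the integral of \<open>\<bar>\<gamma> (y - z)\<bar>\<close> over
    \<open>y\<close> does not depend on \<open>z\<close>.\<close>
  have int2: "integrable (lborel \<Otimes>\<^sub>M lborel) (\<lambda>(y, z). k y * (\<gamma> (y - z) * \<eta> z))"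
    if [measurable]: "k \<in> borel_measurable borel" and k: "\<And>y. \<bar>k y\<bar> \<le> 1" for k :: "'b \<Rightarrow> real"
  proof -
    have "integrable (lborel \<Otimes>\<^sub>M lborel) (\<lambda>(z, y). k y * (\<gamma> (y - z) * \<eta> z))"
    proof (rule lborel_pair.Fubini_integrable)
      show "(\<lambda>(z, y). k y * (\<gamma> (y - z) * \<eta> z)) \<in> borel_measurable (lborel \<Otimes>\<^sub>M lborel)"
        by measurable
      have i: "integrable lborel (\<lambda>y. k y * (\<gamma> (y - z) * \<eta> z))" for z
        by (rule Bochner_Integration.integrable_bound[OF integrable_mult_left[OF lborel_translate(2)[OF _ \<gamma>, of "- z"], of "\<eta> z"]])
         (use k in \<open>auto simp: abs_mult intro!: AE_I2 mult_left_le_one_le mult_nonneg_nonneg\<close>)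
      then show "AE z in lborel. integrable lborel (\<lambda>y. case (z, y) of (z, y) \<Rightarrow> k y * (\<gamma> (y - z) * \<eta> z))"
        by simp
      have "(\<integral>y. \<bar>k y * (\<gamma> (y - z) * \<eta> z)\<bar> \<partial>lborel) \<le> (\<integral>y. \<bar>\<gamma> y\<bar> \<partial>lborel) * \<bar>\<eta> z\<bar>" for z
      proof -
        have "(\<integral>y. \<bar>k y * (\<gamma> (y - z) * \<eta> z)\<bar> \<partial>lborel) \<le> (\<integral>y. \<bar>\<gamma> (y + - z)\<bar> * \<bar>\<eta> z\<bar> \<partial>lborel)"
          using i lborel_translate(2)[OF _ \<gamma>, of "- z"] k
          by (intro integral_mono integrable_mult_left integrable_abs)
            (simp_all add: abs_mult mult_left_le_one_le)
        then show ?thesis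
          by (subst (asm) lborel_translate(1)[where f="\<lambda>y. \<bar>\<gamma> y\<bar> * \<bar>\<eta> z\<bar>"]) auto
      qed
      then show "integrable lborel (\<lambda>z. \<integral>y. norm (case (z, y) of (z, y) \<Rightarrow> k y * (\<gamma> (y - z) * \<eta> z)) \<partial>lborel)"
        by (intro Bochner_Integration.integrable_bound[OF integrable_mult_right[OF integrable_abs[OF \<eta>], of "\<integral>y. \<bar>\<gamma> y\<bar> \<partial>lborel"]])
          (auto simp: abs_mult intro!: AE_I2)
    qed
    from lborel_pair.integrable_product_swap[OF this] show ?thesis
      by (simp add: case_prod_beta)
  qed
  have "(\<integral>v. (\<integral>z. g (x + D v + D z) * \<eta> z \<partial>lborel) * \<gamma> v \<partial>lborel) =
      (\<integral>v. (\<integral>z. g (x + D (v + z)) * (\<gamma> v * \<eta> z) \<partial>lborel) \<partial>lborel)"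
    by (simp add: Dadd algebra_simps flip: integral_mult_right_zero)
  also have "\<dots> = (\<integral>z. (\<integral>v. g (x + D (v + z)) * (\<gamma> v * \<eta> z) \<partial>lborel) \<partial>lborel)"
    using int[of "\<lambda>v z. g (x + D (v + z))"] g1 by (intro lborel_pair.Fubini_integral[symmetric]) auto
  also have "(\<lambda>z. \<integral>v. g (x + D (v + z)) * (\<gamma> v * \<eta> z) \<partial>lborel) = (\<lambda>z. \<integral>y. g (x + D y) * (\<gamma> (y - z) * \<eta> z) \<partial>lborel)"
  proof
    fix z
    show "(\<integral>v. g (x + D (v + z)) * (\<gamma> v * \<eta> z) \<partial>lborel) = (\<integral>y. g (x + D y) * (\<gamma> (y - z) * \<eta> z) \<partial>lborel)"
      using lborel_translate(1)[of "\<lambda>y. g (x + D y) * (\<gamma> (y - z) * \<eta> z)" z] by simp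
  qed
  also have "(\<integral>z. (\<integral>y. g (x + D y) * (\<gamma> (y - z) * \<eta> z) \<partial>lborel) \<partial>lborel) = (\<integral>y. (\<integral>z. g (x + D y) * (\<gamma> (y - z) * \<eta> z) \<partial>lborel) \<partial>lborel)"
    using int2[of "\<lambda>y. g (x + D y)"] g1 by (intro lborel_pair.Fubini_integral) auto
  finally show "(\<integral>v. (\<integral>z. g (x + D v + D z) * \<eta> z \<partial>lborel) * \<gamma> v \<partial>lborel) =
    (\<integral>y. g (x + D y) * (\<integral>z. \<gamma> (y - z) * \<eta> z \<partial>lborel) \<partial>lborel)"
    by simp
qed

text \<open>For \<open>s < t\<close> a Gaussian of variance \<open>s\<close> has no integrable
  preimage under convolution with variance \<open>t\<close>, as the Fourier transform of the
  preimage would be unbounded. Hence only an L1 approximation is sought: the cosine powers with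
  \<open>b = a / sqrt n\<close> have preimages and converge to the narrow Gaussian by dominated
  convergence.\<close>

lemma gaussian_deconvolution_kernel:
  fixes t s \<delta> :: real
  assumes "t > 0" "s > 0" "s < 2 * t" "\<delta> > 0"
  obtains \<eta> :: "real^'n \<Rightarrow> real" where "integrable lborel \<eta>"
    and "integrable lborel (\<lambda>y. (\<integral>z. gauss t (y - z) * \<eta> z \<partial>lborel) - gauss s y)"
    and "(\<integral>y. \<bar>(\<integral>z. gauss t (y - z) * \<eta> z \<partial>lborel) - gauss s y\<bar> \<partial>lborel) < \<delta>"
proof -
  obtain a Z where Z: "Z > 0" and aZ: "\<And>y. normal_density 0 (sqrt (2 * t)) y * exp (- (a * y)\<^sup>2 / 2) =
      Z * normal_density 0 (sqrt s) y"
    using deconvolution_1d_limit[OF assms(1-3)] by blast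
  define b where "b n = a / sqrt (real n)" for n
  \<comment> \<open>A product of one-dimensional kernels. The division by a power of
    \<open>Z\<close> normalizes the limit to \<open>gauss s\<close>, one factor \<open>Z\<close> for
    each coordinate.\<close>
  define \<eta> where "\<eta> n z = (\<Prod>i\<in>UNIV. deconv_kernel n t (b n) (z $ i)) / Z ^ CARD('n)" for n and z :: "real^'n"
  define \<kappa> where "\<kappa> n y = gauss (2 * t) y * (\<Prod>i\<in>UNIV. cos (b n * y $ i) ^ n) / Z ^ CARD('n)" for n and y :: "real^'n"
  have int\<eta>: "integrable lborel (\<eta> n)" for n
    unfolding \<eta>_def using assms by (intro integrable_divide lborel_vec_prod deconv_kernel_integrable)
  have conv: "(\<integral>z. gauss t (y - z) * \<eta> n z \<partial>lborel) = \<kappa> n y" for n y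
  proof -
    have "integrable lborel (\<lambda>z. normal_density 0 (sqrt t) (u - z) * deconv_kernel n t (b n) z)" for u
    proof (rule Bochner_Integration.integrable_bound[OF integrable_mult_right[OF deconv_kernel_integrable]])
      show "AE z in lborel. norm (normal_density 0 (sqrt t) (u - z) * deconv_kernel n t (b n) z)
          \<le> norm (1 / sqrt (2 * pi * t) * deconv_kernel n t (b n) z)"
        using assms(1) by (intro AE_I2) (auto simp: normal_density_def abs_mult intro!: divide_right_mono mult_left_le_one_le)
    qed (use assms in \<open>auto intro!: borel_measurable_times borel_measurable_integrable[OF deconv_kernel_integrable, simplified]\<close>)
    from lborel_vec_prod(2)[of "\<lambda>i z. normal_density 0 (sqrt t) (y $ i - z) * deconv_kernel n t (b n) z", OF this]
    have "(\<integral>z. gauss t (y - z) * (\<Prod>i\<in>UNIV. deconv_kernel n t (b n) (z $ i)) \<partial>lborel) =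
        (\<Prod>i\<in>UNIV. normal_density 0 (sqrt (2 * t)) (y $ i) * cos (b n * y $ i) ^ n)"
      using assms by (simp add: gauss_def prod.distrib deconv_kernel_conv)
    then show ?thesis
      by (simp add: \<eta>_def \<kappa>_def gauss_def prod.distrib)
  qed
  have lim: "(\<lambda>n. \<kappa> n y) \<longlonglongrightarrow> gauss s y" for y
  proof -
    have "(\<lambda>n. \<kappa> n y) \<longlonglongrightarrow> gauss (2 * t) y * (\<Prod>i\<in>UNIV. exp (- (a * y $ i)\<^sup>2 / 2)) / Z ^ CARD('n)"
      unfolding \<kappa>_def b_def using Z by (intro tendsto_intros cos_power_tendsto) auto
    also have "gauss (2 * t) y * (\<Prod>i\<in>UNIV. exp (- (a * y $ i)\<^sup>2 / 2)) / Z ^ CARD('n) = gauss s y"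
      using Z aZ by (simp add: gauss_def prod.distrib[symmetric]) (simp add: prod.distrib)
    finally show ?thesis .
  qed
  have bnd: "\<bar>\<kappa> n y\<bar> \<le> gauss (2 * t) y / Z ^ CARD('n)" for n y
  proof -
    have "\<bar>\<Prod>i\<in>UNIV. cos (b n * y $ i) ^ n\<bar> \<le> (\<Prod>i\<in>(UNIV::'n set). 1)"
      unfolding abs_prod power_abs by (intro prod_mono) (auto intro!: power_le_one)
    then show ?thesis
      using Z by (auto simp: \<kappa>_def abs_mult abs_prod intro!: divide_right_mono mult_left_le)
  qed
  have [measurable]: "\<kappa> n \<in> borel_measurable borel" for n
    unfolding \<kappa>_def by measurable
  \<comment> \<open>Dominating function: cosines are at most 1 in absolute value, so
    \<open>\<kappa> n\<close> stays below a multiple of the wider Gaussian.\<close>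
  have i: "integrable lborel (\<lambda>y :: real^'n. gauss (2 * t) y / Z ^ CARD('n) + gauss s y)"
    using assms by (intro Bochner_Integration.integrable_add integrable_divide gauss_integrable) auto
  have dom: "AE y in lborel. norm (\<bar>\<kappa> n y - gauss s y\<bar>) \<le> gauss (2 * t) y / Z ^ CARD('n) + gauss s y" for n
    using bnd[of n] by (intro AE_I2) (smt (verit, best) gauss_nonneg real_norm_def)
  have int\<kappa>: "integrable lborel (\<lambda>y. \<kappa> n y - gauss s y)" for n
    by (rule Bochner_Integration.integrable_bound[OF i]) (use dom[of n] in auto)
  have "(\<lambda>n. \<integral>y. \<bar>\<kappa> n y - gauss s y\<bar> \<partial>lborel) \<longlonglongrightarrow> (\<integral>(y::real^'n). 0 \<partial>lborel)"
  proof (rule integral_dominated_convergence[OF _ _ i])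
    show "AE y in lborel. (\<lambda>n. \<bar>\<kappa> n y - gauss s y\<bar>) \<longlonglongrightarrow> 0"
      using lim by (intro AE_I2) (simp add: LIM_zero tendsto_rabs_zero)
  qed (use dom in auto)
  then have "\<forall>\<^sub>F n in sequentially. (\<integral>y. \<bar>\<kappa> n y - gauss s y\<bar> \<partial>lborel) < \<delta>"
    using assms by (intro order_tendstoD) auto
  then obtain n where "(\<integral>y. \<bar>\<kappa> n y - gauss s y\<bar> \<partial>lborel) < \<delta>"
    by (auto simp: eventually_sequentially)
  with int\<eta>[of n] int\<kappa>[of n] show ?thesis
    by (intro that[of "\<eta> n"]) (simp_all add: conv)
qed

text \<open>The bound \<open>B\<close> precedes \<open>g\<close> in the quantifiers: it is governed
  by the L1 norm of one kernel, which depends on \<open>g\<close> only through the Lipschitz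
  constant \<open>K\<close>. Half of \<epsilon> pays for replacing the kernel by
  \<open>gauss s\<close>, the other half for smoothing \<open>g\<close> with
  \<open>gauss s\<close>.\<close>

lemma gaussian_deconvolution:
  fixes D :: "real^'r^'q" and K \<epsilon> t :: real
  assumes "t > 0" "\<epsilon> > 0" "K \<ge> 0"
  obtains B where "B > 0"
    and "\<And>g :: real^'q \<Rightarrow> real. (\<And>x. \<bar>g x\<bar> \<le> 1) \<Longrightarrow> (\<And>x y. \<bar>g x - g y\<bar> \<le> K * norm (x - y)) \<Longrightarrow>
      \<exists>F. F \<in> borel_measurable borel \<and> (\<forall>x. \<bar>F x\<bar> \<le> B) \<and>
        (\<forall>x. \<bar>(\<integral>v. F (x + D *v v) * gauss t v \<partial>lborel) - g x\<bar> \<le> \<epsilon>)"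
proof -
  obtain d where d: "d > 0" "\<And>v. norm (D *v v) \<le> norm v * d"
    using linear_bounded_pos[OF matrix_vector_mul_linear[of D]] by (metis mult.commute)
  \<comment> \<open>\<open>c * sqrt s\<close> bounds \<open>K\<close> times the mean length of
    \<open>D *v y\<close> under \<open>gauss s\<close>, by \<open>gauss_norm_moment\<close>.\<close>
  define c where "c = (real CARD('r) + 1) / 2 * K * d"
  have "c \<ge> 0" using d assms by (simp add: c_def)
  \<comment> \<open>The first entry gives \<open>s < 2 * t\<close>, the second makes the smoothing
    error at most \<open>\<epsilon> / 2\<close>.\<close>
  define s where "s = min t ((\<epsilon> / (2 * (c + 1)))\<^sup>2)"
  have s: "s > 0" "s < 2 * t" "c * sqrt s \<le> \<epsilon> / 2"
  proof -
    show "s > 0" "s < 2 * t"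
      using assms \<open>c \<ge> 0\<close> by (auto simp: s_def)
    have "sqrt s \<le> sqrt ((\<epsilon> / (2 * (c + 1)))\<^sup>2)"
      by (simp add: s_def del: real_sqrt_abs)
    also have "\<dots> = \<epsilon> / (2 * (c + 1))"
      using assms \<open>c \<ge> 0\<close> by simp
    finally have "c * sqrt s \<le> c * (\<epsilon> / (2 * (c + 1)))"
      using \<open>c \<ge> 0\<close> by (rule mult_left_mono)
    also have "\<dots> \<le> \<epsilon> / 2"
      using \<open>c \<ge> 0\<close> assms by (simp add: field_simps)
    finally show "c * sqrt s \<le> \<epsilon> / 2" .
  qed
  obtain \<eta> :: "real^'r \<Rightarrow> real" where \<eta>: "integrable lborel \<eta>"
    and int\<kappa>: "integrable lborel (\<lambda>y. (\<integral>z. gauss t (y - z) * \<eta> z \<partial>lborel) - gauss s y)"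
    and small: "(\<integral>y. \<bar>(\<integral>z. gauss t (y - z) * \<eta> z \<partial>lborel) - gauss s y\<bar> \<partial>lborel) < \<epsilon> / 2"
    using gaussian_deconvolution_kernel[OF assms(1) s(1,2), of "\<epsilon> / 2"] assms by auto
  define \<kappa> where "\<kappa> y = (\<integral>z. gauss t (y - z) * \<eta> z \<partial>lborel)" for y
  note int\<kappa> = int\<kappa>[folded \<kappa>_def] and small = small[folded \<kappa>_def]
  have [measurable]: "\<eta> \<in> borel_measurable borel"
    using borel_measurable_integrable[OF \<eta>] by simp
  have Dm[measurable]: "(\<lambda>v. D *v v) \<in> borel_measurable borel"
    by (intro borel_measurable_continuous_onI linear_continuous_on linear_conv_bounded_linear[THEN iffD1]) simp
  \<comment> \<open>The added 1 keeps \<open>B\<close> positive even if \<eta> has norm 0.\<close>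
  define B where "B = (\<integral>z. \<bar>\<eta> z\<bar> \<partial>lborel) + 1"
  have nn: "(\<integral>z. \<bar>\<eta> z\<bar> \<partial>lborel) \<ge> 0" by simp
  then have "B > 0" unfolding B_def by linarith
  show ?thesis
  proof (rule that[OF \<open>B > 0\<close>])
    fix g :: "real^'q \<Rightarrow> real"
    assume g1: "\<bar>g x\<bar> \<le> 1" and gK: "\<bar>g x - g y\<bar> \<le> K * norm (x - y)" for x y
    have "continuous_on UNIV g"
      using lipschitz_on_continuous_on[of K UNIV g] assms gK
      by (auto simp: lipschitz_on_def dist_norm)
    then have [measurable]: "g \<in> borel_measurable borel"
      by (rule borel_measurable_continuous_onI)
    define F where "F x = (\<integral>z. g (x + D *v z) * \<eta> z \<partial>lborel)" for x
    have "F \<in> borel_measurable borel"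
      unfolding F_def by measurable
    moreover have "\<bar>F x\<bar> \<le> B" for x
    proof -
      have i: "integrable lborel (\<lambda>z. g (x + D *v z) * \<eta> z)"
        by (rule Bochner_Integration.integrable_bound[OF \<eta>]) (use g1 in \<open>auto simp: abs_mult mult_left_le_one_le\<close>)
      have "\<bar>F x\<bar> \<le> (\<integral>z. \<bar>g (x + D *v z) * \<eta> z\<bar> \<partial>lborel)"
        unfolding F_def by (rule integral_abs_bound)
      also have "\<dots> \<le> (\<integral>z. \<bar>\<eta> z\<bar> \<partial>lborel)"
        by (intro integral_mono integrable_abs i \<eta>) (use g1 in \<open>auto simp: abs_mult mult_left_le_one_le\<close>)
      finally show ?thesis by (simp add: B_def)
    qed
    moreover have "\<bar>(\<integral>v. F (x + D *v v) * gauss t v \<partial>lborel) - g x\<bar> \<le> \<epsilon>" for x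
    proof -
      have "(\<integral>v. F (x + D *v v) * gauss t v \<partial>lborel) = (\<integral>y. g (x + D *v y) * \<kappa> y \<partial>lborel)"
        unfolding F_def \<kappa>_def using g1 \<eta> gauss_integrable[OF assms(1)]
        by (intro smooth_deconvolution) (auto simp: matrix_vector_right_distrib)
      \<comment> \<open>Three contributions: the kernel error, small in L1; the oscillation of
        \<open>g\<close> at the scale of \<open>gauss s\<close>; and \<open>g x\<close> itself, as
        \<open>gauss s\<close> has mass 1.\<close>
      also have "\<dots> = (\<integral>y. g (x + D *v y) * (\<kappa> y - gauss s y) + (g (x + D *v y) - g x) * gauss s y + g x * gauss s y \<partial>lborel)"
        by (intro Bochner_Integration.integral_cong) (auto simp: algebra_simps)
      also have "\<dots> = (\<integral>y. g (x + D *v y) * (\<kappa> y - gauss s y) \<partial>lborel) +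
          (\<integral>y. (g (x + D *v y) - g x) * gauss s y \<partial>lborel) + g x" (is "_ = ?a + ?b + _")
      proof -
        have i1: "integrable lborel (\<lambda>y. g (x + D *v y) * (\<kappa> y - gauss s y))"
          by (rule Bochner_Integration.integrable_bound[OF int\<kappa>])
            (use g1 borel_measurable_integrable[OF int\<kappa>] in \<open>auto simp: abs_mult mult_left_le_one_le\<close>)
        have i2: "integrable lborel (\<lambda>y. (g (x + D *v y) - g x) * gauss s y)"
        proof (rule Bochner_Integration.integrable_bound[OF integrable_mult_right[OF gauss_integrable[OF s(1)], of 2]])
          have "\<bar>g u - g x\<bar> \<le> 2" for u
            using g1[of u] g1[of x] by linarith
          then show "AE y in lborel. norm ((g (x + D *v y) - g x) * gauss s y) \<le> norm (2 * gauss s y)"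
            by (auto simp: abs_mult intro!: mult_right_mono)
        qed auto
        show ?thesis
          using s by (simp add: i1 i2 gauss_integrable gauss_integral)
      qed
      finally have eq: "(\<integral>v. F (x + D *v v) * gauss t v \<partial>lborel) - g x = ?a + ?b" by simp
      have "\<bar>?a\<bar> \<le> (\<integral>y. \<bar>\<kappa> y - gauss s y\<bar> \<partial>lborel)"
        by (rule integral_abs_bound[THEN order_trans], rule integral_mono)
          (use g1 int\<kappa> borel_measurable_integrable[OF int\<kappa>] in
            \<open>auto simp: abs_mult mult_left_le_one_le intro!: integrable_abs Bochner_Integration.integrable_bound[OF int\<kappa>]\<close>)
      moreover have "\<bar>?b\<bar> \<le> (\<integral>y. K * d * (gauss s y * norm (y::real^'r)) \<partial>lborel)"
      proof -
        have le: "\<bar>(g (x + D *v y) - g x) * gauss s y\<bar> \<le> K * d * (gauss s y * norm y)" for y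
        proof -
          have "\<bar>g (x + D *v y) - g x\<bar> \<le> K * (norm y * d)"
            using gK[of "x + D *v y" x] mult_left_mono[OF d(2) assms(3), of y] by simp
          from mult_right_mono[OF this gauss_nonneg[of s y]] show ?thesis
            by (simp add: abs_mult mult_ac)
        qed
        have i: "integrable lborel (\<lambda>y. K * d * (gauss s y * norm (y::real^'r)))"
          by (intro integrable_mult_right gauss_norm_moment s)
        have i0: "integrable lborel (\<lambda>y. (g (x + D *v y) - g x) * gauss s y)"
          by (rule Bochner_Integration.integrable_bound[OF i]) (use le in \<open>auto intro!: AE_I2 order_trans[OF le]\<close>)
        have "(\<integral>y. \<bar>(g (x + D *v y) - g x) * gauss s y\<bar> \<partial>lborel) \<le> (\<integral>y. K * d * (gauss s y * norm (y::real^'r)) \<partial>lborel)"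
          by (intro integral_mono integrable_abs[OF i0] i le)
        then show ?thesis
          by (rule order_trans[OF integral_abs_bound])
      qed
      moreover have "(\<integral>y. K * d * (gauss s y * norm (y::real^'r)) \<partial>lborel) \<le> c * sqrt s"
        using mult_left_mono[OF gauss_norm_moment(2)[OF s(1), where 'n='r], of "K * d"] d assms
        by (simp add: c_def mult_ac)
      ultimately show ?thesis
        unfolding eq using small s(3) by linarith
    qed
    ultimately show "\<exists>F. F \<in> borel_measurable borel \<and> (\<forall>x. \<bar>F x\<bar> \<le> B) \<and>
        (\<forall>x. \<bar>(\<integral>v. F (x + D *v v) * gauss t v \<partial>lborel) - g x\<bar> \<le> \<epsilon>)"
      by blast
  qed
qed

section \<open>Independence and the Ito integral\<close>

text \<open>The generator is not stable under intersection, so it is enlarged to a stable system of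
  events that agree almost surely with some \<open>a \<inter> b\<close>. The product formula
  survives changes on null sets, and extends from stable systems to the generated
  \<sigma>-fields.\<close>

lemma (in prob_space) indep_set_augmented:
  assumes A: "A \<subseteq> events" "Int_stable A" "space M \<in> A"
    and e: "{} \<in> A"
    and B: "B \<subseteq> events" "Int_stable B" "space M \<in> B"
    and C: "C \<subseteq> events" "Int_stable C" "space M \<in> C"
    and indep: "\<And>a b c. a \<in> A \<Longrightarrow> b \<in> B \<Longrightarrow> c \<in> C \<Longrightarrow> prob (a \<inter> b \<inter> c) = prob a * prob b * prob c"
  shows "indep_set (sigma_sets (space M) (A \<union> B \<union> null_sets M)) C"
proof -
  define G where "G = {e \<in> events. \<exists>a\<in>A. \<exists>b\<in>B. AE \<omega> in M. \<omega> \<in> e \<longleftrightarrow> \<omega> \<in> a \<inter> b}"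
  have "indep_set G C"
  proof (rule indep_setI)
    fix e c assume "e \<in> G" "c \<in> C"
    then obtain a b where e: "e \<in> events" and ab: "a \<in> A" "b \<in> B" and ae: "AE \<omega> in M. \<omega> \<in> e \<longleftrightarrow> \<omega> \<in> a \<inter> b"
      by (auto simp: G_def)
    have ev: "a \<in> events" "b \<in> events" "c \<in> events"
      using ab A B C \<open>c \<in> C\<close> by auto
    have "prob (e \<inter> c) = prob (a \<inter> b \<inter> c)"
      using ae ev e by (intro finite_measure_eq_AE) auto
    moreover have "prob e = prob (a \<inter> b \<inter> space M)"
      using ae ev e by (intro finite_measure_eq_AE) auto
    ultimately show "prob (e \<inter> c) = prob e * prob c"
      using indep[OF ab \<open>c \<in> C\<close>] indep[OF ab C(3)] by (simp add: prob_space)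
  qed (use C in \<open>auto simp: G_def\<close>)
  moreover have "Int_stable G"
  proof (rule Int_stableI)
    fix e e' assume "e \<in> G" "e' \<in> G"
    then obtain a b a' b' where ab: "e \<in> events" "e' \<in> events" "a \<in> A" "b \<in> B" "a' \<in> A" "b' \<in> B"
      and ae: "AE \<omega> in M. \<omega> \<in> e \<longleftrightarrow> \<omega> \<in> a \<inter> b" "AE \<omega> in M. \<omega> \<in> e' \<longleftrightarrow> \<omega> \<in> a' \<inter> b'"
      unfolding G_def by blast
    have "AE \<omega> in M. \<omega> \<in> e \<inter> e' \<longleftrightarrow> \<omega> \<in> (a \<inter> a') \<inter> (b \<inter> b')"
      using ae by eventually_elim auto
    moreover have "a \<inter> a' \<in> A" "b \<inter> b' \<in> B"
      using ab A B by (auto intro: Int_stableD)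
    ultimately show "e \<inter> e' \<in> G"
      unfolding G_def using ab by (intro CollectI conjI bexI[of _ "a \<inter> a'"] bexI[of _ "b \<inter> b'"]) auto
  qed
  ultimately have "indep_set (sigma_sets (space M) G) (sigma_sets (space M) C)"
    using C by (intro indep_set_sigma_sets)
  moreover have "A \<union> B \<union> null_sets M \<subseteq> G"
  proof -
    have "\<exists>a\<in>A. \<exists>b\<in>B. AE \<omega> in M. \<omega> \<in> e \<longleftrightarrow> \<omega> \<in> a \<inter> b" if "e \<in> A" for e
      using that A B by (intro bexI[of _ e] bexI[of _ "space M"]) auto
    moreover have "\<exists>a\<in>A. \<exists>b\<in>B. AE \<omega> in M. \<omega> \<in> e \<longleftrightarrow> \<omega> \<in> a \<inter> b" if "e \<in> B" for e
      using that A B by (intro bexI[of _ e] bexI[of _ "space M"]) auto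
    \<comment> \<open>A null event agrees almost surely with the empty set, which is why
      \<open>{}\<close> has to belong to \<open>A\<close>.\<close>
    moreover have "\<exists>a\<in>A. \<exists>b\<in>B. AE \<omega> in M. \<omega> \<in> e \<longleftrightarrow> \<omega> \<in> a \<inter> b" if "e \<in> null_sets M" for e
      using e B(3) AE_not_in[OF that] by (intro bexI[of _ "{}"] bexI[of _ "space M"]) auto
    ultimately show ?thesis
      using A B by (auto simp: G_def)
  qed
  then have "sigma_sets (space M) (A \<union> B \<union> null_sets M) \<subseteq> sigma_sets (space M) G"
    by (rule sigma_sets_mono')
  moreover have "C \<subseteq> sigma_sets (space M) C"
    by auto
  ultimately show ?thesis
    unfolding indep_sets2_eq by (meson order_trans subsetD)
qed

lemma sets_vimage_algebra_subset:
  assumes "f \<in> measurable N L" "space N = X"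
  shows "sets (vimage_algebra X f L) \<subseteq> sets N"
  using assms by (auto simp: sets_vimage_algebra2 measurable_space Pi_iff)

lemma Int_stable_sets: "Int_stable (sets N)"
  by (auto intro: Int_stableI)

lemma sample_path_measurable:
  assumes "\<And>t. t \<in> I \<Longrightarrow> Z t \<in> borel_measurable N"
  shows "sample_path I Z \<in> measurable N (path_space I)"
  unfolding sample_path_def[abs_def] using assms by (intro measurable_restrict) auto

lemma sample_path_component:
  assumes "t \<in> I"
  shows "Z t \<in> borel_measurable (vimage_algebra X (sample_path I Z) (path_space I))"
proof -
  have "sample_path I Z \<in> measurable (vimage_algebra X (sample_path I Z) (path_space I)) (path_space I)"
    by (rule measurable_vimage_algebra1) (auto simp: sample_path_def space_PiM)
  then have "(\<lambda>\<omega>. sample_path I Z \<omega> t) \<in> borel_measurable (vimage_algebra X (sample_path I Z) (path_space I))"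
    by (rule measurable_compose) (use assms in simp)
  then show ?thesis
    using assms by (simp add: sample_path_def)
qed

text \<open>The last inclusion trades the single-time events of the generator for the \<sigma>-field
  of the path on \<open>{0..t}\<close>; this is the shape to which
  \<open>indep_set_augmented\<close> applies.\<close>

lemma augmented_filtration_props:
  assumes "\<xi> \<in> borel_measurable M" "\<forall>s\<ge>0. W s \<in> borel_measurable M"
  shows "space (augmented_filtration M \<xi> W t) = space M"
    and "sets (augmented_filtration M \<xi> W t) \<subseteq> sets M"
    and "s \<le> t \<Longrightarrow> sets (augmented_filtration M \<xi> W s) \<subseteq> sets (augmented_filtration M \<xi> W t)"
    and "0 \<le> s \<Longrightarrow> s \<le> t \<Longrightarrow> W s \<in> borel_measurable (augmented_filtration M \<xi> W t)"
    and "sets (augmented_filtration M \<xi> W t) \<subseteq> sigma_sets (space M)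
      (sets (vimage_algebra (space M) \<xi> borel) \<union>
       sets (vimage_algebra (space M) (sample_path {0..t} W) (path_space {0..t})) \<union> null_sets M)"
proof -
  define gen where "gen t = ({\<xi> -` A \<inter> space M | A. A \<in> sets borel} \<union>
     {W s -` A \<inter> space M | s A. 0 \<le> s \<and> s \<le> t \<and> A \<in> sets borel} \<union> null_sets M)" for t
  have gM: "gen t \<subseteq> sets M" for t
    using assms by (auto simp: gen_def intro: measurable_sets)
  then have gP: "gen t \<subseteq> Pow (space M)" for t
    using sets.sets_into_space by blast
  have sets: "sets (augmented_filtration M \<xi> W t) = sigma_sets (space M) (gen t)" for t
    using gP[of t] by (simp add: augmented_filtration_def gen_def)
  show sp: "space (augmented_filtration M \<xi> W t) = space M" for t
    using gP[of t] by (simp add: augmented_filtration_def gen_def)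
  show "sets (augmented_filtration M \<xi> W t) \<subseteq> sets M"
    unfolding sets using gM by (rule sets.sigma_sets_subset)
  show "sets (augmented_filtration M \<xi> W s) \<subseteq> sets (augmented_filtration M \<xi> W t)" if "s \<le> t"
  proof -
    have "gen s \<subseteq> gen t"
      unfolding gen_def using that by (intro Un_mono order_refl) (blast intro: order_trans)
    then show ?thesis
      unfolding sets by (rule sigma_sets_mono')
  qed
  show "W s \<in> borel_measurable (augmented_filtration M \<xi> W t)" if "0 \<le> s" "s \<le> t"
  proof (rule measurableI)
    fix A :: "'c set" assume "A \<in> sets borel"
    then have "W s -` A \<inter> space M \<in> gen t"
      using that by (auto simp: gen_def)
    then show "W s -` A \<inter> space (augmented_filtration M \<xi> W t) \<in> sets (augmented_filtration M \<xi> W t)"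
      unfolding sets sp by (rule sigma_sets.Basic)
  qed simp
  have "gen t \<subseteq> sets (vimage_algebra (space M) \<xi> borel) \<union>
       sets (vimage_algebra (space M) (sample_path {0..t} W) (path_space {0..t})) \<union> null_sets M"
  proof -
    have "W s -` A \<inter> space M \<in> sets (vimage_algebra (space M) (sample_path {0..t} W) (path_space {0..t}))"
      if "0 \<le> s" "s \<le> t" "A \<in> sets borel" for s A
      using measurable_sets[OF sample_path_component[of s "{0..t}" W "space M"] that(3)] that by simp
    then show ?thesis
      by (auto simp: gen_def intro: in_vimage_algebra)
  qed
  then show "sets (augmented_filtration M \<xi> W t) \<subseteq> sigma_sets (space M)
      (sets (vimage_algebra (space M) \<xi> borel) \<union>
       sets (vimage_algebra (space M) (sample_path {0..t} W) (path_space {0..t})) \<union> null_sets M)"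
    unfolding sets by (rule sigma_sets_mono')
qed

text \<open>Past and increment of \<open>W\<close> both belong to the path \<sigma>-field, which is
  independent of \<open>X0\<close>. So the event of \<open>X0\<close> splits off first, and then the
  past splits from the increment.\<close>

lemma (in prob_space) augmented_indep_increment:
  assumes W: "wiener_process M W" and X: "X0 \<in> borel_measurable M"
    and indep: "indep_set (sets (vimage_algebra (space M) X0 borel))
      (sets (vimage_algebra (space M) (sample_path {0..} W) (path_space {0..})))"
    and st: "0 \<le> s" "s < t"
  shows "indep_set (sets (augmented_filtration M X0 W s))
    (sets (vimage_algebra (space M) (\<lambda>\<omega>. W t \<omega> - W s \<omega>) borel))"
proof -
  have Wm: "\<forall>r\<ge>0. W r \<in> borel_measurable M"
    using W by (simp add: wiener_process_def)
  let ?path = "vimage_algebra (space M) (sample_path {0..} W) (path_space {0..})"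
  let ?past = "vimage_algebra (space M) (sample_path {0..s} W) (path_space {0..s})"
  let ?incr = "vimage_algebra (space M) (\<lambda>\<omega>. W t \<omega> - W s \<omega>) borel"
  have sub: "sets ?past \<subseteq> sets ?path" "sets ?incr \<subseteq> sets ?path"
    using st by (intro sets_vimage_algebra_subset sample_path_measurable borel_measurable_diff
        sample_path_component; simp)+
  have ev: "sets (vimage_algebra (space M) X0 borel) \<subseteq> events" "sets ?path \<subseteq> events"
    using X Wm by (intro sets_vimage_algebra_subset sample_path_measurable; simp)+
  have top: "space M \<in> sets (vimage_algebra (space M) f N)" for f :: "'a \<Rightarrow> 'd" and N
    using sets.top[of "vimage_algebra (space M) f N"] by simp
  have inc: "indep_set (sets ?past) (sets ?incr)"
    using W st by (simp add: wiener_process_def)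
  have "indep_set (sigma_sets (space M) (sets (vimage_algebra (space M) X0 borel) \<union> sets ?past \<union> null_sets M)) (sets ?incr)"
  proof (rule indep_set_augmented)
    fix a b c assume abc: "a \<in> sets (vimage_algebra (space M) X0 borel)" "b \<in> sets ?past" "c \<in> sets ?incr"
    then have "b \<inter> c \<in> sets ?path"
      using sub by auto
    then have "prob (a \<inter> (b \<inter> c)) = prob a * prob (b \<inter> c)"
      using indep_setD[OF indep abc(1)] by blast
    then show "prob (a \<inter> b \<inter> c) = prob a * prob b * prob c"
      using indep_setD[OF inc abc(2,3)] by (simp add: Int_assoc)
  qed (simp_all add: Int_stable_sets ev order_trans[OF sub(1) ev(2)] order_trans[OF sub(2) ev(2)] top)
  then show ?thesis
    using augmented_filtration_props(5)[OF X Wm, of s] unfolding indep_sets2_eq by blast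
qed

lemma (in prob_space) indep_set_imp_indep_var:
  assumes indep: "indep_set (sets F) (sets G)"
    and space: "space F = space M" "space G = space M" and sets: "sets F \<subseteq> events" "sets G \<subseteq> events"
    and Z: "Z \<in> measurable F T" and Y: "Y \<in> measurable G S"
  shows "indep_var T Z S Y"
proof -
  have sub: "sigma_sets (space M) {f -` A \<inter> space M |A. A \<in> sets L} \<subseteq> sets N" "f \<in> measurable M L"
    if "space N = space M" "sets N \<subseteq> events" "f \<in> measurable N L" for f :: "'a \<Rightarrow> 'b" and L N
  proof -
    have "{f -` A \<inter> space M |A. A \<in> sets L} \<subseteq> sets N"
      using measurable_sets[OF that(3)] by (auto simp: that(1))
    from sets.sigma_sets_subset[OF this]
    show "sigma_sets (space M) {f -` A \<inter> space M |A. A \<in> sets L} \<subseteq> sets N"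
      by (simp add: that(1))
    show "f \<in> measurable M L"
      using measurable_sets[OF that(3)] measurable_space[OF that(3)] that(1,2) by (auto simp: measurable_def)
  qed
  show ?thesis
    unfolding indep_var_eq using sub[OF space(1) sets(1) Z] sub[OF space(2) sets(2) Y] indep
    unfolding indep_sets2_eq by blast
qed

section \<open>Second moments of Ito integrals\<close>

text \<open>The norm on matrices is the Frobenius norm, so Cauchy-Schwarz in each row
  suffices.\<close>

lemma norm_matrix_vector_mult_le:
  fixes A :: "real^'n^'m"
  shows "norm (A *v x) \<le> norm A * norm x"
proof -
  have "(A *v x) $ i = A $ i \<bullet> x" for i
    by (simp add: matrix_vector_mult_def inner_vec_def)
  then have "norm (A *v x) \<le> L2_set (\<lambda>i. norm (A $ i) * norm x) UNIV"
    unfolding norm_vec_def[of "A *v x"] using Cauchy_Schwarz_ineq2 by (intro L2_set_mono) auto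
  also have "\<dots> = norm A * norm x"
    by (simp add: norm_vec_def[of A] L2_set_left_distrib[symmetric])
  finally show ?thesis .
qed

lemma borel_measurable_matrix_vector_mult [measurable (raw)]:
  fixes A :: "'w \<Rightarrow> real^'n^'m"
  assumes "A \<in> borel_measurable N" "x \<in> borel_measurable N"
  shows "(\<lambda>\<omega>. A \<omega> *v x \<omega>) \<in> borel_measurable N"
proof (rule borel_measurable_continuous_Pair[OF assms])
  show "continuous_on UNIV (\<lambda>p :: (real^'n^'m) \<times> (real^'n). fst p *v snd p)"
    unfolding matrix_vector_mult_def by (intro continuous_intros)
qed

text \<open>Separates the data known at the start of a time step from the components of the
  increment, so that the cross term of the isometry is a sum of products of independent
  variables.\<close>

lemma inner_matrix_vector_mult:
  fixes A :: "real^'n^'m"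
  shows "u \<bullet> (A *v x) = (\<Sum>l\<in>UNIV. (\<Sum>i\<in>UNIV. u $ i * A $ i $ l) * x $ l)"
proof -
  have "u \<bullet> (A *v x) = (\<Sum>i\<in>UNIV. \<Sum>l\<in>UNIV. u $ i * A $ i $ l * x $ l)"
    by (simp add: inner_vec_def matrix_vector_mult_def sum_distrib_left mult_ac)
  also have "\<dots> = (\<Sum>l\<in>UNIV. (\<Sum>i\<in>UNIV. u $ i * A $ i $ l) * x $ l)"
    by (subst sum.swap) (simp add: sum_distrib_right)
  finally show ?thesis .
qed

lemma wiener_increment:
  fixes W :: "real \<Rightarrow> 'w \<Rightarrow> real^'p"
  assumes "wiener_process M W" "0 \<le> s" "s \<le> t"
  shows "integrable M (\<lambda>\<omega>. (norm (W t \<omega> - W s \<omega>))\<^sup>2)"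
    and "(\<integral>\<omega>. (norm (W t \<omega> - W s \<omega>))\<^sup>2 \<partial>M) = real CARD('p) * (t - s)"
    and "integrable M (\<lambda>\<omega>. (W t \<omega> - W s \<omega>) $ l)"
    and "(\<integral>\<omega>. (W t \<omega> - W s \<omega>) $ l \<partial>M) = 0"
proof -
  \<comment> \<open>The increment has a density only for \<open>s < t\<close>; for
    \<open>s = t\<close> it is zero and the claims are trivial.\<close>
  have "distributed M lborel (\<lambda>\<omega>. W t \<omega> - W s \<omega>) (gauss (t - s))" if "s < t"
    using assms that by (simp add: wiener_process_def gauss_def[abs_def])
  note d = distributed_integral[OF this, symmetric] distributed_integrable[OF this, symmetric]
  show "integrable M (\<lambda>\<omega>. (norm (W t \<omega> - W s \<omega>))\<^sup>2)"
    using assms d(2)[of "\<lambda>x. (norm x)\<^sup>2"] by (cases "s = t") (simp_all add: gauss_second_moment)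
  show "(\<integral>\<omega>. (norm (W t \<omega> - W s \<omega>))\<^sup>2 \<partial>M) = real CARD('p) * (t - s)"
    using assms d(1)[of "\<lambda>x. (norm x)\<^sup>2"] by (cases "s = t") (simp_all add: gauss_second_moment)
  show "integrable M (\<lambda>\<omega>. (W t \<omega> - W s \<omega>) $ l)"
    using assms d(2)[of "\<lambda>x. x $ l"] by (cases "s = t") (simp_all add: gauss_mean)
  show "(\<integral>\<omega>. (W t \<omega> - W s \<omega>) $ l \<partial>M) = 0"
    using assms d(1)[of "\<lambda>x. x $ l"] by (cases "s = t") (simp_all add: gauss_mean)
qed

text \<open>Induction over the time steps: the cross term has mean zero because the increment is
  centred and independent of the past. An inequality is enough here, and the factor
  \<open>CARD('p)\<close> is the price of bounding the matrix product by the product of the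
  norms.\<close>

lemma (in prob_space) ito_isometry_bound:
  fixes W :: "real \<Rightarrow> 'a \<Rightarrow> real^'p" and \<xi> :: "nat \<Rightarrow> 'a \<Rightarrow> real^'p^'q"
    and X0 :: "'a \<Rightarrow> 'c::topological_space"
  defines "F \<equiv> augmented_filtration M X0 W"
  assumes W: "wiener_process M W" and X0: "X0 \<in> borel_measurable M"
    and indep: "indep_set (sets (vimage_algebra (space M) X0 borel))
      (sets (vimage_algebra (space M) (sample_path {0..} W) (path_space {0..})))"
    and simple: "simple_integrand M F T m \<tau> \<xi>"
  shows "simple_ito_integral W m \<tau> \<xi> \<in> borel_measurable M"
    and "integrable M (\<lambda>\<omega>. (norm (simple_ito_integral W m \<tau> \<xi> \<omega>))\<^sup>2)"
    and "(\<integral>\<omega>. (norm (simple_ito_integral W m \<tau> \<xi> \<omega>))\<^sup>2 \<partial>M) \<le>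
      real CARD('p) * (\<integral>\<omega>. (\<Sum>k<m. (\<tau> (Suc k) - \<tau> k) * (norm (\<xi> k \<omega>))\<^sup>2) \<partial>M)"
proof -
  have Wm: "\<forall>r\<ge>0. W r \<in> borel_measurable M"
    using W by (simp add: wiener_process_def)
  note aug = augmented_filtration_props[OF X0 Wm, folded F_def]
  obtain B where B: "\<And>k \<omega>. k < m \<Longrightarrow> \<omega> \<in> space M \<Longrightarrow> norm (\<xi> k \<omega>) \<le> B"
    using simple unfolding simple_integrand_def by blast
  have \<tau>0: "0 \<le> \<tau> k" if "k \<le> m" for k
    using simple that by (simp add: simple_integrand_def)
  have \<tau>step: "\<tau> k \<le> \<tau> (Suc k)" if "k < m" for k
    using simple that by (simp add: simple_integrand_def)
  have \<tau>mono: "\<tau> j \<le> \<tau> k" if "j \<le> k" "k \<le> m" for j k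
    using that by (induction k rule: dec_induct) (auto intro: order_trans[OF _ \<tau>step])
  have \<xi>F: "\<xi> j \<in> borel_measurable (F (\<tau> k))" if "j \<le> k" "j < m" "k \<le> m" for j k
    using simple aug(1) aug(3)[OF \<tau>mono[OF that(1,3)]] that
    by (intro measurable_mono[OF order_refl refl, THEN subsetD, of "F (\<tau> j)" "F (\<tau> k)"]) (auto simp: simple_integrand_def)
  have FM: "f \<in> borel_measurable M" if "f \<in> borel_measurable (F r)" for r and f :: "'a \<Rightarrow> 'd::topological_space"
    using aug(1,2) that by (intro measurable_mono[OF order_refl refl, THEN subsetD, of "F r" M]) auto
  have SF: "simple_ito_integral W n \<tau> \<xi> \<in> borel_measurable (F (\<tau> n))" if "n \<le> m" for n
  proof -
    have "(\<lambda>\<omega>. \<xi> k \<omega> *v (W (\<tau> (Suc k)) \<omega> - W (\<tau> k) \<omega>)) \<in> borel_measurable (F (\<tau> n))" if "k < n" for k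
      using \<xi>F[of k n] aug(4)[OF \<tau>0 \<tau>mono, of "Suc k" n] aug(4)[OF \<tau>0 \<tau>mono, of k n] that \<open>n \<le> m\<close>
      by (intro borel_measurable_matrix_vector_mult borel_measurable_diff) auto
    then show ?thesis
      unfolding simple_ito_integral_def[abs_def] by (intro borel_measurable_sum) auto
  qed
  show "simple_ito_integral W m \<tau> \<xi> \<in> borel_measurable M"
    using SF[of m] FM by auto
  \<comment> \<open>Anything known at time \<open>\<tau> n\<close> is independent of every
    measurable function of the next increment.\<close>
  have iv: "indep_var borel Z borel (\<lambda>\<omega>. \<phi> (W (\<tau> (Suc n)) \<omega> - W (\<tau> n) \<omega>))"
    if "n < m" "\<tau> n < \<tau> (Suc n)" "Z \<in> borel_measurable (F (\<tau> n))" "\<phi> \<in> borel_measurable borel"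
    for n and Z :: "'a \<Rightarrow> real" and \<phi>
  proof (rule indep_set_imp_indep_var)
    let ?\<Delta> = "\<lambda>\<omega>. W (\<tau> (Suc n)) \<omega> - W (\<tau> n) \<omega>"
    let ?G = "vimage_algebra (space M) ?\<Delta> borel"
    show "indep_set (sets (F (\<tau> n))) (sets ?G)"
      unfolding F_def using that \<tau>0 by (intro augmented_indep_increment[OF W X0 indep]) auto
    show "sets ?G \<subseteq> events"
      using Wm that \<tau>0 by (intro sets_vimage_algebra_subset borel_measurable_diff) auto
    have "?\<Delta> \<in> measurable ?G borel"
      by (rule measurable_vimage_algebra1) auto
    then show "(\<lambda>\<omega>. \<phi> (?\<Delta> \<omega>)) \<in> borel_measurable ?G"
      using that(4) by (rule measurable_compose)
  qed (use aug that in auto)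
  have bint: "integrable M (\<lambda>\<omega>. (norm (\<xi> k \<omega>))\<^sup>2)" if "k < m" for k
    using B[OF that] FM[OF \<xi>F[of k k]] that
    by (intro integrable_const_bound[where B="B\<^sup>2"]) (auto intro!: AE_I2 power_mono)
  have "integrable M (\<lambda>\<omega>. (norm (simple_ito_integral W n \<tau> \<xi> \<omega>))\<^sup>2) \<and>
     (\<integral>\<omega>. (norm (simple_ito_integral W n \<tau> \<xi> \<omega>))\<^sup>2 \<partial>M) \<le>
      real CARD('p) * (\<integral>\<omega>. (\<Sum>k<n. (\<tau> (Suc k) - \<tau> k) * (norm (\<xi> k \<omega>))\<^sup>2) \<partial>M)" if "n \<le> m" for n
    using that
  proof (induction n)
    case 0
    then show ?case by (simp add: simple_ito_integral_def)
  next
    case (Suc n)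
    define S where "S = simple_ito_integral W n \<tau> \<xi>"
    define \<Delta> where "\<Delta> \<omega> = W (\<tau> (Suc n)) \<omega> - W (\<tau> n) \<omega>" for \<omega>
    have n: "n < m" using Suc by simp
    have S2: "integrable M (\<lambda>\<omega>. (norm (S \<omega>))\<^sup>2)"
      and S2le: "(\<integral>\<omega>. (norm (S \<omega>))\<^sup>2 \<partial>M) \<le> real CARD('p) * (\<integral>\<omega>. (\<Sum>k<n. (\<tau> (Suc k) - \<tau> k) * (norm (\<xi> k \<omega>))\<^sup>2) \<partial>M)"
      using Suc by (auto simp: S_def)
    have eq: "simple_ito_integral W (Suc n) \<tau> \<xi> \<omega> = S \<omega> + \<xi> n \<omega> *v \<Delta> \<omega>" for \<omega>
      by (simp add: S_def \<Delta>_def simple_ito_integral_def)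
    have SFn[measurable]: "S \<in> borel_measurable (F (\<tau> n))"
      using SF[of n] n by (simp add: S_def)
    have \<xi>Fn[measurable]: "\<xi> n \<in> borel_measurable (F (\<tau> n))"
      using \<xi>F[of n n] n by simp
    have [measurable]: "S \<in> borel_measurable M" "\<xi> n \<in> borel_measurable M" "\<Delta> \<in> borel_measurable M"
      using FM[OF SFn] FM[OF \<xi>Fn] Wm \<tau>0 n by (auto simp: \<Delta>_def[abs_def] intro!: borel_measurable_diff)
    note inc = wiener_increment[OF W \<tau>0 \<tau>step[OF n], folded \<Delta>_def, OF less_imp_le[OF n]]
    show ?case
    proof (cases "\<tau> n < \<tau> (Suc n)")
      \<comment> \<open>A step of length zero contributes nothing. It is treated apart because
        increments are known to be independent of the past only over proper intervals.\<close>
      case False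
      then have "\<tau> (Suc n) = \<tau> n" using \<tau>step[OF n] by simp
      with S2 S2le show ?thesis
        unfolding eq by (simp add: \<Delta>_def matrix_vector_mult_def zero_vec_def[symmetric])
    next
      case lt: True
      have Sint: "integrable M (\<lambda>\<omega>. norm (S \<omega>))"
        by (rule square_integrable_imp_integrable[OF _ S2]) measurable
      \<comment> \<open>The coefficient of the \<open>l\<close>-th increment component in the cross
        term. It is integrable since \<open>S\<close> is and \<open>\<xi> n\<close> is
        bounded.\<close>
      define U where "U l \<omega> = (\<Sum>i\<in>UNIV. S \<omega> $ i * \<xi> n \<omega> $ i $ l)" for l \<omega>
      have UF: "U l \<in> borel_measurable (F (\<tau> n))" for l
        unfolding U_def[abs_def]
        by (intro borel_measurable_sum borel_measurable_times measurable_compose[OF SFn]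
            measurable_compose[OF \<xi>Fn] borel_measurable_continuous_onI continuous_intros)
      have Uint: "integrable M (U l)" for l
        unfolding U_def[abs_def]
      proof (intro Bochner_Integration.integrable_sum)
        fix i
        show "integrable M (\<lambda>\<omega>. S \<omega> $ i * \<xi> n \<omega> $ i $ l)"
        proof (rule Bochner_Integration.integrable_bound[OF integrable_mult_left[OF Sint, of B]])
          show "AE \<omega> in M. norm (S \<omega> $ i * \<xi> n \<omega> $ i $ l) \<le> norm (norm (S \<omega>) * B)"
          proof (rule AE_I2)
            fix \<omega> assume "\<omega> \<in> space M"
            then have "\<bar>\<xi> n \<omega> $ i $ l\<bar> \<le> B"
              using B[OF n] component_le_norm_cart[of "\<xi> n \<omega> $ i" l] Finite_Cartesian_Product.norm_nth_le[of "\<xi> n \<omega>" i]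
              by fastforce
            moreover have "\<bar>S \<omega> $ i\<bar> \<le> norm (S \<omega>)"
              by (rule component_le_norm_cart)
            ultimately show "norm (S \<omega> $ i * \<xi> n \<omega> $ i $ l) \<le> norm (norm (S \<omega>) * B)"
              by (auto simp: abs_mult intro!: mult_mono)
          qed
        qed (intro borel_measurable_times measurable_compose[OF FM[OF SFn]]
            measurable_compose[OF FM[OF \<xi>Fn]] borel_measurable_continuous_onI continuous_intros)
      qed
      have UD: "integrable M (\<lambda>\<omega>. U l \<omega> * \<Delta> \<omega> $ l)" "(\<integral>\<omega>. U l \<omega> * \<Delta> \<omega> $ l \<partial>M) = 0" for l
      proof -
        have i: "indep_var borel (U l) borel (\<lambda>\<omega>. \<Delta> \<omega> $ l)"
          unfolding \<Delta>_def using iv[OF n lt UF, of "\<lambda>x. x $ l"] by simp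
        show "integrable M (\<lambda>\<omega>. U l \<omega> * \<Delta> \<omega> $ l)"
          by (rule indep_var_integrable[OF i Uint inc(3)])
        show "(\<integral>\<omega>. U l \<omega> * \<Delta> \<omega> $ l \<partial>M) = 0"
          using indep_var_lebesgue_integral[OF i Uint inc(3)] inc(4) by simp
      qed
      have cross: "integrable M (\<lambda>\<omega>. S \<omega> \<bullet> (\<xi> n \<omega> *v \<Delta> \<omega>))" "(\<integral>\<omega>. S \<omega> \<bullet> (\<xi> n \<omega> *v \<Delta> \<omega>) \<partial>M) = 0"
        unfolding inner_matrix_vector_mult U_def[symmetric] using UD by auto
      \<comment> \<open>The diagonal term factorizes as well, now with the squared norms.\<close>
      have i: "indep_var borel (\<lambda>\<omega>. (norm (\<xi> n \<omega>))\<^sup>2) borel (\<lambda>\<omega>. (norm (\<Delta> \<omega>))\<^sup>2)"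
        unfolding \<Delta>_def using \<xi>Fn by (intro iv[OF n lt]) auto
      have prod: "integrable M (\<lambda>\<omega>. (norm (\<xi> n \<omega>))\<^sup>2 * (norm (\<Delta> \<omega>))\<^sup>2)"
        "(\<integral>\<omega>. (norm (\<xi> n \<omega>))\<^sup>2 * (norm (\<Delta> \<omega>))\<^sup>2 \<partial>M) = (\<integral>\<omega>. (norm (\<xi> n \<omega>))\<^sup>2 \<partial>M) * (real CARD('p) * (\<tau> (Suc n) - \<tau> n))"
        using indep_var_integrable[OF i bint[OF n] inc(1)] indep_var_lebesgue_integral[OF i bint[OF n] inc(1)] inc(2)
        by simp_all
      have le: "(norm (\<xi> n \<omega> *v \<Delta> \<omega>))\<^sup>2 \<le> (norm (\<xi> n \<omega>))\<^sup>2 * (norm (\<Delta> \<omega>))\<^sup>2" for \<omega>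
        using power_mono[OF norm_matrix_vector_mult_le norm_ge_zero, of "\<xi> n \<omega>" "\<Delta> \<omega>" 2]
        by (simp add: power_mult_distrib)
      have mv: "(\<lambda>\<omega>. \<xi> n \<omega> *v \<Delta> \<omega>) \<in> borel_measurable M"
        by measurable
      have diag: "integrable M (\<lambda>\<omega>. (norm (\<xi> n \<omega> *v \<Delta> \<omega>))\<^sup>2)"
        using mv le by (intro Bochner_Integration.integrable_bound[OF prod(1)]) auto
      have exp: "(norm (S \<omega> + \<xi> n \<omega> *v \<Delta> \<omega>))\<^sup>2 = (norm (S \<omega>))\<^sup>2 + 2 * (S \<omega> \<bullet> (\<xi> n \<omega> *v \<Delta> \<omega>)) + (norm (\<xi> n \<omega> *v \<Delta> \<omega>))\<^sup>2" for \<omega>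
        by (simp add: power2_norm_eq_inner inner_add_left inner_add_right inner_commute)
      have "(\<integral>\<omega>. (norm (S \<omega> + \<xi> n \<omega> *v \<Delta> \<omega>))\<^sup>2 \<partial>M) = (\<integral>\<omega>. (norm (S \<omega>))\<^sup>2 \<partial>M) + (\<integral>\<omega>. (norm (\<xi> n \<omega> *v \<Delta> \<omega>))\<^sup>2 \<partial>M)"
        unfolding exp using S2 cross diag by simp
      also have "(\<integral>\<omega>. (norm (\<xi> n \<omega> *v \<Delta> \<omega>))\<^sup>2 \<partial>M) \<le> (\<integral>\<omega>. (norm (\<xi> n \<omega>))\<^sup>2 * (norm (\<Delta> \<omega>))\<^sup>2 \<partial>M)"
        by (intro integral_mono diag prod le)
      also note prod(2)
      finally have "(\<integral>\<omega>. (norm (S \<omega> + \<xi> n \<omega> *v \<Delta> \<omega>))\<^sup>2 \<partial>M) \<le>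
          real CARD('p) * (\<integral>\<omega>. (\<Sum>k<n. (\<tau> (Suc k) - \<tau> k) * (norm (\<xi> k \<omega>))\<^sup>2) \<partial>M)
          + (\<integral>\<omega>. (norm (\<xi> n \<omega>))\<^sup>2 \<partial>M) * (real CARD('p) * (\<tau> (Suc n) - \<tau> n))"
        using S2le by simp
      moreover have "integrable M (\<lambda>\<omega>. \<Sum>k<n. (\<tau> (Suc k) - \<tau> k) * (norm (\<xi> k \<omega>))\<^sup>2)"
        using n by (intro Bochner_Integration.integrable_sum integrable_mult_right bint) auto
      ultimately show ?thesis
        unfolding eq using S2 cross diag bint[OF n] by (simp add: exp algebra_simps)
    qed
  qed
  from this[OF order_refl]
  show "integrable M (\<lambda>\<omega>. (norm (simple_ito_integral W m \<tau> \<xi> \<omega>))\<^sup>2)"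
    and "(\<integral>\<omega>. (norm (simple_ito_integral W m \<tau> \<xi> \<omega>))\<^sup>2 \<partial>M) \<le>
      real CARD('p) * (\<integral>\<omega>. (\<Sum>k<m. (\<tau> (Suc k) - \<tau> k) * (norm (\<xi> k \<omega>))\<^sup>2) \<partial>M)"
    by auto
qed

text \<open>From \<open>\<bar>\<xi>\<bar>\<^sup>2 \<le> 2 \<bar>H - \<xi>\<bar>\<^sup>2 + 2
  B\<^sup>2\<close> on each interval. It shows that a simple process close to a bounded integrand
  has a controlled second moment, although the bounds on the individual simple processes need not be
  uniform.\<close>

lemma simple_process_square_lower_bound:
  fixes \<xi> :: "nat \<Rightarrow> 'w \<Rightarrow> real^'p^'q"
  assumes \<tau>: "\<And>k. k \<le> m \<Longrightarrow> 0 \<le> \<tau> k \<and> \<tau> k \<le> T" "\<And>k. k < m \<Longrightarrow> \<tau> k \<le> \<tau> (Suc k)"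
    and H: "\<And>s. 0 \<le> s \<Longrightarrow> s \<le> T \<Longrightarrow> norm (H s) \<le> B" and "0 \<le> T"
  shows "ennreal ((\<Sum>k<m. (\<tau> (Suc k) - \<tau> k) * (norm (\<xi> k \<omega>))\<^sup>2) / 2 - B\<^sup>2 * T) \<le>
    (\<integral>\<^sup>+s\<in>{0..T}. ennreal ((norm (H s - simple_process m \<tau> \<xi> s \<omega>))\<^sup>2) \<partial>lborel)"
proof -
  \<comment> \<open>Truncation at 0 makes the lower bound on each interval a nonnegative constant,
    fit for the nonnegative integral.\<close>
  define c where "c k = max 0 ((norm (\<xi> k \<omega>))\<^sup>2 / 2 - B\<^sup>2)" for k
  have \<tau>mono: "\<tau> j \<le> \<tau> k" if "j \<le> k" "k \<le> m" for j k
    using that by (induction k rule: dec_induct) (auto intro: order_trans[OF _ \<tau>(2)])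
  have tele: "(\<Sum>k<m. \<tau> (Suc k) - \<tau> k) = \<tau> m - \<tau> 0"
    by (rule sum_lessThan_telescope)
  have "(\<Sum>k<m. (\<tau> (Suc k) - \<tau> k) * (norm (\<xi> k \<omega>))\<^sup>2) / 2 - B\<^sup>2 * T \<le>
      (\<Sum>k<m. (\<tau> (Suc k) - \<tau> k) * (norm (\<xi> k \<omega>))\<^sup>2) / 2 - B\<^sup>2 * (\<Sum>k<m. \<tau> (Suc k) - \<tau> k)"
    unfolding tele using \<tau>(1)[of m] \<tau>(1)[of 0] by (intro diff_left_mono mult_left_mono) auto
  also have "\<dots> = (\<Sum>k<m. ((norm (\<xi> k \<omega>))\<^sup>2 / 2 - B\<^sup>2) * (\<tau> (Suc k) - \<tau> k))"
    by (simp add: sum_divide_distrib sum_distrib_left algebra_simps flip: sum_subtractf)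
  also have "\<dots> \<le> (\<Sum>k<m. c k * (\<tau> (Suc k) - \<tau> k))"
    using \<tau>(2) by (intro sum_mono mult_right_mono) (auto simp: c_def)
  finally have "ennreal ((\<Sum>k<m. (\<tau> (Suc k) - \<tau> k) * (norm (\<xi> k \<omega>))\<^sup>2) / 2 - B\<^sup>2 * T) \<le>
      ennreal (\<Sum>k<m. c k * (\<tau> (Suc k) - \<tau> k))"
    by (rule ennreal_leI)
  also have "\<dots> = (\<Sum>k<m. ennreal (c k) * emeasure lborel {\<tau> k<..\<tau> (Suc k)})"
    using \<tau>(2) by (subst sum_ennreal[symmetric]) (auto simp: c_def ennreal_mult intro!: sum.cong)
  also have "\<dots> = (\<integral>\<^sup>+s. (\<Sum>k<m. ennreal (c k) * indicator {\<tau> k<..\<tau> (Suc k)} s) \<partial>lborel)"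
    by (subst nn_integral_sum) (auto intro!: sum.cong simp: nn_integral_cmult_indicator)
  also have "\<dots> \<le> (\<integral>\<^sup>+s\<in>{0..T}. ennreal ((norm (H s - simple_process m \<tau> \<xi> s \<omega>))\<^sup>2) \<partial>lborel)"
  proof (rule nn_integral_mono)
    fix s
    show "(\<Sum>k<m. ennreal (c k) * indicator {\<tau> k<..\<tau> (Suc k)} s) \<le>
      ennreal ((norm (H s - simple_process m \<tau> \<xi> s \<omega>))\<^sup>2) * indicator {0..T} s"
    proof (cases "\<exists>j<m. s \<in> {\<tau> j<..\<tau> (Suc j)}")
      case False
      then have "(\<Sum>k<m. ennreal (c k) * indicator {\<tau> k<..\<tau> (Suc k)} s) = 0"
        by (intro sum.neutral) (auto simp: indicator_def)
      then show ?thesis by simp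
    next
      case True
      then obtain j where j: "j < m" "s \<in> {\<tau> j<..\<tau> (Suc j)}" by blast
      \<comment> \<open>The intervals are half-open, hence disjoint, and only the
        \<open>j\<close>-th summand survives at \<open>s\<close>.\<close>
      have uniq: "indicator {\<tau> k<..\<tau> (Suc k)} s = (0::real)" "indicator {\<tau> k<..\<tau> (Suc k)} s = (0::ennreal)" if "k < m" "k \<noteq> j" for k
        using \<tau>mono[of "Suc k" j] \<tau>mono[of "Suc j" k] j that by (auto simp: indicator_def not_less_eq_eq linorder_neq_iff)
      have sp: "simple_process m \<tau> \<xi> s \<omega> = \<xi> j \<omega>"
        unfolding simple_process_def using j
        by (subst sum.remove[of _ j]) (auto simp: uniq intro!: sum.neutral)
      have s: "(\<Sum>k<m. ennreal (c k) * indicator {\<tau> k<..\<tau> (Suc k)} s) = ennreal (c j)"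
        using j by (subst sum.remove[of _ j]) (auto simp: uniq intro!: sum.neutral)
      have s0: "0 \<le> s" "s \<le> T"
        using j \<tau>(1)[of j] \<tau>(1)[of "Suc j"] by auto
      have "norm (\<xi> j \<omega>) \<le> norm (H s - \<xi> j \<omega>) + B"
        using norm_triangle_sub[of "\<xi> j \<omega>" "H s"] H[OF s0] by (simp add: norm_minus_commute)
      then have "(norm (\<xi> j \<omega>))\<^sup>2 \<le> (norm (H s - \<xi> j \<omega>) + B)\<^sup>2"
        by (rule power_mono) simp
      moreover have "(norm (H s - \<xi> j \<omega>) + B)\<^sup>2 \<le> 2 * (norm (H s - \<xi> j \<omega>))\<^sup>2 + 2 * B\<^sup>2"
        using sum_squares_bound[of "norm (H s - \<xi> j \<omega>)" B] by (simp add: power2_sum)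
      ultimately have "c j \<le> (norm (H s - \<xi> j \<omega>))\<^sup>2"
        by (simp add: c_def)
      then show ?thesis
        unfolding s sp using s0 by (simp add: ennreal_leI)
    qed
  qed
  finally show ?thesis .
qed

text \<open>The bound is proved for the approximating simple integrals and passed to the limit. In
  the constant 4, one factor 2 comes from splitting \<open>I\<close> into error and approximation,
  the other from \<open>simple_process_square_lower_bound\<close>.\<close>

lemma (in prob_space) ito_integral_second_moment:
  fixes W :: "real \<Rightarrow> 'a \<Rightarrow> real^'p" and H :: "real \<Rightarrow> 'a \<Rightarrow> real^'p^'q"
    and X0 :: "'a \<Rightarrow> 'c::topological_space"
  assumes W: "wiener_process M W" and X0: "X0 \<in> borel_measurable M"
    and indep: "indep_set (sets (vimage_algebra (space M) X0 borel))
      (sets (vimage_algebra (space M) (sample_path {0..} W) (path_space {0..})))"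
    and ito: "has_ito_integral M (augmented_filtration M X0 W) W H T I"
    and H: "\<And>s \<omega>. 0 \<le> s \<Longrightarrow> s \<le> T \<Longrightarrow> \<omega> \<in> space M \<Longrightarrow> norm (H s \<omega>) \<le> B" and T: "0 \<le> T"
  shows "(\<integral>\<^sup>+\<omega>. ennreal ((norm (I \<omega>))\<^sup>2) \<partial>M) \<le> ennreal (4 * real CARD('p) * B\<^sup>2 * T)"
proof -
  have [measurable]: "I \<in> borel_measurable M"
    using ito by (simp add: has_ito_integral_def)
  obtain m \<tau> \<xi> where simple: "\<And>n. simple_integrand M (augmented_filtration M X0 W) T (m n) (\<tau> n) (\<xi> n)"
    and Hlim: "(\<lambda>n. \<integral>\<^sup>+\<omega>. (\<integral>\<^sup>+s\<in>{0..T}. ennreal ((norm (H s \<omega> - simple_process (m n) (\<tau> n) (\<xi> n) s \<omega>))\<^sup>2)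
              \<partial>lborel) \<partial>M) \<longlonglongrightarrow> 0" (is "?J \<longlonglongrightarrow> 0")
    and Ilim: "(\<lambda>n. \<integral>\<^sup>+\<omega>. ennreal ((norm (I \<omega> - simple_ito_integral W (m n) (\<tau> n) (\<xi> n) \<omega>))\<^sup>2) \<partial>M)
        \<longlonglongrightarrow> 0" (is "?x \<longlonglongrightarrow> 0")
    using ito unfolding has_ito_integral_def by blast
  define p where "p = real CARD('p)"
  have p: "p \<ge> 0" by (simp add: p_def)
  have le: "(\<integral>\<^sup>+\<omega>. ennreal ((norm (I \<omega>))\<^sup>2) \<partial>M) \<le> 2 * ?x n + 2 * (ennreal p * (2 * ?J n + ennreal (2 * B\<^sup>2 * T)))" for n
  proof -
    define S where "S = simple_ito_integral W (m n) (\<tau> n) (\<xi> n)"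
    \<comment> \<open>The time integral of the squared simple process.\<close>
    define u where "u \<omega> = (\<Sum>k<m n. (\<tau> n (Suc k) - \<tau> n k) * (norm (\<xi> n k \<omega>))\<^sup>2)" for \<omega>
    note iso = ito_isometry_bound[OF W X0 indep simple[of n], folded S_def u_def p_def]
    note [measurable] = iso(1)
    have \<tau>: "\<And>k. k \<le> m n \<Longrightarrow> 0 \<le> \<tau> n k \<and> \<tau> n k \<le> T" "\<And>k. k < m n \<Longrightarrow> \<tau> n k \<le> \<tau> n (Suc k)"
      using simple[of n] by (auto simp: simple_integrand_def)
    have Wm: "\<forall>r\<ge>0. W r \<in> borel_measurable M"
      using W by (simp add: wiener_process_def)
    have [measurable]: "\<xi> n k \<in> borel_measurable M" if "k < m n" for k
      using augmented_filtration_props(1,2)[OF X0 Wm] simple[of n] that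
      by (intro measurable_mono[OF order_refl refl, THEN subsetD, of "augmented_filtration M X0 W (\<tau> n k)" M])
        (auto simp: simple_integrand_def)
    have um[measurable]: "u \<in> borel_measurable M"
      unfolding u_def[abs_def] by measurable
    obtain b where b: "\<And>k \<omega>. k < m n \<Longrightarrow> \<omega> \<in> space M \<Longrightarrow> norm (\<xi> n k \<omega>) \<le> b"
      using simple[of n] unfolding simple_integrand_def by blast
    have u0: "u \<omega> \<ge> 0" for \<omega>
      using \<tau> by (auto simp: u_def intro!: sum_nonneg)
    have uint: "integrable M u"
      unfolding u_def[abs_def]
    proof (intro Bochner_Integration.integrable_sum integrable_mult_right)
      fix k assume "k \<in> {..<m n}"
      then show "integrable M (\<lambda>\<omega>. (norm (\<xi> n k \<omega>))\<^sup>2)"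
        using b[of k] by (intro integrable_const_bound[where B="b\<^sup>2"]) (auto intro!: AE_I2 power_mono)
    qed
    have "(\<integral>\<^sup>+\<omega>. ennreal ((norm (S \<omega>))\<^sup>2) \<partial>M) = ennreal (\<integral>\<omega>. (norm (S \<omega>))\<^sup>2 \<partial>M)"
      by (rule nn_integral_eq_integral[OF iso(2)]) simp
    also have "\<dots> \<le> ennreal (p * (\<integral>\<omega>. u \<omega> \<partial>M))"
      by (rule ennreal_leI[OF iso(3)])
    also have "\<dots> = ennreal p * (\<integral>\<^sup>+\<omega>. ennreal (u \<omega>) \<partial>M)"
      using p u0 by (simp add: ennreal_mult' nn_integral_eq_integral[OF uint])
    \<comment> \<open>\<open>ennreal\<close> sends negative numbers to 0, so the first term is the
      positive part of \<open>u / 2 - B\<^sup>2 * T\<close>, which the approximation error in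
      \<open>H\<close> dominates.\<close>
    also have "(\<integral>\<^sup>+\<omega>. ennreal (u \<omega>) \<partial>M) \<le> (\<integral>\<^sup>+\<omega>. 2 * ennreal (u \<omega> / 2 - B\<^sup>2 * T) + ennreal (2 * B\<^sup>2 * T) \<partial>M)"
    proof (rule nn_integral_mono)
      fix \<omega>
      have "ennreal (u \<omega>) \<le> ennreal (2 * max 0 (u \<omega> / 2 - B\<^sup>2 * T) + 2 * B\<^sup>2 * T)"
        by (intro ennreal_leI) (simp add: max_def)
      also have "\<dots> = 2 * ennreal (u \<omega> / 2 - B\<^sup>2 * T) + ennreal (2 * B\<^sup>2 * T)"
        using T by (simp add: ennreal_mult')
      finally show "ennreal (u \<omega>) \<le> 2 * ennreal (u \<omega> / 2 - B\<^sup>2 * T) + ennreal (2 * B\<^sup>2 * T)" .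
    qed
    also have "\<dots> = 2 * (\<integral>\<^sup>+\<omega>. ennreal (u \<omega> / 2 - B\<^sup>2 * T) \<partial>M) + ennreal (2 * B\<^sup>2 * T)"
      by (subst nn_integral_add) (auto simp: nn_integral_cmult emeasure_space_1)
    also have "(\<integral>\<^sup>+\<omega>. ennreal (u \<omega> / 2 - B\<^sup>2 * T) \<partial>M) \<le> ?J n"
      unfolding u_def using \<tau> H T
      by (intro nn_integral_mono simple_process_square_lower_bound) auto
    finally have S: "(\<integral>\<^sup>+\<omega>. ennreal ((norm (S \<omega>))\<^sup>2) \<partial>M) \<le> ennreal p * (2 * ?J n + ennreal (2 * B\<^sup>2 * T))"
      by (simp add: mult_left_mono add_mono)
    have "(\<integral>\<^sup>+\<omega>. ennreal ((norm (I \<omega>))\<^sup>2) \<partial>M) \<le>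
        (\<integral>\<^sup>+\<omega>. 2 * ennreal ((norm (I \<omega> - S \<omega>))\<^sup>2) + 2 * ennreal ((norm (S \<omega>))\<^sup>2) \<partial>M)"
    proof (rule nn_integral_mono)
      fix \<omega>
      have "(norm (I \<omega>))\<^sup>2 \<le> (norm (I \<omega> - S \<omega>) + norm (S \<omega>))\<^sup>2"
        using norm_triangle_sub[of "I \<omega>" "S \<omega>"] by (intro power_mono) auto
      also have "\<dots> \<le> 2 * (norm (I \<omega> - S \<omega>))\<^sup>2 + 2 * (norm (S \<omega>))\<^sup>2"
        using sum_squares_bound[of "norm (I \<omega> - S \<omega>)" "norm (S \<omega>)"] by (simp add: power2_sum)
      finally have "ennreal ((norm (I \<omega>))\<^sup>2) \<le> ennreal (2 * (norm (I \<omega> - S \<omega>))\<^sup>2 + 2 * (norm (S \<omega>))\<^sup>2)"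
        by (rule ennreal_leI)
      then show "ennreal ((norm (I \<omega>))\<^sup>2) \<le> 2 * ennreal ((norm (I \<omega> - S \<omega>))\<^sup>2) + 2 * ennreal ((norm (S \<omega>))\<^sup>2)"
        by (simp add: ennreal_mult')
    qed
    also have "\<dots> = 2 * ?x n + 2 * (\<integral>\<^sup>+\<omega>. ennreal ((norm (S \<omega>))\<^sup>2) \<partial>M)"
      by (subst nn_integral_add) (auto simp: nn_integral_cmult S_def[symmetric])
    also have "\<dots> \<le> 2 * ?x n + 2 * (ennreal p * (2 * ?J n + ennreal (2 * B\<^sup>2 * T)))"
      using S by (intro add_left_mono mult_left_mono) auto
    finally show ?thesis .
  qed
  \<comment> \<open>Both approximation errors vanish in the limit; only the term from the bound on
    \<open>H\<close> remains.\<close>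
  have "(\<lambda>n. 2 * ?x n + 2 * (ennreal p * (2 * ?J n + ennreal (2 * B\<^sup>2 * T)))) \<longlonglongrightarrow>
      2 * 0 + 2 * (ennreal p * (2 * 0 + ennreal (2 * B\<^sup>2 * T)))"
    by (intro tendsto_add ennreal_tendsto_cmult tendsto_const Hlim Ilim) auto
  then have "(\<integral>\<^sup>+\<omega>. ennreal ((norm (I \<omega>))\<^sup>2) \<partial>M) \<le> 2 * 0 + 2 * (ennreal p * (2 * 0 + ennreal (2 * B\<^sup>2 * T)))"
    by (rule LIMSEQ_le_const) (use le in auto)
  also have "\<dots> = ennreal 2 * (ennreal p * ennreal (2 * B\<^sup>2 * T))"
    by simp
  also have "\<dots> = ennreal (2 * (p * (2 * B\<^sup>2 * T)))"
    using p T by (simp only: ennreal_mult mult_nonneg_nonneg zero_le_power2 zero_le_numeral)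
  finally show ?thesis
    by (simp add: p_def mult_ac)
qed

section \<open>Paths as perturbed solutions of the drift equation\<close>

text \<open>Left-endpoint sums express a time integral through countably many times. Measurability
  and moment bounds for single times thereby carry over to time integrals, with no joint
  measurability in time and outcome.\<close>

definition riemann_sum :: "nat \<Rightarrow> real \<Rightarrow> (real \<Rightarrow> 'a::real_vector) \<Rightarrow> 'a" where
  "riemann_sum n t u = (\<Sum>k<n. (t / real n) *\<^sub>R u (real k * t / real n))"

lemma riemann_sum_tendsto:
  fixes u :: "real \<Rightarrow> 'a::euclidean_space"
  assumes u: "continuous_on {0..t} u" and t: "t > 0"
  shows "(\<lambda>n. riemann_sum n t u) \<longlonglongrightarrow> integral {0..t} u"
proof (rule LIMSEQ_I)
  fix r :: real assume "r > 0"
  \<comment> \<open>The accumulated error is at most \<open>e * t = r / 2\<close>.\<close>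
  define e where "e = r / (2 * t)"
  have e: "e > 0" using \<open>r > 0\<close> t by (simp add: e_def)
  have "uniformly_continuous_on {0..t} u"
    using u by (rule compact_uniformly_continuous) simp
  then obtain d where d: "d > 0" "\<And>x y. x \<in> {0..t} \<Longrightarrow> y \<in> {0..t} \<Longrightarrow> dist y x < d \<Longrightarrow> dist (u y) (u x) < e"
    unfolding uniformly_continuous_on_def using e by metis
  obtain N where N: "N > 0" "t / d < real N"
    using reals_Archimedean2[of "max 0 (t / d)"] by (metis max_less_iff_conj of_nat_0_less_iff)
  have "norm (riemann_sum n t u - integral {0..t} u) < r" if "n \<ge> N" for n
  proof -
    have n: "n > 0" "t / real n < d"
    proof -
      show "n > 0" using N that by simp
      have "t / d < real n" using N that by simp
      then show "t / real n < d"
        using d(1) \<open>n > 0\<close> by (simp add: field_simps)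
    qed
    define a where "a k = real k * t / real n" for k
    have a: "a (Suc k) - a k = t / real n" "a k \<le> a (Suc k)" "0 \<le> a k" for k
      using n t by (auto simp: a_def field_simps)
    have at: "a k \<le> t" if "k \<le> n" for k
      using n t that by (simp add: a_def field_simps)
    have int: "u integrable_on {a i..a j}" if "j \<le> n" for i j
      using at[OF that] a(3)[of i] by (intro integrable_continuous_interval continuous_on_subset[OF u]) auto
    have amono: "a i \<le> a j" if "i \<le> j" for i j
      using n t that by (simp add: a_def divide_right_mono mult_right_mono)
    have split: "integral {0..a k} u = (\<Sum>i<k. integral {a i..a (Suc i)} u)" if "k \<le> n" for k
      using that
    proof (induction k)
      case 0 then show ?case by (simp add: a_def)
    next
      case (Suc k)
      have "integral {0..a (Suc k)} u = integral {0..a k} u + integral {a k..a (Suc k)} u"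
        using a int[OF Suc.prems, of 0] by (intro Henstock_Kurzweil_Integration.integral_combine[symmetric]) (auto simp: a_def)
      with Suc show ?case by simp
    qed
    have step: "norm ((t / real n) *\<^sub>R u (a k) - integral {a k..a (Suc k)} u) \<le> e * (t / real n)" if k: "k < n" for k
    proof -
      have "((\<lambda>x. u (a k) - u x) has_integral ((t / real n) *\<^sub>R u (a k) - integral {a k..a (Suc k)} u)) {a k..a (Suc k)}"
        using has_integral_const_real[of "u (a k)" "a k" "a (Suc k)"] a int[of "Suc k" k] k
        by (intro has_integral_diff integrable_integral) auto
      moreover have "norm (u (a k) - u x) \<le> e" if "x \<in> {a k..a (Suc k)}" for x
      proof -
        have "dist (a k) x < d"
          using that a(1)[of k] n(2) by (auto simp: dist_real_def)
        moreover have "x \<in> {0..t}" "a k \<in> {0..t}"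
          using that a at[of "Suc k"] at[of k] k by (auto intro: order_trans)
        ultimately show ?thesis
          using d(2)[of x "a k"] by (simp add: dist_norm less_imp_le)
      qed
      ultimately have "norm ((t / real n) *\<^sub>R u (a k) - integral {a k..a (Suc k)} u) \<le> e * measure lborel (cbox (a k) (a (Suc k)))"
        using e by (intro has_integral_bound[where f="\<lambda>x. u (a k) - u x"]) auto
      then show ?thesis
        using a by simp
    qed
    have "a n = t" using n by (simp add: a_def)
    then have "riemann_sum n t u - integral {0..t} u = (\<Sum>k<n. (t / real n) *\<^sub>R u (a k) - integral {a k..a (Suc k)} u)"
      using split[of n] by (simp add: riemann_sum_def a_def sum_subtractf)
    also have "norm \<dots> \<le> (\<Sum>k<n. e * (t / real n))"
      using step by (intro sum_norm_le) auto
    also have "\<dots> < r"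
      using n t \<open>r > 0\<close> by (simp add: e_def)
    finally show ?thesis .
  qed
  then show "\<exists>N. \<forall>n\<ge>N. norm (riemann_sum n t u - integral {0..t} u) < r"
    by blast
qed

text \<open>A path is a perturbed solution of the drift equation; two paths are compared through the
  perturbations only, so no flow of the drift is needed.\<close>

definition path_noise :: "('a \<Rightarrow> 'a::euclidean_space) \<Rightarrow> (real \<Rightarrow> 'a) \<Rightarrow> real \<Rightarrow> 'a" where
  "path_noise b x s = x s - x 0 - integral {0..s} (\<lambda>r. b (x r))"

definition mean_noise :: "('a \<Rightarrow> 'a::euclidean_space) \<Rightarrow> real \<Rightarrow> (real \<Rightarrow> 'a) \<Rightarrow> real" where
  "mean_noise b t x = integral {0..t} (\<lambda>s. norm (path_noise b x s)) / t"

text \<open>If \<open>x + k x\<close> is the observation function multiplied by the inverse of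
  \<open>C\<close>, this is the transformed observation divided by \<open>t\<close>, with the
  observation noise removed.\<close>

definition mean_obs :: "('a \<Rightarrow> 'a::euclidean_space) \<Rightarrow> real \<Rightarrow> (real \<Rightarrow> 'a) \<Rightarrow> 'a" where
  "mean_obs k t x = integral {0..t} (\<lambda>s. x s + k (x s)) /\<^sub>R t"

lemma path_noise_continuous:
  assumes "continuous_on {0..t} x" "L-lipschitz_on UNIV b"
  shows "continuous_on {0..t} (path_noise b x)"
proof -
  have "continuous_on {0..t} (\<lambda>r. b (x r))"
    using continuous_on_compose2[OF lipschitz_on_continuous_on[OF assms(2)] assms(1)] by simp
  then show ?thesis
    unfolding path_noise_def[abs_def]
    by (intro continuous_intros assms indefinite_integral_continuous_1 integrable_continuous_interval)
qed

section \<open>Recovering the initial value from the averaged path\<close>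

text \<open>Over a short time the difference of two paths stays near its initial value, up to drift
  and noise, so its time average is nearly that value; as \<open>k\<close> is a contraction, it
  cannot cancel this in the averaged observation. The drift is controlled by the mean distance
  \<open>m\<close> of the paths in place of a Gronwall argument.\<close>

lemma initial_value_stability:
  fixes x y :: "real \<Rightarrow> 'a::euclidean_space"
  assumes x: "continuous_on {0..t} x" and y: "continuous_on {0..t} y"
    and b: "L-lipschitz_on UNIV b" and k: "\<kappa>-lipschitz_on UNIV k" and t: "0 < t" "2 * (L * t) + \<kappa> < 1"
  shows "(1 - (2 * (L * t) + \<kappa>)) * norm (x 0 - y 0) \<le>
    norm (mean_obs k t x - mean_obs k t y) + 2 * (mean_noise b t x + mean_noise b t y)"
proof -
  define \<Delta> where "\<Delta> s = x s - y s" for s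
  define \<delta> where "\<delta> = \<Delta> 0"
  define m where "m = integral {0..t} (\<lambda>s. norm (\<Delta> s)) / t"
  define e where "e = mean_noise b t x + mean_noise b t y"
  have L: "L \<ge> 0" and \<kappa>: "\<kappa> \<ge> 0"
    using b k by (auto simp: lipschitz_on_def)
  have c\<Delta>: "continuous_on {0..t} \<Delta>"
    unfolding \<Delta>_def[abs_def] by (intro continuous_intros x y)
  have comp: "continuous_on {0..t} (\<lambda>r. f (z r))" if "continuous_on {0..t} z" "M-lipschitz_on UNIV f" for z M and f :: "'a \<Rightarrow> 'a"
    using continuous_on_compose2[OF lipschitz_on_continuous_on[OF that(2)] that(1)] by simp
  note cb = comp[OF x b] comp[OF y b] and ck = comp[OF x k] comp[OF y k]
  note cN = path_noise_continuous[OF x b] path_noise_continuous[OF y b]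
  note ii = integrable_continuous_interval
  have lip: "norm (b (x r) - b (y r)) \<le> L * norm (\<Delta> r)" "norm (k (x r) - k (y r)) \<le> \<kappa> * norm (\<Delta> r)" for r
    using lipschitz_onD[OF b, of "x r" "y r"] lipschitz_onD[OF k, of "x r" "y r"] by (auto simp: dist_norm \<Delta>_def)
  \<comment> \<open>The drift contribution up to time \<open>s\<close> is bounded by its total over
    \<open>{0..t}\<close>, which is \<open>L * t\<close> times the mean distance.\<close>
  have point: "norm (\<Delta> s - \<delta>) \<le> L * (m * t) + (norm (path_noise b x s) + norm (path_noise b y s))" if s: "s \<in> {0..t}" for s
  proof -
    have sub: "{0..s} \<subseteq> {0..t}" using s by auto
    have "\<Delta> s - \<delta> = integral {0..s} (\<lambda>r. b (x r) - b (y r)) + (path_noise b x s - path_noise b y s)"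
      by (subst Henstock_Kurzweil_Integration.integral_diff)
        (auto simp: \<Delta>_def \<delta>_def path_noise_def intro!: ii continuous_on_subset[OF cb(1) sub] continuous_on_subset[OF cb(2) sub])
    moreover have "norm (integral {0..s} (\<lambda>r. b (x r) - b (y r))) \<le> integral {0..s} (\<lambda>r. L * norm (\<Delta> r))"
      using lip by (intro integral_norm_bound_integral ii continuous_intros continuous_on_subset[OF cb(1) sub]
        continuous_on_subset[OF cb(2) sub] continuous_on_subset[OF c\<Delta> sub]) auto
    moreover have "integral {0..s} (\<lambda>r. L * norm (\<Delta> r)) \<le> integral {0..t} (\<lambda>r. L * norm (\<Delta> r))"
      using L by (intro integral_subset_le sub ii continuous_intros continuous_on_subset[OF c\<Delta> sub] c\<Delta>) auto
    moreover have "integral {0..t} (\<lambda>r. L * norm (\<Delta> r)) = L * (m * t)"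
      using t by (simp add: m_def)
    ultimately show ?thesis
      using norm_triangle_ineq[of "integral {0..s} (\<lambda>r. b (x r) - b (y r))" "path_noise b x s - path_noise b y s"]
        norm_triangle_ineq4[of "path_noise b x s" "path_noise b y s"] by (smt (verit))
  qed
  have "integral {0..t} (\<lambda>s. norm (\<Delta> s - \<delta>)) \<le>
      integral {0..t} (\<lambda>s. L * (m * t) + (norm (path_noise b x s) + norm (path_noise b y s)))"
    using point by (intro integral_le ii continuous_intros c\<Delta> cN) auto
  also have "\<dots> = (L * t * m + e) * t"
    using t by (subst Henstock_Kurzweil_Integration.integral_add | (intro ii continuous_intros cN)[1])+
      (simp add: e_def mean_noise_def field_simps)
  finally have dev: "integral {0..t} (\<lambda>s. norm (\<Delta> s - \<delta>)) / t \<le> L * t * m + e"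
    using t by (simp add: field_simps)
  have m0: "m \<ge> 0"
    using t by (auto simp: m_def intro!: divide_nonneg_pos integral_nonneg ii continuous_intros c\<Delta>)
  have "integral {0..t} (\<lambda>s. norm (\<Delta> s)) \<le> integral {0..t} (\<lambda>s. norm \<delta> + norm (\<Delta> s - \<delta>))"
    using norm_triangle_sub[of _ \<delta>] by (intro integral_le ii continuous_intros c\<Delta>) auto
  also have "\<dots> = t * norm \<delta> + integral {0..t} (\<lambda>s. norm (\<Delta> s - \<delta>))"
    using t by (subst Henstock_Kurzweil_Integration.integral_add) (auto intro!: ii continuous_intros c\<Delta>)
  finally have "m \<le> norm \<delta> + integral {0..t} (\<lambda>s. norm (\<Delta> s - \<delta>)) / t"
    using t by (simp add: m_def field_simps)
  with dev have m1: "m \<le> norm \<delta> + L * t * m + e" by simp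
  \<comment> \<open>Subtracting the constant \<delta> leaves only the deviation from the initial
    difference and the contribution of \<open>k\<close>.\<close>
  have "mean_obs k t x - mean_obs k t y - \<delta> = integral {0..t} (\<lambda>s. (\<Delta> s - \<delta>) + (k (x s) - k (y s))) /\<^sub>R t"
  proof -
    have "integral {0..t} (\<lambda>s. (\<Delta> s - \<delta>) + (k (x s) - k (y s))) =
       integral {0..t} (\<lambda>s. ((x s + k (x s)) - (y s + k (y s))) - \<delta>)"
      by (intro Henstock_Kurzweil_Integration.integral_cong) (simp add: \<Delta>_def)
    also have "\<dots> = integral {0..t} (\<lambda>s. x s + k (x s)) - integral {0..t} (\<lambda>s. y s + k (y s)) - t *\<^sub>R \<delta>"
      using t by (subst Henstock_Kurzweil_Integration.integral_diff | (intro ii continuous_intros x y ck)[1])+ simp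
    finally show ?thesis
      using t by (simp add: mean_obs_def scaleR_diff_right)
  qed
  also have "norm \<dots> \<le> integral {0..t} (\<lambda>s. norm (\<Delta> s - \<delta>) + \<kappa> * norm (\<Delta> s)) / t"
  proof -
    have "norm (integral {0..t} (\<lambda>s. (\<Delta> s - \<delta>) + (k (x s) - k (y s)))) \<le> integral {0..t} (\<lambda>s. norm (\<Delta> s - \<delta>) + \<kappa> * norm (\<Delta> s))"
      using lip(2) by (intro integral_norm_bound_integral ii continuous_intros c\<Delta> ck norm_triangle_mono) auto
    then show ?thesis
      using t by (simp add: divide_right_mono divide_inverse_commute)
  qed
  also have "integral {0..t} (\<lambda>s. norm (\<Delta> s - \<delta>) + \<kappa> * norm (\<Delta> s)) / t = integral {0..t} (\<lambda>s. norm (\<Delta> s - \<delta>)) / t + \<kappa> * m"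
    by (subst Henstock_Kurzweil_Integration.integral_add) (auto simp: m_def add_divide_distrib intro!: ii continuous_intros c\<Delta>)
  also note dev
  finally have "norm (mean_obs k t x - mean_obs k t y - \<delta>) \<le> (L * t + \<kappa>) * m + e"
    by (simp add: algebra_simps)
  then have "norm \<delta> \<le> norm (mean_obs k t x - mean_obs k t y) + (L * t + \<kappa>) * m + e"
    using norm_triangle_sub[of \<delta> "mean_obs k t x - mean_obs k t y"] by (simp add: norm_minus_commute)
  moreover have "(L * t + \<kappa>) * m \<le> (2 * (L * t) + \<kappa>) * norm \<delta> + e"
  proof -
    define q where "q = L * t"
    have q: "q \<ge> 0" "2 * q + \<kappa> < 1" using L t by (auto simp: q_def)
    have e0: "e \<ge> 0"
      using t by (auto simp: e_def mean_noise_def intro!: add_nonneg_nonneg divide_nonneg_pos integral_nonneg ii continuous_intros cN)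
    have m1': "(1 - q) * m \<le> norm \<delta> + e" using m1 by (simp add: q_def algebra_simps)
    \<comment> \<open>This allows \<open>m\<close> to be eliminated through
      \<open>(1 - q) * m \<le> norm \<delta> + e\<close> without dividing by \<open>1 - q\<close>;
      it uses \<open>2 * q + \<kappa> < 1\<close>.\<close>
    have "(q + \<kappa>) \<le> (2 * q + \<kappa>) * (1 - q)"
    proof -
      have "q * (2 * q + \<kappa>) \<le> q * 1" using q by (intro mult_left_mono) auto
      then show ?thesis by (simp add: algebra_simps)
    qed
    then have "(q + \<kappa>) * m \<le> (2 * q + \<kappa>) * ((1 - q) * m)"
      using mult_right_mono[OF _ m0] by (simp add: mult.assoc[symmetric])
    also have "\<dots> \<le> (2 * q + \<kappa>) * (norm \<delta> + e)"
      using m1' q \<kappa> by (intro mult_left_mono) auto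
    also have "\<dots> \<le> (2 * q + \<kappa>) * norm \<delta> + e"
      unfolding distrib_left[of "2 * q + \<kappa>"] using q \<kappa> e0 by (intro add_left_mono mult_left_le_one_le) auto
    finally show ?thesis by (simp add: q_def)
  qed
  ultimately have "(1 - (2 * (L * t) + \<kappa>)) * norm \<delta> \<le> norm (mean_obs k t x - mean_obs k t y) + 2 * e"
    by (simp add: algebra_simps)
  then show ?thesis
    by (simp add: \<delta>_def \<Delta>_def e_def)
qed

lemma mean_noise_nonneg:
  assumes "continuous_on {0..t} x" "L-lipschitz_on UNIV b" "0 < t"
  shows "0 \<le> mean_noise b t x"
  unfolding mean_noise_def using assms path_noise_continuous[OF assms(1,2)]
  by (intro divide_nonneg_pos integral_nonneg integrable_continuous_interval continuous_intros) auto

text \<open>A McShane-type infimum over all continuous paths turns the stability estimate into a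
  Lipschitz function of the averaged observation that recovers the test function up to noise.\<close>

lemma initial_value_reconstruction:
  fixes b k :: "'a::euclidean_space \<Rightarrow> 'a" and f :: "'a \<Rightarrow> real"
  defines "c \<equiv> \<lambda>L \<kappa> t :: real. 1 / (1 - (2 * (L * t) + \<kappa>))"
  assumes b: "L-lipschitz_on UNIV b" and k: "\<kappa>-lipschitz_on UNIV k" and t: "0 < t" "2 * (L * t) + \<kappa> < 1"
    and f: "\<And>x. \<bar>f x\<bar> \<le> 1" "\<And>x y. \<bar>f x - f y\<bar> \<le> norm (x - y)"
  obtains g where "\<And>z. \<bar>g z\<bar> \<le> 1" "\<And>z w. \<bar>g z - g w\<bar> \<le> c L \<kappa> t * norm (z - w)"
    "\<And>x. continuous_on {0..t} x \<Longrightarrow> \<bar>g (mean_obs k t x) - f (x 0)\<bar> \<le> 2 * c L \<kappa> t * mean_noise b t x"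
proof -
  define K where "K = c L \<kappa> t"
  have K: "K > 0" using t by (simp add: K_def c_def)
  define S where "S = {x :: real \<Rightarrow> 'a. continuous_on {0..t} x}"
  have S: "(\<lambda>_. 0) \<in> S" by (simp add: S_def)
  then have ne: "S \<noteq> {}" by blast
  \<comment> \<open>A competing path pays for its mismatch with \<open>z\<close> and for its own
    noise, both at the rate of the stability estimate.\<close>
  define \<phi> where "\<phi> z x = f (x 0) + K * norm (z - mean_obs k t x) + 2 * K * mean_noise b t x" for z x
  define G where "G z = (INF x\<in>S. \<phi> z x)" for z
  have lower: "-1 \<le> \<phi> z x" if "x \<in> S" for z x
  proof -
    have "0 \<le> K * norm (z - mean_obs k t x)" "0 \<le> 2 * K * mean_noise b t x"
      using K mean_noise_nonneg[OF _ b t(1), of x] that by (simp_all add: S_def)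
    then show ?thesis
      unfolding \<phi>_def using f(1)[of "x 0"] by linarith
  qed
  have bdd: "bdd_below (\<phi> z ` S)" for z
    using lower by (auto simp: bdd_below_def)
  have GLip: "G z \<le> G w + K * norm (z - w)" for z w
  proof -
    have "G z - K * norm (z - w) \<le> G w"
      unfolding G_def[of w]
    proof (rule cINF_greatest[OF ne])
      fix x assume x: "x \<in> S"
      have "G z \<le> \<phi> z x"
        unfolding G_def by (rule cINF_lower[OF bdd x])
      moreover have "norm (z - mean_obs k t x) \<le> norm (z - w) + norm (w - mean_obs k t x)"
        using norm_triangle_ineq[of "z - w" "w - mean_obs k t x"] by simp
      then have "K * norm (z - mean_obs k t x) \<le> K * (norm (z - w) + norm (w - mean_obs k t x))"
        using K by (intro mult_left_mono) auto
      ultimately show "G z - K * norm (z - w) \<le> \<phi> w x"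
        by (simp add: \<phi>_def algebra_simps)
    qed
    then show ?thesis by simp
  qed
  have Gl: "-1 \<le> G z" for z
    unfolding G_def by (rule cINF_greatest[OF ne]) (rule lower)
  \<comment> \<open>Only the upper truncation is required, since \<open>G\<close> is at least -1
    already.\<close>
  define g where "g z = min 1 (G z)" for z
  show ?thesis
  proof (rule that[of g])
    show "\<bar>g z\<bar> \<le> 1" for z
      using Gl[of z] by (auto simp: g_def)
    show "\<bar>g z - g w\<bar> \<le> c L \<kappa> t * norm (z - w)" for z w
      using GLip[of z w] GLip[of w z] K by (auto simp: g_def norm_minus_commute min_def K_def)
    fix x :: "real \<Rightarrow> 'a" assume x: "continuous_on {0..t} x"
    then have xS: "x \<in> S" by (simp add: S_def)
    have nn: "0 \<le> mean_noise b t x"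
      by (rule mean_noise_nonneg[OF x b t(1)])
    \<comment> \<open>Upper bound: the path itself competes, with mismatch zero. The lower bound
      below applies stability against every competitor, whose noise is already charged in
      \<phi>.\<close>
    have "G (mean_obs k t x) \<le> \<phi> (mean_obs k t x) x"
      unfolding G_def by (rule cINF_lower[OF bdd xS])
    then have up: "G (mean_obs k t x) \<le> f (x 0) + 2 * K * mean_noise b t x"
      by (simp add: \<phi>_def)
    have low: "f (x 0) - 2 * K * mean_noise b t x \<le> G (mean_obs k t x)"
      unfolding G_def
    proof (rule cINF_greatest[OF ne])
      fix y assume "y \<in> S"
      then have y: "continuous_on {0..t} y" by (simp add: S_def)
      have "norm (x 0 - y 0) \<le> K * (norm (mean_obs k t x - mean_obs k t y) + 2 * (mean_noise b t x + mean_noise b t y))"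
        using initial_value_stability[OF x y b k t] t(2) by (simp add: K_def c_def field_simps)
      moreover have "f (x 0) - f (y 0) \<le> norm (x 0 - y 0)"
        using f(2)[of "x 0" "y 0"] by simp
      ultimately show "f (x 0) - 2 * K * mean_noise b t x \<le> \<phi> (mean_obs k t x) y"
        by (simp add: \<phi>_def algebra_simps)
    qed
    show "\<bar>g (mean_obs k t x) - f (x 0)\<bar> \<le> 2 * c L \<kappa> t * mean_noise b t x"
    proof -
      have "0 \<le> 2 * K * mean_noise b t x" using K nn by simp
      then show ?thesis
        unfolding K_def[symmetric] g_def using up low f(1)[of "x 0"] by linarith
    qed
  qed
qed

section \<open>The hidden Markov model\<close>

lemma hmm_solutionD:
  assumes "hmm_solution b \<sigma> h D M W V X Y"
  shows "prob_space M" "wiener_process M W" "wiener_process M V" "X 0 \<in> borel_measurable M"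
    "prob_space.indep_sets M
      (\<lambda>i::nat. [sets (vimage_algebra (space M) (X 0) borel),
                 sets (vimage_algebra (space M) (sample_path {0..} W) (path_space {0..})),
                 sets (vimage_algebra (space M) (sample_path {0..} V) (path_space {0..}))] ! i) {0, 1, 2}"
    "\<And>t. t \<ge> 0 \<Longrightarrow> X t \<in> borel_measurable (augmented_filtration M (X 0) W t)"
    "\<And>t. t \<ge> 0 \<Longrightarrow> Y t \<in> borel_measurable M"
    "AE \<omega> in M. continuous_on {0..} (\<lambda>t. X t \<omega>)"
    "\<And>t. t \<ge> 0 \<Longrightarrow> \<exists>I. has_ito_integral M (augmented_filtration M (X 0) W) W (\<lambda>s \<omega>. \<sigma> (X s \<omega>)) t I \<and>
      (AE \<omega> in M. X t \<omega> = X 0 \<omega> + integral {0..t} (\<lambda>s. b (X s \<omega>)) + I \<omega>)"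
    "AE \<omega> in M. \<forall>t\<ge>0. Y t \<omega> = integral {0..t} (\<lambda>s. h (X s \<omega>)) + D *v V t \<omega>"
  using assms unfolding hmm_solution_def by simp_all

lemma (in prob_space) indep_three:
  assumes "indep_sets (\<lambda>i::nat. [A, B, C] ! i) {0, 1, 2}"
  shows "A \<subseteq> events" "B \<subseteq> events" "C \<subseteq> events"
    and "a \<in> A \<Longrightarrow> b \<in> B \<Longrightarrow> c \<in> C \<Longrightarrow> prob (a \<inter> b \<inter> c) = prob a * prob b * prob c"
    and "indep_set A B"
proof -
  show ev: "A \<subseteq> events" "B \<subseteq> events" "C \<subseteq> events"
    using assms by (auto simp: indep_sets_def)
  have "prob (\<Inter>j\<in>{0, 1, 2::nat}. [a, b, c] ! j) = (\<Prod>j\<in>{0, 1, 2::nat}. prob ([a, b, c] ! j))"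
    if "a \<in> A" "b \<in> B" "c \<in> C" for a b c
    using that by (intro indep_setsD[OF assms]) auto
  then show "prob (a \<inter> b \<inter> c) = prob a * prob b * prob c" if "a \<in> A" "b \<in> B" "c \<in> C"
    using that by (simp add: Int_assoc mult.assoc)
  have "prob (\<Inter>j\<in>{0, 1::nat}. [a, b] ! j) = (\<Prod>j\<in>{0, 1::nat}. prob ([a, b] ! j))"
    if "a \<in> A" "b \<in> B" for a b
    using that by (intro indep_setsD[OF assms]) auto
  then show "indep_set A B"
    using ev by (intro indep_setI) auto
qed

lemma hmm_signal_measurable:
  fixes X :: "real \<Rightarrow> 'w \<Rightarrow> real^'q"
  assumes sol: "hmm_solution b \<sigma> h D M W V X Y" and st: "0 \<le> s" "s \<le> t"
  shows "X s \<in> borel_measurable (augmented_filtration M (X 0) W t)" "X s \<in> borel_measurable M"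
proof -
  note sol = hmm_solutionD[OF sol]
  have Wm: "\<forall>r\<ge>0. W r \<in> borel_measurable M"
    using sol(2) by (simp add: wiener_process_def)
  note aug = augmented_filtration_props[OF sol(4) Wm]
  have mono: "f \<in> borel_measurable N'" if "f \<in> borel_measurable N" "space N = space N'" "sets N \<subseteq> sets N'"
    for f :: "'w \<Rightarrow> real^'q" and N N'
    using measurable_mono[OF order_refl refl that(3,2)] that(1) by blast
  show 1: "X s \<in> borel_measurable (augmented_filtration M (X 0) W t)"
    by (rule mono[OF sol(6)[OF st(1)]]) (use aug(1) aug(3)[OF st(2)] in auto)
  show "X s \<in> borel_measurable M"
    by (rule mono[OF 1]) (use aug in auto)
qed

text \<open>Weighted arithmetic-geometric mean with weight \<open>c\<close>, integrated.\<close>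

lemma expectation_norm_le:
  fixes I :: "'w \<Rightarrow> 'a::euclidean_space"
  assumes "prob_space M" and [measurable]: "I \<in> borel_measurable M" and "c > 0"
    and I2: "(\<integral>\<^sup>+\<omega>. ennreal ((norm (I \<omega>))\<^sup>2) \<partial>M) \<le> ennreal (c\<^sup>2)"
  shows "(\<integral>\<^sup>+\<omega>. ennreal (norm (I \<omega>)) \<partial>M) \<le> ennreal c"
proof -
  interpret prob_space M by fact
  have "(\<integral>\<^sup>+\<omega>. ennreal (norm (I \<omega>)) \<partial>M) \<le> (\<integral>\<^sup>+\<omega>. ennreal (1 / (2 * c)) * ennreal ((norm (I \<omega>))\<^sup>2) + ennreal (c / 2) \<partial>M)"
  proof (rule nn_integral_mono)
    fix \<omega>
    have "norm (I \<omega>) \<le> 1 / (2 * c) * (norm (I \<omega>))\<^sup>2 + c / 2"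
      using sum_squares_bound[of "norm (I \<omega>)" c] assms(3) by (simp add: field_simps power2_eq_square)
    then have "ennreal (norm (I \<omega>)) \<le> ennreal (1 / (2 * c) * (norm (I \<omega>))\<^sup>2 + c / 2)"
      by (rule ennreal_leI)
    also have "\<dots> = ennreal (1 / (2 * c)) * ennreal ((norm (I \<omega>))\<^sup>2) + ennreal (c / 2)"
      using assms(3) by (subst ennreal_plus) (auto simp: ennreal_mult[symmetric])
    finally show "ennreal (norm (I \<omega>)) \<le> ennreal (1 / (2 * c)) * ennreal ((norm (I \<omega>))\<^sup>2) + ennreal (c / 2)" .
  qed
  also have "\<dots> = ennreal (1 / (2 * c)) * (\<integral>\<^sup>+\<omega>. ennreal ((norm (I \<omega>))\<^sup>2) \<partial>M) + ennreal (c / 2)"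
    by (subst nn_integral_add) (auto simp: nn_integral_cmult emeasure_space_1)
  also have "\<dots> \<le> ennreal (1 / (2 * c)) * ennreal (c\<^sup>2) + ennreal (c / 2)"
    using I2 by (intro add_right_mono mult_left_mono) auto
  also have "\<dots> = ennreal (1 / (2 * c) * c\<^sup>2 + c / 2)"
    using assms(3) by (subst ennreal_plus) (auto simp: ennreal_mult[symmetric])
  also have "1 / (2 * c) * c\<^sup>2 + c / 2 = c"
    using assms(3) by (simp add: field_simps power2_eq_square)
  finally show ?thesis .
qed

text \<open>The path noise at time \<open>s\<close> is the Ito integral of \<sigma>, whose mean norm
  is of order \<open>sqrt s\<close> by the bound on \<sigma>. Riemann sums and Fatou carry this over
  to the time average. The law of \<open>X 0\<close> does not enter the bound.\<close>

lemma hmm_mean_noise_bound: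
  fixes X :: "real \<Rightarrow> 'w \<Rightarrow> real^'q" and \<sigma> :: "real^'q \<Rightarrow> real^'p^'q"
  assumes sol: "hmm_solution b \<sigma> h D M W V X Y" and b: "L-lipschitz_on UNIV b"
    and \<sigma>: "\<And>x. norm (\<sigma> x) \<le> B" and B: "B > 0" and t: "t > 0"
  shows "(\<integral>\<^sup>+\<omega>. ennreal (mean_noise b t (\<lambda>s. X s \<omega>)) \<partial>M) \<le> ennreal (2 * B * sqrt (real CARD('p) * t))"
proof -
  note sol' = hmm_solutionD[OF sol]
  interpret prob_space M by (rule sol'(1))
  define c where "c = 2 * B * sqrt (real CARD('p) * t)"
  have c: "c > 0" using B t by (simp add: c_def)
  have c2: "c\<^sup>2 = 4 * real CARD('p) * B\<^sup>2 * t"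
    using t by (simp add: c_def power_mult_distrib)
  have "\<forall>s\<in>{0..}. \<exists>I. has_ito_integral M (augmented_filtration M (X 0) W) W (\<lambda>s \<omega>. \<sigma> (X s \<omega>)) s I \<and>
      (AE \<omega> in M. X s \<omega> = X 0 \<omega> + integral {0..s} (\<lambda>s. b (X s \<omega>)) + I \<omega>)"
    using sol'(9) by auto
  then obtain I where I: "\<And>s. s \<ge> 0 \<Longrightarrow> has_ito_integral M (augmented_filtration M (X 0) W) W (\<lambda>s \<omega>. \<sigma> (X s \<omega>)) s (I s)"
    and IX: "\<And>s. s \<ge> 0 \<Longrightarrow> AE \<omega> in M. X s \<omega> = X 0 \<omega> + integral {0..s} (\<lambda>s. b (X s \<omega>)) + I s \<omega>"
    unfolding bchoice_iff by auto
  have Im[measurable]: "I s \<in> borel_measurable M" if "s \<ge> 0" for s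
    using I[OF that] by (simp add: has_ito_integral_def)
  have I1: "(\<integral>\<^sup>+\<omega>. ennreal (norm (I s \<omega>)) \<partial>M) \<le> ennreal c" if s: "0 \<le> s" "s \<le> t" for s
  proof (rule expectation_norm_le[OF sol'(1) Im[OF s(1)] c])
    have "(\<integral>\<^sup>+\<omega>. ennreal ((norm (I s \<omega>))\<^sup>2) \<partial>M) \<le> ennreal (4 * real CARD('p) * B\<^sup>2 * s)"
      by (rule ito_integral_second_moment[OF sol'(2,4) indep_three(5)[OF sol'(5)] I[OF s(1)] _ s(1)]) (rule \<sigma>)
    also have "\<dots> \<le> ennreal (c\<^sup>2)"
      unfolding c2 using s by (intro ennreal_leI mult_left_mono) auto
    finally show "(\<integral>\<^sup>+\<omega>. ennreal ((norm (I s \<omega>))\<^sup>2) \<partial>M) \<le> ennreal (c\<^sup>2)" .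
  qed
  define R where "R n \<omega> = (\<Sum>k<n. 1 / real n * norm (I (real k * t / real n) \<omega>))" for n \<omega>
  have [measurable]: "R n \<in> borel_measurable M" for n
    unfolding R_def[abs_def] using t by (intro borel_measurable_sum borel_measurable_times borel_measurable_norm Im) auto
  \<comment> \<open>The signal equation holds outside a null set that depends on the time, so it is
    used only at the countably many grid times.\<close>
  have "AE \<omega> in M. \<forall>n k. X (real k * t / real n) \<omega> = X 0 \<omega> + integral {0..real k * t / real n} (\<lambda>s. b (X s \<omega>)) + I (real k * t / real n) \<omega>"
    unfolding AE_all_countable using t by (intro allI IX) auto
  \<comment> \<open>The limit exists almost surely and is written as a lower limit to suit Fatou's
    lemma.\<close>
  then have ae: "AE \<omega> in M. ennreal (mean_noise b t (\<lambda>s. X s \<omega>)) = liminf (\<lambda>n. ennreal (R n \<omega>))"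
    using sol'(8)
  proof eventually_elim
    case (elim \<omega>)
    have x: "continuous_on {0..t} (\<lambda>s. X s \<omega>)"
      using elim(2) by (rule continuous_on_subset) auto
    have N: "path_noise b (\<lambda>s. X s \<omega>) (real k * t / real n) = I (real k * t / real n) \<omega>" for k n :: nat
      using elim(1) by (simp add: path_noise_def)
    have "(\<lambda>n. riemann_sum n t (\<lambda>s. norm (path_noise b (\<lambda>s. X s \<omega>) s)) / t) \<longlonglongrightarrow> mean_noise b t (\<lambda>s. X s \<omega>)"
      unfolding mean_noise_def using t
      by (intro tendsto_divide tendsto_const riemann_sum_tendsto continuous_intros path_noise_continuous[OF x b]) auto
    moreover have "riemann_sum n t (\<lambda>s. norm (path_noise b (\<lambda>s. X s \<omega>) s)) / t = R n \<omega>" for n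
      using t by (simp add: riemann_sum_def R_def N sum_divide_distrib)
    ultimately have "(\<lambda>n. ennreal (R n \<omega>)) \<longlonglongrightarrow> ennreal (mean_noise b t (\<lambda>s. X s \<omega>))"
      by (intro tendsto_ennrealI) simp
    then show ?case
      by (intro lim_imp_Liminf[symmetric]) auto
  qed
  have Rn: "(\<integral>\<^sup>+\<omega>. ennreal (R n \<omega>) \<partial>M) \<le> ennreal c" for n
  proof (cases "n = 0")
    case True
    then show ?thesis by (simp add: R_def)
  next
    case False
    have "(\<integral>\<^sup>+\<omega>. ennreal (R n \<omega>) \<partial>M) = (\<integral>\<^sup>+\<omega>. (\<Sum>k<n. ennreal (1 / real n) * ennreal (norm (I (real k * t / real n) \<omega>))) \<partial>M)"
      unfolding R_def by (simp add: ennreal_mult[symmetric])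
    also have "\<dots> = (\<Sum>k<n. ennreal (1 / real n) * (\<integral>\<^sup>+\<omega>. ennreal (norm (I (real k * t / real n) \<omega>)) \<partial>M))"
      using t by (subst nn_integral_sum) (auto simp: nn_integral_cmult)
    also have "\<dots> \<le> (\<Sum>k<n. ennreal (1 / real n) * ennreal c)"
    proof (intro sum_mono mult_left_mono I1)
      fix k assume "k \<in> {..<n}"
      then show "real k * t / real n \<le> t"
        using t by (simp add: field_simps)
    qed (use t in auto)
    also have "\<dots> = ennreal (\<Sum>k<n. 1 / real n * c)"
      using c by (subst sum_ennreal[symmetric]) (auto intro!: sum.cong simp: ennreal_mult[symmetric] simp del: sum_constant)
    also have "(\<Sum>k<n. 1 / real n * c) = c"
      using False by simp
    finally show ?thesis .
  qed
  have "(\<integral>\<^sup>+\<omega>. ennreal (mean_noise b t (\<lambda>s. X s \<omega>)) \<partial>M) = (\<integral>\<^sup>+\<omega>. liminf (\<lambda>n. ennreal (R n \<omega>)) \<partial>M)"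
    using ae by (rule nn_integral_cong_AE)
  also have "\<dots> \<le> liminf (\<lambda>n. \<integral>\<^sup>+\<omega>. ennreal (R n \<omega>) \<partial>M)"
    by (rule nn_integral_liminf) measurable
  also have "\<dots> \<le> liminf (\<lambda>n::nat. ennreal c)"
    by (intro Liminf_mono) (simp add: Rn)
  also have "\<dots> = ennreal c"
    by (simp add: Liminf_const)
  finally show ?thesis
    by (simp add: c_def)
qed

text \<open>A version of the integrated signal that is measurable for the past of \<open>X 0\<close>
  and \<open>W\<close>, and so independent of \<open>V\<close>. A pointwise limit of Riemann sums
  provides it; on discontinuous paths its value does not matter.\<close>

lemma hmm_integrated_signal:
  fixes X :: "real \<Rightarrow> 'w \<Rightarrow> real^'q"
  assumes sol: "hmm_solution b \<sigma> h D M W V X Y" and h: "continuous_on UNIV h" and t: "t > 0"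
  obtains A where "A \<in> borel_measurable (augmented_filtration M (X 0) W t)"
    and "AE \<omega> in M. A \<omega> = integral {0..t} (\<lambda>s. h (X s \<omega>))"
proof
  define A where "A \<omega> = lim (\<lambda>n. riemann_sum n t (\<lambda>s. h (X s \<omega>)))" for \<omega>
  show "A \<in> borel_measurable (augmented_filtration M (X 0) W t)"
    unfolding A_def[abs_def]
  proof (rule borel_measurable_lim_metric)
    fix n :: nat
    show "(\<lambda>\<omega>. riemann_sum n t (\<lambda>s. h (X s \<omega>))) \<in> borel_measurable (augmented_filtration M (X 0) W t)"
      unfolding riemann_sum_def
    proof (intro borel_measurable_sum borel_measurable_scaleR borel_measurable_const
        measurable_compose[OF hmm_signal_measurable(1)[OF sol] borel_measurable_continuous_onI[OF h]])
      fix k assume "k \<in> {..<n}"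
      then show "real k * t / real n \<le> t"
        using t by (simp add: field_simps)
    qed (use t in auto)
  qed
  show "AE \<omega> in M. A \<omega> = integral {0..t} (\<lambda>s. h (X s \<omega>))"
    using hmm_solutionD(8)[OF sol]
  proof eventually_elim
    case (elim \<omega>)
    have "continuous_on {0..t} (\<lambda>s. h (X s \<omega>))"
      using continuous_on_subset[OF elim, of "{0..t}"] by (intro continuous_on_compose2[OF h]) auto
    from riemann_sum_tendsto[OF this t] show ?case
      by (simp add: A_def limI)
  qed
qed

text \<open>\<open>Y t\<close> is almost surely the sum of \<open>A\<close> and
  \<open>D *v V t\<close>, which are independent. The joint law is therefore a product, and Fubini
  integrates out the observation noise first.\<close>

lemma hmm_observation_law:
  fixes X :: "real \<Rightarrow> 'w \<Rightarrow> real^'q" and D :: "real^'r^'q" and F :: "real^'q \<Rightarrow> real"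
  assumes sol: "hmm_solution b \<sigma> h D M W V X Y" and t: "t > 0"
    and A: "A \<in> borel_measurable (augmented_filtration M (X 0) W t)"
    and AI: "AE \<omega> in M. A \<omega> = integral {0..t} (\<lambda>s. h (X s \<omega>))"
    and F[measurable]: "F \<in> borel_measurable borel" and FB: "\<And>x. \<bar>F x\<bar> \<le> B"
  shows "(\<integral>\<omega>. F (Y t \<omega>) \<partial>M) = (\<integral>\<omega>. (\<integral>v. F (A \<omega> + D *v v) * gauss t v \<partial>lborel) \<partial>M)"
proof -
  note sol' = hmm_solutionD[OF sol]
  interpret prob_space M by (rule sol'(1))
  note ind = indep_three[OF sol'(5)]
  have Wm: "\<forall>r\<ge>0. W r \<in> borel_measurable M" and Vm: "\<forall>r\<ge>0. V r \<in> borel_measurable M"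
    using sol'(2,3) by (auto simp: wiener_process_def)
  note aug = augmented_filtration_props[OF sol'(4) Wm]
  let ?X0 = "vimage_algebra (space M) (X 0) borel"
  let ?Wp = "vimage_algebra (space M) (sample_path {0..} W) (path_space {0..})"
  let ?Wt = "vimage_algebra (space M) (sample_path {0..t} W) (path_space {0..t})"
  let ?Vp = "vimage_algebra (space M) (sample_path {0..} V) (path_space {0..})"
  have sub: "sets ?Wt \<subseteq> sets ?Wp"
    by (intro sets_vimage_algebra_subset sample_path_measurable sample_path_component; simp)
  have top: "space M \<in> sets (vimage_algebra (space M) f N)" for f :: "'w \<Rightarrow> 'd" and N
    using sets.top[of "vimage_algebra (space M) f N"] by simp
  have "indep_set (sigma_sets (space M) (sets ?X0 \<union> sets ?Wt \<union> null_sets M)) (sets ?Vp)"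
    by (rule indep_set_augmented)
      (use ind(4) sub in \<open>simp_all add: Int_stable_sets top ind(1,3) order_trans[OF sub ind(2)] subsetD\<close>)
  then have indAV: "indep_set (sets (augmented_filtration M (X 0) W t)) (sets ?Vp)"
    using aug(5)[of t] unfolding indep_sets2_eq by blast
  define U where "U \<omega> = D *v V t \<omega>" for \<omega>
  have Dm[measurable]: "(\<lambda>v. D *v v) \<in> borel_measurable borel"
    by measurable
  have Um: "U \<in> borel_measurable ?Vp"
    unfolding U_def[abs_def] using t by (intro measurable_compose[OF sample_path_component Dm]) auto
  have iv: "indep_var borel A borel U"
    using aug(1,2) ind(3) by (intro indep_set_imp_indep_var[OF indAV _ _ _ _ A Um]) simp_all
  have [measurable]: "A \<in> borel_measurable M" "U \<in> borel_measurable M" "V t \<in> borel_measurable M" "V 0 \<in> borel_measurable M"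
    using iv Vm t by (auto simp: indep_var_distribution_eq)
  interpret A: prob_space "distr M borel A" by (rule prob_space_distr) simp
  interpret U: prob_space "distr M borel U" by (rule prob_space_distr) simp
  interpret AU: pair_prob_space "distr M borel A" "distr M borel U" ..
  have dist: "distr M borel A \<Otimes>\<^sub>M distr M borel U = distr M (borel \<Otimes>\<^sub>M borel) (\<lambda>x. (A x, U x))"
    using iv by (simp add: indep_var_distribution_eq)
  have UV: "(\<integral>u. F (a + u) \<partial>distr M borel U) = (\<integral>v. F (a + D *v v) * gauss t v \<partial>lborel)" for a
  proof -
    have "\<forall>s t. 0 \<le> s \<and> s < t \<longrightarrow> distributed M lborel (\<lambda>\<omega>. V t \<omega> - V s \<omega>) (gauss (t - s))"
      using sol'(3) by (simp add: wiener_process_def gauss_def[abs_def])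
    from this[rule_format, of 0 t] have d: "distributed M lborel (\<lambda>\<omega>. V t \<omega> - V 0 \<omega>) (gauss t)"
      using t by simp
    have "(\<integral>u. F (a + u) \<partial>distr M borel U) = (\<integral>\<omega>. F (a + D *v V t \<omega>) \<partial>M)"
      by (subst integral_distr) (auto simp: U_def)
    \<comment> \<open>The Gaussian density is given for increments, and \<open>V 0\<close> vanishes
      almost surely.\<close>
    also have "\<dots> = (\<integral>\<omega>. F (a + D *v (V t \<omega> - V 0 \<omega>)) \<partial>M)"
    proof (rule integral_cong_AE)
      show "AE \<omega> in M. F (a + D *v V t \<omega>) = F (a + D *v (V t \<omega> - V 0 \<omega>))"
        using sol'(3) by (auto simp: wiener_process_def elim: eventually_mono)
    qed measurable
    also have "\<dots> = (\<integral>v. gauss t v * F (a + D *v v) \<partial>lborel)"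
      by (rule distributed_integral[OF d, symmetric]) auto
    finally show ?thesis by (simp add: mult.commute)
  qed
  have int: "integrable (distr M borel A \<Otimes>\<^sub>M distr M borel U) (\<lambda>(a, u). F (a + u))"
    using FB by (intro AU.P.integrable_const_bound[where B=B]) (auto intro!: AE_I2)
  have "(\<integral>\<omega>. F (Y t \<omega>) \<partial>M) = (\<integral>\<omega>. F (A \<omega> + U \<omega>) \<partial>M)"
  proof (rule integral_cong_AE)
    show "AE \<omega> in M. F (Y t \<omega>) = F (A \<omega> + U \<omega>)"
      using AI sol'(10) by eventually_elim (use t in \<open>simp add: U_def\<close>)
  qed (use sol'(7)[of t] t in auto)
  also have "\<dots> = (\<integral>x. (case x of (a, u) \<Rightarrow> F (a + u)) \<partial>(distr M borel A \<Otimes>\<^sub>M distr M borel U))"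
    unfolding dist by (subst integral_distr) auto
  also have "\<dots> = (\<integral>a. (\<integral>u. F (a + u) \<partial>distr M borel U) \<partial>distr M borel A)"
    using AU.integral_fst[OF int] by simp
  also have "\<dots> = (\<integral>\<omega>. (\<integral>v. F (A \<omega> + D *v v) * gauss t v \<partial>lborel) \<partial>M)"
    unfolding UV by (rule integral_distr) auto
  finally show ?thesis .
qed

section \<open>Test functions of the initial value as functions of the observation\<close>

lemma lip_norm_lipschitz_on:
  assumes "lip_norm f \<le> ennreal L" "0 \<le> L"
  shows "L-lipschitz_on UNIV f"
proof (rule lipschitz_onI)
  fix x y
  show "dist (f x) (f y) \<le> L * dist x y"
  proof (cases "x = y")
    case False
    then have "ennreal (dist (f x) (f y) / dist x y) \<le> lip_norm f"
      unfolding lip_norm_def by (intro SUP_upper2[of "(x, y)"]) auto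
    also note assms(1)
    finally show ?thesis
      using False assms(2) by (simp add: field_simps)
  qed simp
qed fact

text \<open>Chain of approximations: \<open>f (X 0)\<close> is close in mean to \<open>g (Z)\<close>
  by the reconstruction, \<open>g (Z)\<close> is uniformly within \<epsilon> of the noise-averaged
  \<open>F\<close>, and the mean of the latter is exactly that of \<open>F (Y t)\<close>.\<close>

lemma hmm_test_function_error:
  fixes X :: "real \<Rightarrow> 'w \<Rightarrow> real^'q" and D :: "real^'r^'q" and \<sigma> :: "real^'q \<Rightarrow> real^'p^'q"
    and f g F :: "real^'q \<Rightarrow> real"
  assumes sol: "hmm_solution b \<sigma> h D M W V X Y"
    and b: "L-lipschitz_on UNIV b" and k: "\<kappa>-lipschitz_on UNIV k" and \<sigma>: "\<And>x. norm (\<sigma> x) \<le> B" and "B > 0" "t > 0"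
    and h: "continuous_on UNIV h" and Ch: "\<And>x. C' *v h x = x + k x"
    and f: "\<And>x. \<bar>f x\<bar> \<le> 1" "f \<in> borel_measurable borel"
    and g: "\<And>x. \<bar>g x\<bar> \<le> 1" "g \<in> borel_measurable borel"
    and fg: "\<And>x. continuous_on {0..t} x \<Longrightarrow> \<bar>g (mean_obs k t x) - f (x 0)\<bar> \<le> c * mean_noise b t x" and "c > 0"
    and F: "F \<in> borel_measurable borel" "\<And>x. \<bar>F x\<bar> \<le> B'"
    and Fg: "\<And>x. \<bar>(\<integral>v. F (x + D *v v) * gauss t v \<partial>lborel) - g ((C' *v x) /\<^sub>R t)\<bar> \<le> \<epsilon>"
  shows "\<bar>(\<integral>\<omega>. f (X 0 \<omega>) \<partial>M) - (\<integral>\<omega>. F (Y t \<omega>) \<partial>M)\<bar> \<le> c * (2 * B * sqrt (real CARD('p) * t)) + \<epsilon>"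
proof -
  note sol' = hmm_solutionD[OF sol]
  interpret prob_space M by (rule sol'(1))
  have Wm: "\<forall>r\<ge>0. W r \<in> borel_measurable M"
    using sol'(2) by (simp add: wiener_process_def)
  note aug = augmented_filtration_props[OF sol'(4) Wm]
  obtain A where A: "A \<in> borel_measurable (augmented_filtration M (X 0) W t)"
    and AI: "AE \<omega> in M. A \<omega> = integral {0..t} (\<lambda>s. h (X s \<omega>))"
    using hmm_integrated_signal[OF sol h \<open>t > 0\<close>] by blast
  have Am[measurable]: "A \<in> borel_measurable M"
    using A aug(1,2) measurable_mono[OF order_refl refl, of "augmented_filtration M (X 0) W t" M borel] by blast
  have Xm[measurable]: "X 0 \<in> borel_measurable M" by (rule sol'(4))
  note [measurable] = f(2) g(2) F(1)
  define Z where "Z \<omega> = (C' *v A \<omega>) /\<^sub>R t" for \<omega>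
  have [measurable]: "(\<lambda>x. C' *v x) \<in> borel_measurable borel"
    by measurable
  have [measurable]: "Z \<in> borel_measurable M"
    unfolding Z_def[abs_def] by measurable
  define d where "d \<omega> = \<bar>g (Z \<omega>) - f (X 0 \<omega>)\<bar>" for \<omega>
  have dm[measurable]: "d \<in> borel_measurable M"
    unfolding d_def[abs_def] by measurable
  \<comment> \<open>Dividing by \<open>c\<close> lets the bound on the nonnegative integral of the
    mean noise apply directly.\<close>
  have "AE \<omega> in M. ennreal (d \<omega> / c) \<le> ennreal (mean_noise b t (\<lambda>s. X s \<omega>))"
    using AI sol'(8)
  proof eventually_elim
    case (elim \<omega>)
    have x: "continuous_on {0..t} (\<lambda>s. X s \<omega>)"
      using elim(2) by (rule continuous_on_subset) auto
    have "continuous_on {0..t} (\<lambda>s. h (X s \<omega>))"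
      by (rule continuous_on_compose2[OF h x]) auto
    then have "(\<lambda>s. h (X s \<omega>)) integrable_on {0..t}"
      by (rule integrable_continuous_interval)
    \<comment> \<open>The matrix \<open>C'\<close> moves inside the time integral and turns
      \<open>h\<close> into \<open>x + k x\<close>, which identifies \<open>Z\<close> with
      \<open>mean_obs\<close>.\<close>
    from integral_linear[OF this matrix_vector_mul_bounded_linear, of C']
    have "C' *v A \<omega> = integral {0..t} (\<lambda>s. X s \<omega> + k (X s \<omega>))"
      by (simp add: elim(1) comp_def Ch)
    then have Z: "Z \<omega> = mean_obs k t (\<lambda>s. X s \<omega>)"
      by (simp add: Z_def mean_obs_def)
    have "d \<omega> \<le> c * mean_noise b t (\<lambda>s. X s \<omega>)"
      unfolding d_def Z by (rule fg[OF x])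
    then show ?case
      using \<open>c > 0\<close> by (intro ennreal_leI) (simp add: field_simps)
  qed
  then have "(\<integral>\<^sup>+\<omega>. ennreal (d \<omega> / c) \<partial>M) \<le> (\<integral>\<^sup>+\<omega>. ennreal (mean_noise b t (\<lambda>s. X s \<omega>)) \<partial>M)"
    by (rule nn_integral_mono_AE)
  also have "\<dots> \<le> ennreal (2 * B * sqrt (real CARD('p) * t))"
    by (rule hmm_mean_noise_bound[OF sol b \<sigma> \<open>B > 0\<close> \<open>t > 0\<close>])
  finally have nd: "(\<integral>\<^sup>+\<omega>. ennreal (d \<omega> / c) \<partial>M) \<le> ennreal (2 * B * sqrt (real CARD('p) * t))" .
  have d2: "\<bar>d \<omega>\<bar> \<le> 2" for \<omega>
    using f(1)[of "X 0 \<omega>"] g(1)[of "Z \<omega>"] unfolding d_def by linarith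
  have dint: "integrable M d"
    by (rule integrable_const_bound[where B=2]) (use d2 in auto)
  have "ennreal (\<integral>\<omega>. d \<omega> / c \<partial>M) = (\<integral>\<^sup>+\<omega>. ennreal (d \<omega> / c) \<partial>M)"
    using \<open>c > 0\<close> by (intro nn_integral_eq_integral[symmetric] integrable_divide[OF dint]) (auto simp: d_def)
  with nd have "ennreal (\<integral>\<omega>. d \<omega> / c \<partial>M) \<le> ennreal (2 * B * sqrt (real CARD('p) * t))"
    by (rule ord_eq_le_trans[rotated])
  then have "(\<integral>\<omega>. d \<omega> / c \<partial>M) \<le> 2 * B * sqrt (real CARD('p) * t)"
    by (rule ennreal_le_iff[THEN iffD1, rotated]) (use \<open>B > 0\<close> \<open>t > 0\<close> in simp)
  then have Ed: "(\<integral>\<omega>. d \<omega> \<partial>M) \<le> c * (2 * B * sqrt (real CARD('p) * t))"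
    using \<open>c > 0\<close> by (simp add: field_simps)
  have fint: "integrable M (\<lambda>\<omega>. f (X 0 \<omega>))"
    by (rule integrable_const_bound[where B=1]) (use f(1) in auto)
  have gint: "integrable M (\<lambda>\<omega>. g (Z \<omega>))"
    by (rule integrable_const_bound[where B=1]) (use g(1) in auto)
  define G where "G x = (\<integral>v. F (x + D *v v) * gauss t v \<partial>lborel)" for x
  have [measurable]: "G \<in> borel_measurable borel"
    unfolding G_def[abs_def] by measurable
  have Gg: "\<bar>G (A \<omega>) - g (Z \<omega>)\<bar> \<le> \<epsilon>" for \<omega>
    using Fg[of "A \<omega>"] by (simp add: G_def Z_def)
  have Gint: "integrable M (\<lambda>\<omega>. G (A \<omega>))"
  proof (rule integrable_const_bound[where B="1 + \<epsilon>"])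
    have "\<bar>G (A \<omega>)\<bar> \<le> 1 + \<epsilon>" for \<omega>
      using Gg[of \<omega>] g(1)[of "Z \<omega>"] by linarith
    then show "AE \<omega> in M. norm (G (A \<omega>)) \<le> 1 + \<epsilon>" by simp
  qed measurable
  have "(\<integral>\<omega>. F (Y t \<omega>) \<partial>M) = (\<integral>\<omega>. G (A \<omega>) \<partial>M)"
    unfolding G_def by (rule hmm_observation_law[OF sol \<open>t > 0\<close> A AI F])
  moreover have "\<bar>(\<integral>\<omega>. f (X 0 \<omega>) \<partial>M) - (\<integral>\<omega>. g (Z \<omega>) \<partial>M)\<bar> \<le> (\<integral>\<omega>. d \<omega> \<partial>M)"
    unfolding d_def abs_minus_commute[of "g _"] Bochner_Integration.integral_diff[OF fint gint, symmetric]
    by (rule integral_abs_bound)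
  moreover have "\<bar>(\<integral>\<omega>. G (A \<omega>) \<partial>M) - (\<integral>\<omega>. g (Z \<omega>) \<partial>M)\<bar> \<le> \<epsilon>"
  proof -
    have "\<bar>(\<integral>\<omega>. G (A \<omega>) - g (Z \<omega>) \<partial>M)\<bar> \<le> (\<integral>\<omega>. \<bar>G (A \<omega>) - g (Z \<omega>)\<bar> \<partial>M)"
      by (rule integral_abs_bound)
    also have "\<dots> \<le> (\<integral>\<omega>. \<epsilon> \<partial>M)"
      using Gint gint Gg by (intro integral_mono) auto
    finally show ?thesis
      using Gint gint by (simp add: prob_space)
  qed
  ultimately show ?thesis
    using Ed by linarith
qed

text \<open>A function of one observation is measurable for the observation \<sigma>-field, so its
  integral is unchanged by restricting the law and can be computed on the space that carries the
  solution.\<close>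

lemma hmm_law_observation:
  fixes P :: "(real \<Rightarrow> (real^'q) \<times> (real^'q)) measure" and F :: "real^'q \<Rightarrow> real"
  assumes sol: "hmm_solution b \<sigma> h D M W V X Y"
    and P: "P = distr M (path_space {0..}) (sample_path {0..} (\<lambda>t \<omega>. (X t \<omega>, Y t \<omega>)))"
    and t: "t \<ge> 0" and F: "F \<in> borel_measurable borel"
  shows "prob_space P" "subalgebra P obs_algebra"
    and "(\<lambda>z. F (snd (z t))) \<in> borel_measurable obs_algebra"
    and "(\<integral>z. F (snd (z t)) \<partial>restr_to_subalg P obs_algebra) = (\<integral>\<omega>. F (Y t \<omega>) \<partial>M)"
proof -
  note sol' = hmm_solutionD[OF sol]
  interpret prob_space M by (rule sol'(1))
  have m: "sample_path {0..} (\<lambda>t \<omega>. (X t \<omega>, Y t \<omega>)) \<in> measurable M (path_space {0..})"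
    using hmm_signal_measurable(2)[OF sol _ order_refl] sol'(7)
    by (intro sample_path_measurable borel_measurable_Pair) auto
  show "prob_space P"
    unfolding P by (rule prob_space_distr[OF m])
  have sets: "sets P = sets (path_space {0..})"
    by (simp add: P)
  have space: "space P = space (path_space {0..})"
    by (simp add: P)
  have "sample_path {0..} (\<lambda>t z. snd (z t)) \<in> measurable (path_space {0..} :: (real \<Rightarrow> (real^'q) \<times> (real^'q)) measure)
      (path_space {0..} :: (real \<Rightarrow> real^'q) measure)"
  proof (rule sample_path_measurable)
    fix r :: real assume "r \<in> {0..}"
    then have "(\<lambda>z. z r) \<in> measurable (path_space {0..}) (borel :: ((real^'q) \<times> (real^'q)) measure)"
      by (rule measurable_component_singleton)
    then show "(\<lambda>z. snd (z r)) \<in> borel_measurable (path_space {0..} :: (real \<Rightarrow> (real^'q) \<times> (real^'q)) measure)"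
      by (rule measurable_compose[OF _ borel_measurable_continuous_onI[OF continuous_on_snd[OF continuous_on_id]]])
  qed
  then show sub: "subalgebra P obs_algebra"
    unfolding subalgebra_def obs_algebra_def using sets space by (simp add: sets_vimage_algebra_subset)
  show Fm: "(\<lambda>z. F (snd (z t))) \<in> borel_measurable obs_algebra"
    unfolding obs_algebra_def using t by (intro measurable_compose[OF sample_path_component F]) auto
  have "(\<integral>z. F (snd (z t)) \<partial>restr_to_subalg P obs_algebra) = (\<integral>z. F (snd (z t)) \<partial>P)"
    by (rule integral_subalgebra2[OF sub Fm])
  also have "\<dots> = (\<integral>\<omega>. F (Y t \<omega>) \<partial>M)"
  proof -
    have "(\<lambda>z. F (snd (z t))) \<in> borel_measurable P"
      using Fm sub by (rule measurable_from_subalg[rotated])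
    then have "(\<lambda>z. F (snd (z t))) \<in> borel_measurable (path_space {0..} :: (real \<Rightarrow> (real^'q) \<times> (real^'q)) measure)"
      by (simp cong: measurable_cong_sets add: sets)
    then show ?thesis
      unfolding P using t by (subst integral_distr[OF m]) (simp_all add: sample_path_def)
  qed
  finally show "(\<integral>z. F (snd (z t)) \<partial>restr_to_subalg P obs_algebra) = (\<integral>\<omega>. F (Y t \<omega>) \<partial>M)" .
qed

lemma (in prob_space) abs_expectation_le_1:
  fixes f :: "'a \<Rightarrow> real"
  assumes f: "f \<in> borel_measurable M" "\<And>x. x \<in> space M \<Longrightarrow> \<bar>f x\<bar> \<le> 1"
  shows "\<bar>\<integral>x. f x \<partial>M\<bar> \<le> 1"
proof -
  have "integrable M f"
    by (rule integrable_const_bound[where B=1]) (use f in auto)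
  have "\<bar>\<integral>x. f x \<partial>M\<bar> \<le> (\<integral>x. \<bar>f x\<bar> \<partial>M)"
    by (rule integral_abs_bound)
  also have "\<dots> \<le> 1"
    using \<open>integrable M f\<close> f by (intro integral_le_const integrable_abs) auto
  finally show ?thesis .
qed

text \<open>After division by \<open>B\<close> the function is admissible in the supremum.\<close>

lemma tv_dist_upper:
  fixes f :: "'a \<Rightarrow> real"
  assumes "prob_space P" "prob_space Q" "sets P = sets Q" "f \<in> borel_measurable P" "\<And>x. \<bar>f x\<bar> \<le> B" "B > 0"
  shows "\<bar>(\<integral>x. f x \<partial>P) - (\<integral>x. f x \<partial>Q)\<bar> \<le> B * tv_dist P Q"
proof -
  interpret P: prob_space P by fact
  interpret Q: prob_space Q by fact
  let ?S = "{f :: 'a \<Rightarrow> real. f \<in> borel_measurable P \<and> ( \<forall>x\<in>space P. \<bar>f x\<bar> \<le> 1)}"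
  have space: "space P = space Q"
    using assms(3) by (rule sets_eq_imp_space_eq)
  \<comment> \<open>A real supremum dominates its elements only if the set is bounded above; 2 is
    such a bound.\<close>
  have "\<bar>(\<integral>x. g x \<partial>P) - (\<integral>x. g x \<partial>Q)\<bar> \<le> 2" if g: "g \<in> ?S" for g
  proof -
    have gQ: "g \<in> borel_measurable Q"
      using g by (simp cong: measurable_cong_sets add: assms(3)[symmetric])
    have "\<bar>\<integral>x. g x \<partial>P\<bar> \<le> 1" "\<bar>\<integral>x. g x \<partial>Q\<bar> \<le> 1"
      using P.abs_expectation_le_1[of g] Q.abs_expectation_le_1[of g] g gQ space by auto
    then show ?thesis by linarith
  qed
  then have bdd: "bdd_above ((\<lambda>f. \<bar>(\<integral>x. f x \<partial>P) - (\<integral>x. f x \<partial>Q)\<bar>) ` ?S)"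
    by (auto simp: bdd_above_def)
  have "(\<lambda>x. f x / B) \<in> ?S"
    using assms by auto
  from cSUP_upper[OF this bdd] have "\<bar>(\<integral>x. f x / B \<partial>P) - (\<integral>x. f x / B \<partial>Q)\<bar> \<le> tv_dist P Q"
    by (simp add: tv_dist_def)
  then show ?thesis
    using assms(6) by (simp add: field_simps flip: diff_divide_distrib)
qed

section \<open>From total variation of the observations to the initial laws\<close>

theorem theorem3p9:
  fixes b :: "real^'q \<Rightarrow> real^'q"
    and \<sigma> :: "real^'q \<Rightarrow> real^'p^'q"
    and h h\<^sub>0 :: "real^'q \<Rightarrow> real^'q"
    and C :: "real^'q^'q"
    and D :: "real^'r^'q"
    and \<mu> \<nu> :: "nat \<Rightarrow> (real^'q) measure"
    and P Q :: "nat \<Rightarrow> (real \<Rightarrow> (real^'q) \<times> (real^'q)) measure"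
  assumes "\<exists>L. L-lipschitz_on UNIV b"
    and "\<exists>L. L-lipschitz_on UNIV \<sigma>"
    and "bounded (range \<sigma>)"
    and "\<And>x. h x = C *v x + h\<^sub>0 x"
    and "invertible C"
    and "lip_norm (\<lambda>x. matrix_inv C *v h\<^sub>0 x) < 1"
    and "\<And>n. \<mu> n \<in> borel_prob"
    and "\<And>n. \<nu> n \<in> borel_prob"
    and "\<And>n. is_hmm_law TYPE('w) b \<sigma> h D (\<mu> n) (P n)"
    and "\<And>n. is_hmm_law TYPE('w) b \<sigma> h D (\<nu> n) (Q n)"
    and "(\<lambda>n. tv_dist (restr_to_subalg (P n) obs_algebra) (restr_to_subalg (Q n) obs_algebra))
           \<longlonglongrightarrow> 0"
  shows "(\<lambda>n. bl_dist (\<mu> n) (\<nu> n)) \<longlonglongrightarrow> 0"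
proof -
  obtain L where L: "L-lipschitz_on UNIV b"
    using assms(1) by blast
  then have L0: "L \<ge> 0" by (simp add: lipschitz_on_def)
  obtain B where B: "B > 0" "\<And>x. norm (\<sigma> x) \<le> B"
    using assms(3) unfolding bounded_pos by auto
  define C' where "C' = matrix_inv C"
  define k where "k x = C' *v h\<^sub>0 x" for x
  \<comment> \<open>The conversion loses nothing, since the Lipschitz constant is below 1 and hence
    finite.\<close>
  define \<kappa> where "\<kappa> = enn2real (lip_norm k)"
  have lipk: "lip_norm k < 1"
    using assms(6) by (simp add: k_def[abs_def] C'_def)
  then have lk: "lip_norm k = ennreal \<kappa>"
    by (auto simp: \<kappa>_def less_top[symmetric] intro!: ennreal_enn2real[symmetric] dest: order_less_trans[OF _ ennreal_one_less_top])
  have \<kappa>: "0 \<le> \<kappa>" "\<kappa> < 1"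
    using lipk unfolding lk by (simp_all add: \<kappa>_def)
  have k: "\<kappa>-lipschitz_on UNIV k"
    by (rule lip_norm_lipschitz_on) (simp_all add: lk \<kappa>)
  have inv: "C' ** C = mat 1" "C ** C' = mat 1"
    using someI_ex[OF assms(5)[unfolded invertible_def]] by (simp_all add: C'_def matrix_inv_def)
  have Ch: "C' *v h x = x + k x" for x
    using inv by (simp add: assms(4) matrix_vector_right_distrib matrix_vector_mul_assoc k_def)
  \<comment> \<open>Continuity of \<open>h\<close> follows from that of \<open>k\<close>, by
    applying \<open>C\<close> to the transformed observation function.\<close>
  have "h x = C *v (x + k x)" for x
    unfolding Ch[symmetric] using inv by (simp add: matrix_vector_mul_assoc)
  then have "h = (\<lambda>x. C *v (x + k x))" by auto
  moreover have "continuous_on UNIV (\<lambda>x. C *v (x + k x))"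
    by (rule continuous_on_compose2[OF linear_continuous_on[OF matrix_vector_mul_bounded_linear, of UNIV C]])
      (use lipschitz_on_continuous_on[OF k] in \<open>auto intro!: continuous_intros\<close>)
  ultimately have h: "continuous_on UNIV h" by simp
  obtain d where d: "d > 0" "\<And>v. norm (C' *v v) \<le> norm v * d"
    using linear_bounded_pos[OF matrix_vector_mul_linear[of C']] by (metis mult.commute)
  define tv where "tv n = tv_dist (restr_to_subalg (P n) obs_algebra) (restr_to_subalg (Q n) obs_algebra)" for n
  have tv: "tv \<longlonglongrightarrow> 0"
    using assms(11) unfolding tv_def[abs_def] .
  \<comment> \<open>The constant may depend on \<epsilon> but not on \<open>n\<close>. This
    uniformity is what makes the limit work for arbitrary sequences of initial laws.\<close>
  have key: "\<exists>B'>0. \<forall>n. \<bar>bl_dist (\<mu> n) (\<nu> n)\<bar> \<le> \<epsilon> + B' * tv n" if \<epsilon>: "\<epsilon> > 0" for \<epsilon>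
  proof -
    \<comment> \<open>\<open>K\<close> bounds the stability constant \<open>c\<close> for every
      \<open>t\<close> with \<open>2 * (L * t) \<le> (1 - \<kappa>) / 2\<close>, so it can be fixed
      before \<open>t\<close>. Then \<delta> is chosen to make the noise error
      \<open>2 * K * (2 * B * \<delta>)\<close> equal to \<open>\<epsilon> / 4\<close>.\<close>
    define K where "K = 2 / (1 - \<kappa>)"
    have K: "K > 0" using \<kappa> by (simp add: K_def)
    define \<delta> where "\<delta> = \<epsilon> / (16 * K * B)"
    have \<delta>: "\<delta> > 0" using K B \<epsilon> by (simp add: \<delta>_def)
    \<comment> \<open>The first entry keeps the drift small, with \<open>L + 1\<close> to cover
      \<open>L = 0\<close>; the second gives
      \<open>sqrt (CARD('p) * t) \<le> \<delta>\<close>.\<close>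
    define t where "t = min ((1 - \<kappa>) / (4 * (L + 1))) (\<delta>\<^sup>2 / real CARD('p))"
    have t: "t > 0" using \<kappa> L0 \<delta> by (simp add: t_def)
    have Lt: "2 * (L * t) \<le> (1 - \<kappa>) / 2"
    proof -
      have "2 * (L * t) \<le> 2 * ((L + 1) * t)"
        using L0 t by (intro mult_left_mono mult_right_mono) auto
      also have "\<dots> \<le> 2 * ((L + 1) * ((1 - \<kappa>) / (4 * (L + 1))))"
        using L0 by (intro mult_left_mono) (auto simp: t_def)
      also have "\<dots> = (1 - \<kappa>) / 2"
        using L0 by (simp add: field_simps)
      finally show ?thesis .
    qed
    then have t1: "2 * (L * t) + \<kappa> < 1" using \<kappa> by simp
    define c where "c = 1 / (1 - (2 * (L * t) + \<kappa>))"
    have c: "c > 0" "c \<le> K"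
    proof -
      show "c > 0" using t1 by (simp add: c_def)
      have "1 / (1 - (2 * (L * t) + \<kappa>)) \<le> 1 / ((1 - \<kappa>) / 2)"
        using Lt \<kappa> by (intro divide_left_mono) auto
      then show "c \<le> K" by (simp add: c_def K_def)
    qed
    have "sqrt (real CARD('p) * t) \<le> sqrt (\<delta>\<^sup>2)"
      by (intro real_sqrt_le_mono) (simp add: t_def min_def field_simps)
    then have "sqrt (real CARD('p) * t) \<le> \<delta>" using \<delta> by simp
    then have "2 * c * (2 * B * sqrt (real CARD('p) * t)) \<le> 2 * K * (2 * B * \<delta>)"
      using c K B \<delta> t by (intro mult_mono) auto
    also have "\<dots> = \<epsilon> / 4"
      using K B by (simp add: \<delta>_def field_simps)
    finally have noise: "2 * c * (2 * B * sqrt (real CARD('p) * t)) \<le> \<epsilon> / 4" .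
    \<comment> \<open>\<open>c * d / t\<close> is the Lipschitz constant of \<open>g\<close>
      composed with \<open>x \<mapsto> (C' *v x) /\<^sub>R t\<close>.\<close>
    have cd: "0 \<le> c * d / t" using c d t by simp
    have e4: "\<epsilon> / 4 > 0" using \<epsilon> by simp
    \<comment> \<open>Fixed before the test function and the index, so that it serves all of
      them.\<close>
    obtain B' where B': "B' > 0" and dec: "\<And>g :: real^'q \<Rightarrow> real. (\<And>x. \<bar>g x\<bar> \<le> 1) \<Longrightarrow> (\<And>x y. \<bar>g x - g y\<bar> \<le> c * d / t * norm (x - y)) \<Longrightarrow>
      \<exists>F. F \<in> borel_measurable borel \<and> (\<forall>x. \<bar>F x\<bar> \<le> B') \<and>
        (\<forall>x. \<bar>(\<integral>v. F (x + D *v v) * gauss t v \<partial>lborel) - g x\<bar> \<le> \<epsilon> / 4)"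
    proof (rule gaussian_deconvolution[OF t e4 cd, where D=D])
      fix B' :: real
      assume "B' > 0" and "\<And>g :: real^'q \<Rightarrow> real. (\<And>x. \<bar>g x\<bar> \<le> 1) \<Longrightarrow> (\<And>x y. \<bar>g x - g y\<bar> \<le> c * d / t * norm (x - y)) \<Longrightarrow>
        \<exists>F. F \<in> borel_measurable borel \<and> (\<forall>x. \<bar>F x\<bar> \<le> B') \<and>
          (\<forall>x. \<bar>(\<integral>v. F (x + D *v v) * gauss t v \<partial>lborel) - g x\<bar> \<le> \<epsilon> / 4)"
      then show thesis by (rule that)
    qed
    have bound: "\<bar>(\<integral>x. f x \<partial>\<mu> n) - (\<integral>x. f x \<partial>\<nu> n)\<bar> \<le> \<epsilon> + B' * tv n"
      if f1: "\<And>x. \<bar>f x\<bar> \<le> 1" and fL: "lip_norm f \<le> 1" for f :: "real^'q \<Rightarrow> real" and n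
    proof -
      have flip: "1-lipschitz_on UNIV f"
        using fL by (intro lip_norm_lipschitz_on) auto
      then have f2: "\<bar>f x - f y\<bar> \<le> norm (x - y)" for x y
        using lipschitz_onD[OF flip, of x y] by (simp add: dist_norm)
      have fm: "f \<in> borel_measurable borel"
        by (rule borel_measurable_continuous_onI[OF lipschitz_on_continuous_on[OF flip]])
      obtain g where g: "\<And>z. \<bar>g z\<bar> \<le> 1" "\<And>z w. \<bar>g z - g w\<bar> \<le> c * norm (z - w)"
        "\<And>x. continuous_on {0..t} x \<Longrightarrow> \<bar>g (mean_obs k t x) - f (x 0)\<bar> \<le> 2 * c * mean_noise b t x"
        using initial_value_reconstruction[OF L k t t1 f1 f2] unfolding c_def by blast
      have "c-lipschitz_on UNIV g"
        using g(2) c by (auto simp: lipschitz_on_def dist_norm)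
      then have gm: "g \<in> borel_measurable borel"
        by (intro borel_measurable_continuous_onI lipschitz_on_continuous_on)
      have "\<bar>g ((C' *v x) /\<^sub>R t) - g ((C' *v y) /\<^sub>R t)\<bar> \<le> c * d / t * norm (x - y)" for x y
      proof -
        have "norm ((C' *v x) /\<^sub>R t - (C' *v y) /\<^sub>R t) = norm (C' *v (x - y)) / t"
          using t by (simp add: matrix_vector_mult_diff_distrib divide_inverse_commute flip: scaleR_diff_right)
        also have "\<dots> \<le> norm (x - y) * d / t"
          using d(2)[of "x - y"] t by (intro divide_right_mono) auto
        finally have "c * norm ((C' *v x) /\<^sub>R t - (C' *v y) /\<^sub>R t) \<le> c * (norm (x - y) * d / t)"
          using c by (intro mult_left_mono) auto
        with g(2)[of "(C' *v x) /\<^sub>R t" "(C' *v y) /\<^sub>R t"] show ?thesis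
          by (simp add: mult_ac)
      qed
      then obtain F where F: "F \<in> borel_measurable borel" "\<And>x. \<bar>F x\<bar> \<le> B'"
        and Fg: "\<And>x. \<bar>(\<integral>v. F (x + D *v v) * gauss t v \<partial>lborel) - g ((C' *v x) /\<^sub>R t)\<bar> \<le> \<epsilon> / 4"
        using dec[of "\<lambda>x. g ((C' *v x) /\<^sub>R t)"] g(1) by blast
      let ?obs = "\<lambda>R :: (real \<Rightarrow> (real^'q) \<times> (real^'q)) measure. \<integral>z. F (snd (z t)) \<partial>restr_to_subalg R obs_algebra"
      \<comment> \<open>For either initial law the error is \<open>\<epsilon> / 4\<close> from the
        signal noise plus \<open>\<epsilon> / 4\<close> from the deconvolution, with the same
        \<open>F\<close> for both laws. Together they cost \<epsilon>.\<close>
      have law: "prob_space R \<and> subalgebra R obs_algebra \<and>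
          (\<lambda>z. F (snd (z t))) \<in> borel_measurable obs_algebra \<and> \<bar>(\<integral>x. f x \<partial>\<rho>) - ?obs R\<bar> \<le> \<epsilon> / 2"
        if hl: "is_hmm_law TYPE('w) b \<sigma> h D \<rho> R" for \<rho> R
      proof -
        obtain M :: "'w measure" and W V X Y where sol: "hmm_solution b \<sigma> h D M W V X Y"
          and \<rho>: "distr M borel (X 0) = \<rho>"
          and R: "R = distr M (path_space {0..}) (sample_path {0..} (\<lambda>t \<omega>. (X t \<omega>, Y t \<omega>)))"
          using hl unfolding is_hmm_law_def by blast
        note obs = hmm_law_observation[OF sol R less_imp_le[OF t] F(1)]
        have "(\<integral>x. f x \<partial>\<rho>) = (\<integral>\<omega>. f (X 0 \<omega>) \<partial>M)"
          unfolding \<rho>[symmetric] by (rule integral_distr[OF hmm_solutionD(4)[OF sol] fm])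
        moreover have "\<bar>(\<integral>\<omega>. f (X 0 \<omega>) \<partial>M) - (\<integral>\<omega>. F (Y t \<omega>) \<partial>M)\<bar> \<le> 2 * c * (2 * B * sqrt (real CARD('p) * t)) + \<epsilon> / 4"
          using c by (intro hmm_test_function_error[OF sol L k B(2,1) t h Ch f1 fm g(1) gm g(3) _ F Fg]) auto
        ultimately show ?thesis
          using obs noise by auto
      qed
      note \<mu> = law[OF assms(9)[of n]] and \<nu> = law[OF assms(10)[of n]]
      have "\<bar>?obs (P n) - ?obs (Q n)\<bar> \<le> B' * tv n"
        unfolding tv_def
        using \<mu> \<nu> F(2) B'
        by (intro tv_dist_upper prob_space_restr_to_subalg)
          (auto simp: sets_restr_to_subalg measurable_in_subalg)
      with \<mu> \<nu> show ?thesis by linarith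
    qed
    show ?thesis
    proof (intro exI conjI allI, rule B')
      fix n
      let ?S = "{f :: real^'q \<Rightarrow> real. (\<forall>x. \<bar>f x\<bar> \<le> 1) \<and> lip_norm f \<le> 1}"
      have 0: "(\<lambda>_. 0) \<in> ?S"
        by (auto simp: lip_norm_def intro!: SUP_least)
      \<comment> \<open>The bound just proved also shows that the real supremum in
        \<open>bl_dist\<close> is over a bounded set; the zero function then makes it
        nonnegative.\<close>
      have "bdd_above ((\<lambda>f. \<bar>(\<integral>x. f x \<partial>\<mu> n) - (\<integral>x. f x \<partial>\<nu> n)\<bar>) ` ?S)"
        using bound by (intro bdd_aboveI2[where M="\<epsilon> + B' * tv n"]) auto
      from cSUP_upper[OF 0 this] have "0 \<le> bl_dist (\<mu> n) (\<nu> n)"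
        by (simp add: bl_dist_def)
      moreover have "bl_dist (\<mu> n) (\<nu> n) \<le> \<epsilon> + B' * tv n"
        unfolding bl_dist_def
      proof (rule cSUP_least)
        have "x \<in> A \<Longrightarrow> A \<noteq> {}" for x :: "real^'q \<Rightarrow> real" and A by blast
        from this[OF 0] show "?S \<noteq> {}" .
      qed (use bound in auto)
      ultimately show "\<bar>bl_dist (\<mu> n) (\<nu> n)\<bar> \<le> \<epsilon> + B' * tv n" by simp
    qed
  qed
  show ?thesis
  proof (rule LIMSEQ_I)
    fix r :: real assume r: "r > 0"
    obtain B' where B': "B' > 0" "\<And>n. \<bar>bl_dist (\<mu> n) (\<nu> n)\<bar> \<le> r / 2 + B' * tv n"
      using key[of "r / 2"] r by auto
    have "(\<lambda>n. r / 2 + B' * tv n) \<longlonglongrightarrow> r / 2 + B' * 0"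
      by (intro tendsto_intros tv)
    then have "\<forall>\<^sub>F n in sequentially. r / 2 + B' * tv n < r"
      by (rule order_tendstoD(2)) (use r in simp)
    then obtain N where "\<And>n. n \<ge> N \<Longrightarrow> r / 2 + B' * tv n < r"
      unfolding eventually_sequentially by blast
    with B'(2) have "\<bar>bl_dist (\<mu> n) (\<nu> n)\<bar> < r" if "n \<ge> N" for n
      using that by (meson order_le_less_trans)
    then show "\<exists>no. \<forall>n\<ge>no. norm (bl_dist (\<mu> n) (\<nu> n) - 0) < r"
      by auto
  qed
qed

end
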